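(* Let $V$ be a finite dimensional $\mathbf{k}$-vector space with basis $\{v_1,\ldots,v_N\}$, let $\gamma\colon V^{\otimes 2}\to V^{\otimes 2}$ be an $R$-matrix with structure constants $c_{ij}^{mn}$ given by $\gamma(v_i\otimes v_j)=\sum_{m,n=1}^N c_{ij}^{mn}v_m\otimes v_n$, and let $A(\gamma)$ be the FRT quantum group associated to $\gamma$, with generators $T_i^j$, multiplication $\mu$, comultiplication $\Delta$ and cobraiding form $R$. Let $\lambda_1,\ldots,\lambda_N\in\mathbf{k}$ be invertible scalars such that $\lambda_i\lambda_jc_{ij}^{mn}=\lambda_m\lambda_nc_{ij}^{mn}$ for all $i,j,m,n\in\{1,\ldots,N\}$, and let $\alpha_A\colon A(\gamma)\to A(\gamma)$ be the bialgebra morphism determined by $\alpha_A(T_i^j)=\lambda_i\lambda_j^{-1}T_i^j$ for all $i,j$. Then there is a cobraided Hom-bialgebra $$A(\gamma)_\alpha=(A(\gamma),\ \mu_\alpha=\alpha_A\circ\mu,\ \Delta_\alpha=\Delta\circ\alpha_A,\ \alpha_A,\ R).$$ The Hom-cobraiding form $R$ is $\alpha$-invariant, i.e. $R=R\circ\alpha_A^{\otimes 2}$. The twisted comultiplication is given by $$\Delta_\alpha(T_i^j)=\lambda_i\lambda_j^{-1}\Delta(T_i^j)=\lambda_i\lambda_j^{-1}\sum_{k=1}^N T_i^k\otimes T_k^j.$$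
   Context: $\mathbf{k}$ is a field of characteristic $0$; tensor products and linear maps are over $\mathbf{k}$. Write $\Delta(x)=\sum x_1\otimes x_2$ (Sweedler). An $R$-matrix on $V$ is a linear automorphism $\gamma$ of $V^{\otimes 2}$ with $(\mathrm{Id}\otimes\gamma)\circ(\gamma\otimes\mathrm{Id})\circ(\mathrm{Id}\otimes\gamma)=(\gamma\otimes\mathrm{Id})\circ(\mathrm{Id}\otimes\gamma)\circ(\gamma\otimes\mathrm{Id})$ on $V^{\otimes 3}$. The FRT quantum group $A(\gamma)$: let $\{T_i^j\}_{1\le i,j\le N}$ be $N^2$ independent non-commuting variables, and let $A(\gamma)$ be the unital associative $\mathbf{k}$-algebra generated by the $T_i^j$ subject to the relations, for all $i,j,m,n\in\{1,\ldots,N\}$, $\sum_{k,l=1}^N c_{ij}^{kl}T_k^mT_l^n-\sum_{k,l=1}^N T_i^kT_j^lc_{kl}^{mn}=0$. It is a bialgebra with comultiplication the algebra morphism determined by $\Delta(T_i^j)=\sum_{k=1}^N T_i^k\otimes T_k^j$. It is a cobraided bialgebra with the bilinear form $R\colon A(\gamma)^{\otimes 2}\to\mathbf{k}$ determined by $R(T_i^m\otimes T_j^n)=c_{ji}^{mn}$ and $R(1\otimes T_i^j)=R(T_i^j\otimes 1)=\delta_{ij}$, and extended to all of $A(\gamma)^{\otimes 2}$ by the rules $R(xy\otimes z)=\sum R(x\otimes z_1)R(y\otimes z_2)$ and $R(x\otimes yz)=\sum R(x_1\otimes z)R(x_2\otimes y)$. (That $A(\gamma)$ is a well-defined cobraided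 bialgebra, i.e. that $R$ is well defined and also satisfies $\sum y_1x_1R(x_2\otimes y_2)=\sum R(x_1\otimes y_1)x_2y_2$, is a known fact.) A Hom-bialgebra $(A,\mu,\Delta,\alpha)$ consists of a $\mathbf{k}$-module $A$, a bilinear map $\mu\colon A^{\otimes 2}\to A$, written $xy=\mu(x,y)$, and linear maps $\Delta\colon A\to A^{\otimes 2}$, $\alpha\colon A\to A$ such that $\alpha\circ\mu=\mu\circ\alpha^{\otimes 2}$, $\mu\circ(\alpha\otimes\mu)=\mu\circ(\mu\otimes\alpha)$, $\alpha^{\otimes 2}\circ\Delta=\Delta\circ\alpha$, $(\alpha\otimes\Delta)\circ\Delta=(\Delta\otimes\alpha)\circ\Delta$, and $\Delta(ab)=\sum a_1b_1\otimes a_2b_2$ for all $a,b\in A$. A cobraided Hom-bialgebra $(A,\mu,\Delta,\alpha,R)$ is a Hom-bialgebra with a bilinear form $R\in\mathrm{Hom}(A^{\otimes 2},\mathbf{k})$ (the Hom-cobraiding form) such that for all $x,y,z\in A$: (1) $R(xy\otimes\alpha(z))=\sum R(\alpha(x)\otimes z_1)R(\alpha(y)\otimes z_2)$; (2) $R(\alpha(x)\otimes yz)=\sum R(x_1\otimes\alpha(z))R(x_2\otimes\alpha(y))$; (3) $\sum y_1x_1R(x_2\otimes y_2)=\sum R(x_1\otimes y_1)x_2y_2$. *)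

theory Defs
  imports Complex_Main "HOL-Library.Poly_Mapping"
begin

section \<open>Tensor products\<close>

text \<open>
  The type \<open>'x \<Rightarrow>\<^sub>0 'k\<close> of finitely supported functions is the free vector space on \<open>'x\<close>;
  \<open>Poly_Mapping.single x 1\<close> is the basis vector belonging to \<open>x\<close>.
\<close>

definition free_scale :: "'k::field \<Rightarrow> ('x \<Rightarrow>\<^sub>0 'k) \<Rightarrow> ('x \<Rightarrow>\<^sub>0 'k)" where
  "free_scale r p = Poly_Mapping.map ((*) r) p"

definition tensor_relators ::
    "('k::field \<Rightarrow> 'a \<Rightarrow> 'a::ab_group_add) \<Rightarrow> ('k \<Rightarrow> 'b \<Rightarrow> 'b::ab_group_add) \<Rightarrow> ('a \<times> 'b \<Rightarrow>\<^sub>0 'k) set"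
  where
  "tensor_relators sA sB =
     {Poly_Mapping.single (a + a', b) 1 - Poly_Mapping.single (a, b) 1
        - Poly_Mapping.single (a', b) 1 | a a' b. True} \<union>
     {Poly_Mapping.single (a, b + b') 1 - Poly_Mapping.single (a, b) 1
        - Poly_Mapping.single (a, b') 1 | a b b'. True} \<union>
     {Poly_Mapping.single (sA r a, b) 1 - Poly_Mapping.single (a, b) r | r a b. True} \<union>
     {Poly_Mapping.single (a, sB r b) 1 - Poly_Mapping.single (a, b) r | r a b. True}"

definition tensor_eval ::
    "('k::field \<Rightarrow> 't \<Rightarrow> 't::ab_group_add) \<Rightarrow> ('a \<Rightarrow> 'b \<Rightarrow> 't) \<Rightarrow> ('a \<times> 'b \<Rightarrow>\<^sub>0 'k) \<Rightarrow> 't" where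
  "tensor_eval sT t p = (\<Sum>(a, b)\<in>Poly_Mapping.keys p. sT (Poly_Mapping.lookup p (a, b)) (t a b))"

text \<open>
  HOL types cannot depend on the scalar multiplications, so a tensor product is not a type
  constructor here. Instead, the locale says that \<open>'t\<close> together with \<open>t a b = a \<otimes> b\<close> is (a copy of)
  the usual quotient of the free vector space on \<open>'a \<times> 'b\<close> by the bilinearity relations.
  Statements are made for every such copy.
\<close>

locale tensor_product =
  A: vector_space sA + B: vector_space sB + T: vector_space sT
  for sA :: "'k::field \<Rightarrow> 'a \<Rightarrow> 'a::ab_group_add"
    and sB :: "'k \<Rightarrow> 'b \<Rightarrow> 'b::ab_group_add"
    and sT :: "'k \<Rightarrow> 't \<Rightarrow> 't::ab_group_add" +
  fixes t :: "'a \<Rightarrow> 'b \<Rightarrow> 't"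
  assumes surj_eval: "surj (tensor_eval sT t)"
    and kernel_eval: "tensor_eval sT t p = 0 \<longleftrightarrow> p \<in> module.span free_scale (tensor_relators sA sB)"

text \<open>
  The linear map out of a tensor product that is given by a bilinear map \<open>\<beta>\<close>. In Sweedler notation,
  with \<open>\<Delta> x = \<Sum> x\<^sub>1 \<otimes> x\<^sub>2\<close>, the expression \<open>tensor_lift sT sC t \<beta> (\<Delta> x)\<close> is \<open>\<Sum> \<beta> x\<^sub>1 x\<^sub>2\<close>.
\<close>

definition tensor_lift ::
    "('k::field \<Rightarrow> 't \<Rightarrow> 't::ab_group_add) \<Rightarrow> ('k \<Rightarrow> 'c \<Rightarrow> 'c::ab_group_add) \<Rightarrow>
     ('a \<Rightarrow> 'b \<Rightarrow> 't) \<Rightarrow> ('a \<Rightarrow> 'b \<Rightarrow> 'c) \<Rightarrow> 't \<Rightarrow> 'c" where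
  "tensor_lift sT sC t \<beta> = (THE h. Vector_Spaces.linear sT sC h \<and> (\<forall>a b. h (t a b) = \<beta> a b))"

text \<open>
  A vector space \<open>'a\<close> with its tensor square \<open>'aa\<close> and its tensor cube \<open>'aaa\<close>. The cube is at the
  same time \<open>('a \<otimes> 'a) \<otimes> 'a\<close> (via \<open>tensl\<close>) and \<open>'a \<otimes> ('a \<otimes> 'a)\<close> (via \<open>tensr\<close>); the axiom
  \<open>tens_assoc\<close> is the usual identification of the two.
\<close>

record ('k, 'a, 'aa, 'aaa) tensor_space =
  scl :: "'k \<Rightarrow> 'a \<Rightarrow> 'a"
  scl2 :: "'k \<Rightarrow> 'aa \<Rightarrow> 'aa"
  scl3 :: "'k \<Rightarrow> 'aaa \<Rightarrow> 'aaa"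
  tens :: "'a \<Rightarrow> 'a \<Rightarrow> 'aa"  (infixl "\<otimes>\<index>" 70)
  tensl :: "'aa \<Rightarrow> 'a \<Rightarrow> 'aaa"
  tensr :: "'a \<Rightarrow> 'aa \<Rightarrow> 'aaa"

locale tensor_cube =
  fixes A :: "('k::field, 'a::ab_group_add, 'aa::ab_group_add, 'aaa::ab_group_add) tensor_space"
    (structure)
  assumes square: "tensor_product (scl A) (scl A) (scl2 A) (tens A)"
    and cube_left: "tensor_product (scl2 A) (scl A) (scl3 A) (tensl A)"
    and cube_right: "tensor_product (scl A) (scl2 A) (scl3 A) (tensr A)"
    and tens_assoc: "tensl A (x \<otimes> y) z = tensr A x (y \<otimes> z)"

definition tensor_map ::
    "('k::field \<Rightarrow> 't \<Rightarrow> 't::ab_group_add) \<Rightarrow> ('a \<Rightarrow> 'b \<Rightarrow> 't) \<Rightarrow>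
     ('k \<Rightarrow> 'u \<Rightarrow> 'u::ab_group_add) \<Rightarrow> ('c \<Rightarrow> 'd \<Rightarrow> 'u) \<Rightarrow>
     ('a \<Rightarrow> 'c) \<Rightarrow> ('b \<Rightarrow> 'd) \<Rightarrow> 't \<Rightarrow> 'u" where
  "tensor_map sT t sU u f g = tensor_lift sT sU t (\<lambda>a b. u (f a) (g b))"

abbreviation tensor_square_map ::
    "('k::field, 'a::ab_group_add, 'aa::ab_group_add, 'aaa) tensor_space \<Rightarrow>
     ('a \<Rightarrow> 'a) \<Rightarrow> 'aa \<Rightarrow> 'aa" where
  "tensor_square_map A f \<equiv> tensor_map (scl2 A) (tens A) (scl2 A) (tens A) f f"

text \<open>For \<open>\<mu>\<close> on \<open>'a\<close>, the multiplication \<open>(a \<otimes> b) (c \<otimes> d) = \<mu> (a \<otimes> c) \<otimes> \<mu> (b \<otimes> d)\<close> on \<open>'aa\<close>.\<close>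

definition tensor_mult ::
    "('k::field, 'a::ab_group_add, 'aa::ab_group_add, 'aaa) tensor_space \<Rightarrow>
     ('aa \<Rightarrow> 'a) \<Rightarrow> 'aa \<Rightarrow> 'aa \<Rightarrow> 'aa" where
  "tensor_mult A \<mu> X Y =
     tensor_lift (scl2 A) (scl2 A) (tens A)
       (\<lambda>a b. tensor_lift (scl2 A) (scl2 A) (tens A)
          (\<lambda>c d. tens A (\<mu> (tens A a c)) (\<mu> (tens A b d))) Y) X"

section \<open>$R$-matrices and Hom-bialgebras\<close>

definition R_matrix ::
    "('k::field, 'v::ab_group_add, 'vv::ab_group_add, 'vvv::ab_group_add) tensor_space \<Rightarrow>
     ('vv \<Rightarrow> 'vv) \<Rightarrow> bool" where
  "R_matrix V \<gamma> \<longleftrightarrow>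
     Vector_Spaces.linear (scl2 V) (scl2 V) \<gamma> \<and> bij \<gamma> \<and>
     (let id_\<gamma> = tensor_map (scl3 V) (tensr V) (scl3 V) (tensr V) id \<gamma>;
          \<gamma>_id = tensor_map (scl3 V) (tensl V) (scl3 V) (tensl V) \<gamma> id
      in id_\<gamma> \<circ> \<gamma>_id \<circ> id_\<gamma> = \<gamma>_id \<circ> id_\<gamma> \<circ> \<gamma>_id)"

locale hom_bialgebra = tensor_cube A
  for A :: "('k::field, 'a::ab_group_add, 'aa::ab_group_add, 'aaa::ab_group_add) tensor_space"
    (structure) +
  fixes \<mu> :: "'aa \<Rightarrow> 'a" and \<Delta> :: "'a \<Rightarrow> 'aa" and \<alpha> :: "'a \<Rightarrow> 'a"
  assumes linear_mult: "Vector_Spaces.linear (scl2 A) (scl A) \<mu>"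
    and linear_comult: "Vector_Spaces.linear (scl A) (scl2 A) \<Delta>"
    and linear_twist: "Vector_Spaces.linear (scl A) (scl A) \<alpha>"
    and twist_mult: "\<alpha> \<circ> \<mu> = \<mu> \<circ> tensor_square_map A \<alpha>"
    and hom_assoc: "\<mu> \<circ> tensor_map (scl3 A) (tensr A) (scl2 A) (tens A) \<alpha> \<mu> =
        \<mu> \<circ> tensor_map (scl3 A) (tensl A) (scl2 A) (tens A) \<mu> \<alpha>"
    and twist_comult: "tensor_square_map A \<alpha> \<circ> \<Delta> = \<Delta> \<circ> \<alpha>"
    and hom_coassoc: "tensor_map (scl2 A) (tens A) (scl3 A) (tensr A) \<alpha> \<Delta> \<circ> \<Delta> =
        tensor_map (scl2 A) (tens A) (scl3 A) (tensl A) \<Delta> \<alpha> \<circ> \<Delta>"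
    and comult_mult: "\<Delta> (\<mu> (a \<otimes> b)) = tensor_mult A \<mu> (\<Delta> a) (\<Delta> b)"

locale cobraided_hom_bialgebra = hom_bialgebra A \<mu> \<Delta> \<alpha>
  for A :: "('k::field, 'a::ab_group_add, 'aa::ab_group_add, 'aaa::ab_group_add) tensor_space"
    (structure) and \<mu> \<Delta> \<alpha> +
  fixes R :: "'aa \<Rightarrow> 'k"
  assumes linear_form: "Vector_Spaces.linear (scl2 A) (*) R"
    and form_mult_left:
      "R (\<mu> (x \<otimes> y) \<otimes> \<alpha> z) =
         tensor_lift (scl2 A) (*) (tens A)
           (\<lambda>z\<^sub>1 z\<^sub>2. R (\<alpha> x \<otimes> z\<^sub>1) * R (\<alpha> y \<otimes> z\<^sub>2)) (\<Delta> z)"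
    and form_mult_right:
      "R (\<alpha> x \<otimes> \<mu> (y \<otimes> z)) =
         tensor_lift (scl2 A) (*) (tens A)
           (\<lambda>x\<^sub>1 x\<^sub>2. R (x\<^sub>1 \<otimes> \<alpha> z) * R (x\<^sub>2 \<otimes> \<alpha> y)) (\<Delta> x)"
    and form_commute:
      "tensor_lift (scl2 A) (scl A) (tens A) (\<lambda>x\<^sub>1 x\<^sub>2.
         tensor_lift (scl2 A) (scl A) (tens A)
           (\<lambda>y\<^sub>1 y\<^sub>2. scl A (R (x\<^sub>2 \<otimes> y\<^sub>2)) (\<mu> (y\<^sub>1 \<otimes> x\<^sub>1))) (\<Delta> y)) (\<Delta> x) =
       tensor_lift (scl2 A) (scl A) (tens A) (\<lambda>x\<^sub>1 x\<^sub>2.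
         tensor_lift (scl2 A) (scl A) (tens A)
           (\<lambda>y\<^sub>1 y\<^sub>2. scl A (R (x\<^sub>1 \<otimes> y\<^sub>1)) (\<mu> (x\<^sub>2 \<otimes> y\<^sub>2))) (\<Delta> y)) (\<Delta> x)"

section \<open>Algebras given by generators and relations\<close>

datatype 'g free_monoid = Mon (letters: "'g list")

instantiation free_monoid :: (type) monoid_add
begin

definition zero_free_monoid :: "'a free_monoid" where
  "zero_free_monoid = Mon []"

definition plus_free_monoid :: "'a free_monoid \<Rightarrow> 'a free_monoid \<Rightarrow> 'a free_monoid" where
  "plus_free_monoid u w = Mon (letters u @ letters w)"

instance
  by standard (simp_all add: zero_free_monoid_def plus_free_monoid_def)

end

text \<open>
  With concatenation of words as addition of exponents, the convolution product makes
  \<open>'g free_monoid \<Rightarrow>\<^sub>0 'k\<close> the free associative unital algebra on \<open>'g\<close>.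
\<close>

type_synonym ('g, 'k) free_algebra = "'g free_monoid \<Rightarrow>\<^sub>0 'k"

definition free_const :: "'k::field \<Rightarrow> ('g, 'k) free_algebra" where
  "free_const r = Poly_Mapping.single 0 r"

definition free_gen :: "'g \<Rightarrow> ('g, 'k::field) free_algebra" where
  "free_gen g = Poly_Mapping.single (Mon [g]) 1"

definition free_algebra_on :: "'g set \<Rightarrow> ('g, 'k::field) free_algebra set" where
  "free_algebra_on G = {p. \<forall>w\<in>Poly_Mapping.keys p. set (letters w) \<subseteq> G}"

definition free_eval ::
    "('k::field \<Rightarrow> 'a \<Rightarrow> 'a::ring_1) \<Rightarrow> ('g \<Rightarrow> 'a) \<Rightarrow> ('g, 'k) free_algebra \<Rightarrow> 'a" where
  "free_eval s x p =
     (\<Sum>w\<in>Poly_Mapping.keys p. s (Poly_Mapping.lookup p w) (prod_list (map x (letters w))))"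

definition two_sided_ideal :: "'f::ring_1 set \<Rightarrow> 'f set \<Rightarrow> bool" where
  "two_sided_ideal F I \<longleftrightarrow>
     I \<subseteq> F \<and> 0 \<in> I \<and> (\<forall>p\<in>I. \<forall>q\<in>I. p + q \<in> I) \<and> (\<forall>f\<in>F. \<forall>p\<in>I. f * p \<in> I \<and> p * f \<in> I)"

definition ideal_generated :: "'f::ring_1 set \<Rightarrow> 'f set \<Rightarrow> 'f set" where
  "ideal_generated F S = \<Inter>{I. two_sided_ideal F I \<and> S \<subseteq> I}"

locale k_algebra = vector_space s for s :: "'k::field \<Rightarrow> 'a \<Rightarrow> 'a::ring_1" +
  assumes scale_mult_left: "s r x * y = s r (x * y)"
    and scale_mult_right: "x * s r y = s r (x * y)"

text \<open>
  The algebra \<open>'a\<close> is (a copy of) the quotient of the free algebra on the set \<open>G\<close> by the two-sided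
  ideal generated by the relators \<open>S\<close>, the generator \<open>g\<close> having the image \<open>x g\<close>.
\<close>

definition presented_algebra ::
    "('k::field \<Rightarrow> 'a \<Rightarrow> 'a::ring_1) \<Rightarrow> 'g set \<Rightarrow> ('g, 'k) free_algebra set \<Rightarrow> ('g \<Rightarrow> 'a) \<Rightarrow> bool"
  where
  "presented_algebra s G S x \<longleftrightarrow>
     k_algebra s \<and>
     free_eval s x ` free_algebra_on G = UNIV \<and>
     (\<forall>p\<in>free_algebra_on G. free_eval s x p = 0 \<longleftrightarrow> p \<in> ideal_generated (free_algebra_on G) S)"

section \<open>The FRT quantum group\<close>

text \<open>
  Here \<open>c i j m n\<close> is \<open>c_{ij}^{mn}\<close>, and \<open>T i j\<close> (the letter \<open>(i, j)\<close> of the free algebra)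
  is \<open>T_i^j\<close>.
\<close>

definition frt_relator ::
    "nat \<Rightarrow> (nat \<Rightarrow> nat \<Rightarrow> nat \<Rightarrow> nat \<Rightarrow> 'k::field) \<Rightarrow> nat \<Rightarrow> nat \<Rightarrow> nat \<Rightarrow> nat \<Rightarrow>
     (nat \<times> nat, 'k) free_algebra" where
  "frt_relator N c i j m n =
     (\<Sum>k=1..N. \<Sum>l=1..N. free_const (c i j k l) * free_gen (k, m) * free_gen (l, n))
     - (\<Sum>k=1..N. \<Sum>l=1..N. free_gen (i, k) * free_gen (j, l) * free_const (c k l m n))"

definition frt_algebra ::
    "nat \<Rightarrow> (nat \<Rightarrow> nat \<Rightarrow> nat \<Rightarrow> nat \<Rightarrow> 'k::field) \<Rightarrow> ('k \<Rightarrow> 'a \<Rightarrow> 'a::ring_1) \<Rightarrow>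
     (nat \<Rightarrow> nat \<Rightarrow> 'a) \<Rightarrow> bool" where
  "frt_algebra N c s T \<longleftrightarrow>
     presented_algebra s ({1..N} \<times> {1..N})
       {frt_relator N c i j m n | i j m n. i \<in> {1..N} \<and> j \<in> {1..N} \<and> m \<in> {1..N} \<and> n \<in> {1..N}}
       (\<lambda>(i, j). T i j)"

definition mult_map ::
    "('k::field, 'a::ring_1, 'aa::ab_group_add, 'aaa) tensor_space \<Rightarrow> 'aa \<Rightarrow> 'a" where
  "mult_map A = tensor_lift (scl2 A) (scl A) (tens A) (*)"

definition frt_comult ::
    "nat \<Rightarrow> ('k::field, 'a::ring_1, 'aa::ab_group_add, 'aaa) tensor_space \<Rightarrow> (nat \<Rightarrow> nat \<Rightarrow> 'a) \<Rightarrow>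
     'a \<Rightarrow> 'aa" where
  "frt_comult N A T = (THE \<Delta>.
     Vector_Spaces.linear (scl A) (scl2 A) \<Delta> \<and>
     \<Delta> 1 = 1 \<otimes>\<^bsub>A\<^esub> 1 \<and>
     (\<forall>x y. \<Delta> (x * y) = tensor_mult A (mult_map A) (\<Delta> x) (\<Delta> y)) \<and>
     (\<forall>i\<in>{1..N}. \<forall>j\<in>{1..N}. \<Delta> (T i j) = (\<Sum>k=1..N. T i k \<otimes>\<^bsub>A\<^esub> T k j)))"

text \<open>
  If \<open>N \<ge> 1\<close>, the normalisation \<open>R (1 \<otimes> 1) = 1\<close> follows from the other conditions (expand
  \<open>R (1 \<otimes> T i i * 1)\<close>); it only matters for \<open>N = 0\<close>, where the algebra is the ground field.
\<close>

definition frt_form ::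
    "nat \<Rightarrow> (nat \<Rightarrow> nat \<Rightarrow> nat \<Rightarrow> nat \<Rightarrow> 'k::field) \<Rightarrow>
     ('k, 'a::ring_1, 'aa::ab_group_add, 'aaa) tensor_space \<Rightarrow> (nat \<Rightarrow> nat \<Rightarrow> 'a) \<Rightarrow> 'aa \<Rightarrow> 'k" where
  "frt_form N c A T = (THE R.
     Vector_Spaces.linear (scl2 A) (*) R \<and>
     R (1 \<otimes>\<^bsub>A\<^esub> 1) = 1 \<and>
     (\<forall>i\<in>{1..N}. \<forall>j\<in>{1..N}.
        R (1 \<otimes>\<^bsub>A\<^esub> T i j) = (if i = j then 1 else 0) \<and>
        R (T i j \<otimes>\<^bsub>A\<^esub> 1) = (if i = j then 1 else 0)) \<and>
     (\<forall>i\<in>{1..N}. \<forall>j\<in>{1..N}. \<forall>m\<in>{1..N}. \<forall>n\<in>{1..N}.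
        R (T i m \<otimes>\<^bsub>A\<^esub> T j n) = c j i m n) \<and>
     (\<forall>x y z. R ((x * y) \<otimes>\<^bsub>A\<^esub> z) =
        tensor_lift (scl2 A) (*) (tens A)
          (\<lambda>z\<^sub>1 z\<^sub>2. R (x \<otimes>\<^bsub>A\<^esub> z\<^sub>1) * R (y \<otimes>\<^bsub>A\<^esub> z\<^sub>2)) (frt_comult N A T z)) \<and>
     (\<forall>x y z. R (x \<otimes>\<^bsub>A\<^esub> (y * z)) =
        tensor_lift (scl2 A) (*) (tens A)
          (\<lambda>x\<^sub>1 x\<^sub>2. R (x\<^sub>1 \<otimes>\<^bsub>A\<^esub> z) * R (x\<^sub>2 \<otimes>\<^bsub>A\<^esub> y)) (frt_comult N A T x)))"

definition bialgebra_endomorphism ::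
    "('k::field, 'a::ring_1, 'aa::ab_group_add, 'aaa) tensor_space \<Rightarrow> ('a \<Rightarrow> 'aa) \<Rightarrow>
     ('a \<Rightarrow> 'a) \<Rightarrow> bool" where
  "bialgebra_endomorphism A \<Delta> f \<longleftrightarrow>
     Vector_Spaces.linear (scl A) (scl A) f \<and> f 1 = 1 \<and> (\<forall>x y. f (x * y) = f x * f y) \<and>
     tensor_square_map A f \<circ> \<Delta> = \<Delta> \<circ> f"

definition is_frt_twist ::
    "nat \<Rightarrow> ('k::field, 'a::ring_1, 'aa::ab_group_add, 'aaa) tensor_space \<Rightarrow> (nat \<Rightarrow> nat \<Rightarrow> 'a) \<Rightarrow>
     (nat \<Rightarrow> 'k) \<Rightarrow> ('a \<Rightarrow> 'a) \<Rightarrow> bool" where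
  "is_frt_twist N A T lam \<alpha> \<longleftrightarrow>
     bialgebra_endomorphism A (frt_comult N A T) \<alpha> \<and>
     (\<forall>i\<in>{1..N}. \<forall>j\<in>{1..N}. \<alpha> (T i j) = scl A (lam i * inverse (lam j)) (T i j))"

end

theory Submission
  imports Defs "HOL-Library.Function_Algebras"
begin

text \<open>
  The statement splits into a general twisting principle and the structure of the FRT quantum group.

  Twisting: let a bialgebra carry a form \<open>R\<close> satisfying the two multiplicativity rules and the
  commutation rule \<open>\<Sum> y\<^sub>1 x\<^sub>1 R(x\<^sub>2 \<otimes> y\<^sub>2) = \<Sum> R(x\<^sub>1 \<otimes> y\<^sub>1) x\<^sub>2 y\<^sub>2\<close>, and let \<open>\<alpha>\<close> be a bialgebra endomorphism.
  Every axiom of a cobraided Hom-bialgebra for \<open>(\<alpha> \<circ> \<mu>, \<Delta> \<circ> \<alpha>, \<alpha>, R)\<close> is then an untwisted axiom, or a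
  morphism property of \<open>\<alpha>\<close>, with \<open>\<alpha>\<close> applied to its arguments or to both of its sides
  (\<open>hom_bialgebra\<close>, \<open>cobraided\<close>).

  The untwisted structure has to be constructed, since \<open>\<Delta>\<close> and \<open>R\<close> are specified only by the
  conditions that determine them. Each piece is an algebra morphism out of \<open>A(\<gamma>)\<close>, and exists by the universal
  property of generators and relations (\<open>presented.lift\<close>, \<open>frt_lift\<close>), whose target may be any
  algebra structure on a subspace:

  \<^item> \<open>\<Delta>\<close> has target \<open>A \<otimes> A\<close>; the relations of \<open>A\<close>, used once in each tensor factor, give those of
    \<open>\<Delta> T\<^sub>i\<^sup>j\<close> (\<open>ex_comult\<close>).
  \<^item> The vector representation \<open>\<rho>\<close> has target the \<open>N \<times> N\<close> matrices, with \<open>\<rho>(T\<^sub>i\<^sup>m)\<^sub>j\<^sub>n = c\<^sub>j\<^sub>i\<^sup>m\<^sup>n\<close>.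
    The defining relations become the Yang-Baxter equation (\<open>ex_vector_representation\<close>).
  \<^item> An anti-morphism \<open>\<phi>\<close> into the dual, with convolution as product, sends \<open>T\<^sub>j\<^sup>n\<close> to the
    matrix coefficient \<open>\<rho>\<^sub>j\<^sub>n\<close>. Here the relations say that \<open>\<gamma>\<close> intertwines a representation on
    \<open>V \<otimes> V\<close>, which again is the Yang-Baxter equation on generators (\<open>rep2_commute\<close>, \<open>ex_dual_map\<close>).

  Then \<open>R(x \<otimes> y) = \<phi>(y)(x)\<close>. The rule for \<open>R(x \<otimes> y z)\<close> holds because \<open>\<phi>\<close> reverses products.
  The remaining identities are checked on words \<open>T\<^sub>I\<^sup>J\<close>, the products of generators \<open>T\<^sub>i\<^sup>j\<close> along two
  lists \<open>I\<close>, \<open>J\<close> of equal length. These span \<open>A\<close> and satisfy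
  \<open>\<Delta>(T\<^sub>I\<^sup>J) = \<Sum>\<^sub>K T\<^sub>I\<^sup>K \<otimes> T\<^sub>K\<^sup>J\<close>, so that Sweedler sums turn into finite matrix products:
  coassociativity, the convolution algebra, the rule for \<open>R(x y \<otimes> z)\<close> and the commutation rule
  (\<open>form_commutation\<close>) all become statements about matrices indexed by words.

  Finally, the condition \<open>\<lambda>\<^sub>i \<lambda>\<^sub>j c\<^sub>i\<^sub>j\<^sup>m\<^sup>n = \<lambda>\<^sub>m \<lambda>\<^sub>n c\<^sub>i\<^sub>j\<^sup>m\<^sup>n\<close> makes the rescaled generators satisfy the
  defining relations, which gives \<open>\<alpha>\<close> (\<open>ex_twist\<close>), and shows that \<open>R \<circ> (\<alpha> \<otimes> \<alpha>)\<close> agrees with \<open>R\<close> on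
  generators; as it obeys the same multiplicativity rules, it equals \<open>R\<close> (\<open>form_invariant\<close>).
\<close>

section \<open>Linear maps out of free vector spaces\<close>

definition linear_extension ::
    "('k::field \<Rightarrow> 't \<Rightarrow> 't::ab_group_add) \<Rightarrow> ('x \<Rightarrow> 't) \<Rightarrow> ('x \<Rightarrow>\<^sub>0 'k) \<Rightarrow> 't" where
  "linear_extension s f p = (\<Sum>x\<in>Poly_Mapping.keys p. s (Poly_Mapping.lookup p x) (f x))"

lemma lookup_free_scale: "Poly_Mapping.lookup (free_scale r p) x = r * Poly_Mapping.lookup p x"
  by (simp add: free_scale_def Poly_Mapping.map.rep_eq when_def)

lemma vector_space_free_scale: "vector_space free_scale"
  by unfold_locales
    (rule poly_mapping_eqI; simp add: lookup_free_scale lookup_add algebra_simps)+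

lemma vector_space_field: "vector_space ((*) :: 'k::field \<Rightarrow> 'k \<Rightarrow> 'k)"
  by unfold_locales (simp_all add: algebra_simps)

lemma linearI:
  assumes "vector_space s" "vector_space s'"
    and "\<And>x y. f (x + y) = f x + f y" "\<And>r x. f (s r x) = s' r (f x)"
  shows "Vector_Spaces.linear s s' f"
  using assms by (simp add: Vector_Spaces.linear_iff)

lemmas linear_addD = Vector_Spaces.linear_iff[THEN iffD1, THEN conjunct2, THEN conjunct2,
    THEN conjunct1, rule_format]
  and linear_scaleD = Vector_Spaces.linear_iff[THEN iffD1, THEN conjunct2, THEN conjunct2,
    THEN conjunct2, rule_format]
  and linear_sumD = module_hom.sum[OF module_hom_linearI]
  and linear_zeroD = module_hom.zero[OF module_hom_linearI]
  and linear_diffD = module_hom.diff[OF module_hom_linearI]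

context vector_space
begin

lemma linear_extension_superset:
  assumes "finite K" "Poly_Mapping.keys p \<subseteq> K"
  shows "linear_extension scale f p = (\<Sum>x\<in>K. scale (Poly_Mapping.lookup p x) (f x))"
  unfolding linear_extension_def
  by (rule sum.mono_neutral_left) (use assms in \<open>auto simp: in_keys_iff\<close>)

lemma linear_extension_single [simp]:
  "linear_extension scale f (Poly_Mapping.single x r) = scale r (f x)"
  by (subst linear_extension_superset[of "{x}"]) auto

lemma linear_linear_extension: "Vector_Spaces.linear free_scale scale (linear_extension scale f)"
proof (rule linearI)
  fix p q :: "'c \<Rightarrow>\<^sub>0 'a" and r
  let ?K = "Poly_Mapping.keys p \<union> Poly_Mapping.keys q"
  have "linear_extension scale f p' = (\<Sum>x\<in>?K. scale (Poly_Mapping.lookup p' x) (f x))"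
    if "p' \<in> {p, q, p + q}" for p'
    by (rule linear_extension_superset) (use that Poly_Mapping.keys_add[of p q] in auto)
  then show "linear_extension scale f (p + q) = linear_extension scale f p + linear_extension scale f q"
    by (simp add: lookup_add scale_left_distrib sum.distrib)
  have "Poly_Mapping.keys (free_scale r p) \<subseteq> Poly_Mapping.keys p"
    by (auto simp: in_keys_iff lookup_free_scale)
  then have "linear_extension scale f (free_scale r p) =
      (\<Sum>x\<in>Poly_Mapping.keys p. scale (Poly_Mapping.lookup (free_scale r p) x) (f x))"
    by (intro linear_extension_superset) auto
  then show "linear_extension scale f (free_scale r p) = scale r (linear_extension scale f p)"
    by (simp add: linear_extension_def lookup_free_scale scale_sum_right)
qed (rule vector_space_free_scale vector_space_axioms)+

end

lemma poly_mapping_eq_sum_single: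
  "p = (\<Sum>x\<in>Poly_Mapping.keys p. Poly_Mapping.single x (Poly_Mapping.lookup p x))"
proof (rule poly_mapping_eqI)
  fix y
  have "Poly_Mapping.lookup (\<Sum>x\<in>Poly_Mapping.keys p. Poly_Mapping.single x (Poly_Mapping.lookup p x)) y
      = (\<Sum>x\<in>Poly_Mapping.keys p. if y = x then Poly_Mapping.lookup p y else 0)"
    unfolding lookup_sum by (rule sum.cong) (auto simp: lookup_single when_def)
  then show "Poly_Mapping.lookup p y =
      Poly_Mapping.lookup (\<Sum>x\<in>Poly_Mapping.keys p. Poly_Mapping.single x (Poly_Mapping.lookup p x)) y"
    by (simp add: in_keys_iff)
qed

section \<open>Maps out of algebras given by generators and relations\<close>

text \<open>
  An algebra structure \<open>(e, m)\<close> on the subspace \<open>C\<close> of a vector space. The relativisation to \<open>C\<close>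
  serves targets that are not a whole type: matrices supported on a finite index set, and the linear
  functionals inside all functions.
\<close>

locale algebra_on = vector_space s for s :: "'k::field \<Rightarrow> 't \<Rightarrow> 't::ab_group_add" +
  fixes C :: "'t set" and e :: 't and m :: "'t \<Rightarrow> 't \<Rightarrow> 't"
  assumes carrier_subspace: "subspace C"
    and unit_closed: "e \<in> C"
    and mult_closed: "\<And>x y. x \<in> C \<Longrightarrow> y \<in> C \<Longrightarrow> m x y \<in> C"
    and mult_add_left: "\<And>x y z. x \<in> C \<Longrightarrow> y \<in> C \<Longrightarrow> z \<in> C \<Longrightarrow> m (x + y) z = m x z + m y z"
    and mult_add_right: "\<And>x y z. x \<in> C \<Longrightarrow> y \<in> C \<Longrightarrow> z \<in> C \<Longrightarrow> m z (x + y) = m z x + m z y"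
    and mult_scale_left: "\<And>r x y. x \<in> C \<Longrightarrow> y \<in> C \<Longrightarrow> m (s r x) y = s r (m x y)"
    and mult_scale_right: "\<And>r x y. x \<in> C \<Longrightarrow> y \<in> C \<Longrightarrow> m x (s r y) = s r (m x y)"
    and mult_assoc: "\<And>x y z. x \<in> C \<Longrightarrow> y \<in> C \<Longrightarrow> z \<in> C \<Longrightarrow> m (m x y) z = m x (m y z)"
    and unit_left: "\<And>x. x \<in> C \<Longrightarrow> m e x = x"
    and unit_right: "\<And>x. x \<in> C \<Longrightarrow> m x e = x"
begin

definition word_eval :: "('g \<Rightarrow> 't) \<Rightarrow> 'g free_monoid \<Rightarrow> 't" where
  "word_eval x w = foldr (\<lambda>g. m (x g)) (letters w) e"

definition algebra_eval :: "('g \<Rightarrow> 't) \<Rightarrow> ('g, 'k) free_algebra \<Rightarrow> 't" where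
  "algebra_eval x = linear_extension s (word_eval x)"

lemma word_eval_closed:
  assumes "x ` G \<subseteq> C" "set (letters w) \<subseteq> G"
  shows "word_eval x w \<in> C"
proof -
  have "foldr (\<lambda>g. m (x g)) gs e \<in> C" if "set gs \<subseteq> G" for gs
    using that assms(1) by (induction gs) (auto intro!: unit_closed mult_closed)
  then show ?thesis using assms(2) by (simp add: word_eval_def)
qed

lemma word_eval_add:
  assumes x: "x ` G \<subseteq> C" and u: "set (letters u) \<subseteq> G" and w: "set (letters w) \<subseteq> G"
  shows "word_eval x (u + w) = m (word_eval x u) (word_eval x w)"
proof -
  have closed: "foldr (\<lambda>g. m (x g)) gs e \<in> C" if "set gs \<subseteq> G" for gs
    using word_eval_closed[OF x, of "Mon gs"] that by (simp add: word_eval_def)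
  have "foldr (\<lambda>g. m (x g)) (gs @ hs) e = m (foldr (\<lambda>g. m (x g)) gs e) (foldr (\<lambda>g. m (x g)) hs e)"
    if "set gs \<subseteq> G" "set hs \<subseteq> G" for gs hs
    using that
  proof (induction gs)
    case Nil
    then show ?case using closed[of hs] by (simp add: unit_left del: foldr_append)
  next
    case (Cons g gs)
    then show ?case using closed[of gs] closed[of hs] x
      by (auto simp: mult_assoc image_subset_iff simp del: foldr_append)
  qed
  from this[OF u w] show ?thesis by (simp add: word_eval_def plus_free_monoid_def)
qed

lemma mult_sum_left:
  assumes "finite K" "\<And>i. i \<in> K \<Longrightarrow> f i \<in> C" "y \<in> C"
  shows "m (\<Sum>i\<in>K. f i) y = (\<Sum>i\<in>K. m (f i) y)"
  using assms
proof (induction K)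
  case empty
  show ?case using mult_scale_left[of 0 y 0] carrier_subspace empty
    by (simp add: subspace_0)
next
  case (insert i K)
  then show ?case
    by (simp add: mult_add_left subspace_sum[OF carrier_subspace])
qed

lemma mult_sum_right:
  assumes "finite K" "\<And>i. i \<in> K \<Longrightarrow> f i \<in> C" "y \<in> C"
  shows "m y (\<Sum>i\<in>K. f i) = (\<Sum>i\<in>K. m y (f i))"
  using assms
proof (induction K)
  case empty
  show ?case using mult_scale_right[of y 0 0] carrier_subspace empty
    by (simp add: subspace_0)
next
  case (insert i K)
  then show ?case
    by (simp add: mult_add_right subspace_sum[OF carrier_subspace])
qed

lemma linear_algebra_eval: "Vector_Spaces.linear free_scale s (algebra_eval x)"
  unfolding algebra_eval_def by (rule linear_linear_extension)

lemma algebra_eval_single: "algebra_eval x (Poly_Mapping.single w r) = s r (word_eval x w)"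
  by (simp add: algebra_eval_def)

lemma algebra_eval_one: "algebra_eval x 1 = e"
  by (simp add: algebra_eval_single single_one[symmetric] word_eval_def zero_free_monoid_def
      del: single_one)

lemma algebra_eval_gen:
  assumes "x g \<in> C"
  shows "algebra_eval x (free_gen g) = x g"
  using assms by (simp add: free_gen_def algebra_eval_single word_eval_def unit_right)

lemma algebra_eval_closed:
  assumes "x ` G \<subseteq> C" "p \<in> free_algebra_on G"
  shows "algebra_eval x p \<in> C"
  using assms unfolding algebra_eval_def linear_extension_def free_algebra_on_def
  by (intro subspace_sum subspace_scale carrier_subspace word_eval_closed[of x G]) auto

lemma algebra_eval_mult:
  assumes x: "x ` G \<subseteq> C" and p: "p \<in> free_algebra_on G" and q: "q \<in> free_algebra_on G"
  shows "algebra_eval x (p * q) = m (algebra_eval x p) (algebra_eval x q)"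
proof -
  let ?l = Poly_Mapping.lookup and ?k = Poly_Mapping.keys
  have C: "word_eval x w \<in> C" "set (letters w) \<subseteq> G" if "w \<in> ?k p \<union> ?k q" for w
    using that p q word_eval_closed[OF x] by (auto simp: free_algebra_on_def)
  have sC: "s r (word_eval x w) \<in> C" if "w \<in> ?k p \<union> ?k q" for w r
    using C that by (auto intro: subspace_scale carrier_subspace)
  have "p * q = (\<Sum>u\<in>?k p. Poly_Mapping.single u (?l p u)) * (\<Sum>w\<in>?k q. Poly_Mapping.single w (?l q w))"
    using poly_mapping_eq_sum_single[of p] poly_mapping_eq_sum_single[of q] by metis
  also have "\<dots> = (\<Sum>u\<in>?k p. \<Sum>w\<in>?k q. Poly_Mapping.single (u + w) (?l p u * ?l q w))"
    by (simp add: sum_product mult_single)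
  finally have "algebra_eval x (p * q) =
      (\<Sum>u\<in>?k p. \<Sum>w\<in>?k q. s (?l p u * ?l q w) (word_eval x (u + w)))"
    by (simp add: linear_sumD[OF linear_algebra_eval] algebra_eval_single)
  also have "\<dots> = (\<Sum>u\<in>?k p. \<Sum>w\<in>?k q. m (s (?l p u) (word_eval x u)) (s (?l q w) (word_eval x w)))"
    using C sC by (intro sum.cong refl) (simp add: word_eval_add[OF x] mult_scale_left mult_scale_right)
  also have "\<dots> = m (\<Sum>u\<in>?k p. s (?l p u) (word_eval x u)) (\<Sum>w\<in>?k q. s (?l q w) (word_eval x w))"
    using sC by (simp add: mult_sum_left mult_sum_right subspace_sum[OF carrier_subspace])
      (rule sum.swap)
  finally show ?thesis by (simp add: algebra_eval_def linear_extension_def)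
qed

end

lemma free_algebra_on_closed:
  fixes p q :: "('g, 'k::field) free_algebra"
  assumes "p \<in> free_algebra_on G" "q \<in> free_algebra_on G"
  shows "p + q \<in> free_algebra_on G" "p - q \<in> free_algebra_on G" "p * q \<in> free_algebra_on G"
    "free_scale r p \<in> free_algebra_on G"
proof -
  show "p + q \<in> free_algebra_on G"
    using assms Poly_Mapping.keys_add[of p q] by (auto simp: free_algebra_on_def)
  show "p - q \<in> free_algebra_on G"
    using assms Poly_Mapping.keys_diff[of p q] by (fastforce simp: free_algebra_on_def)
  show "p * q \<in> free_algebra_on G"
    unfolding free_algebra_on_def
  proof safe
    fix w g
    assume "w \<in> Poly_Mapping.keys (p * q)" "g \<in> set (letters w)"
    then obtain a b where "a \<in> Poly_Mapping.keys p" "b \<in> Poly_Mapping.keys q" "w = a + b"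
      using Poly_Mapping.keys_mult[of p q] by auto
    then show "g \<in> G" using assms \<open>g \<in> set (letters w)\<close>
      by (auto simp: free_algebra_on_def plus_free_monoid_def)
  qed
  have "Poly_Mapping.keys (free_scale r p) \<subseteq> Poly_Mapping.keys p"
    by (auto simp: in_keys_iff lookup_free_scale)
  then show "free_scale r p \<in> free_algebra_on G" using assms by (auto simp: free_algebra_on_def)
qed

lemma free_algebra_on_basic:
  "0 \<in> free_algebra_on G" "1 \<in> free_algebra_on G" "free_const r \<in> free_algebra_on G"
  "g \<in> G \<Longrightarrow> free_gen g \<in> free_algebra_on G"
  by (auto simp: free_algebra_on_def free_const_def free_gen_def zero_free_monoid_def)

lemma free_algebra_on_sum:
  fixes f :: "'i \<Rightarrow> ('g, 'k::field) free_algebra"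
  shows "(\<And>i. i \<in> K \<Longrightarrow> f i \<in> free_algebra_on G) \<Longrightarrow> (\<Sum>i\<in>K. f i) \<in> free_algebra_on G"
  by (induction K rule: infinite_finite_induct) (auto simp: free_algebra_on_basic free_algebra_on_closed)

lemma (in k_algebra) algebra_on_UNIV: "algebra_on s UNIV 1 (*)"
  by unfold_locales
    (auto simp: subspace_UNIV scale_mult_left scale_mult_right algebra_simps)

text \<open>
  Makes evaluation in the presented algebra itself an instance of \<open>algebra_eval\<close>, so that its
  linearity and multiplicativity come from the same lemmas as those of evaluation in a target.
\<close>

lemma (in k_algebra) free_eval_eq: "free_eval s x = algebra_on.algebra_eval s 1 (*) x"
proof -
  interpret algebra_on s UNIV 1 "(*)" by (rule algebra_on_UNIV)
  have "prod_list (map x l) = foldr (\<lambda>g. (*) (x g)) l 1" for l by (induction l) auto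
  then show ?thesis
    by (auto simp: free_eval_def algebra_eval_def linear_extension_def word_eval_def fun_eq_iff)
qed

locale presented = k_algebra s for s :: "'k::field \<Rightarrow> 'a \<Rightarrow> 'a::ring_1" +
  fixes G :: "'g set" and S :: "('g, 'k) free_algebra set" and X :: "'g \<Rightarrow> 'a"
  assumes pres: "presented_algebra s G S X" and relators: "S \<subseteq> free_algebra_on G"
begin

interpretation self: algebra_on s UNIV 1 "(*)" by (rule algebra_on_UNIV)

lemma ex_preimage: "\<exists>p\<in>free_algebra_on G. free_eval s X p = a"
  using pres unfolding presented_algebra_def by (metis UNIV_I imageE)

lemma relator_zero:
  assumes "p \<in> S" shows "free_eval s X p = 0"
  using pres relators assms unfolding presented_algebra_def ideal_generated_def by blast

text \<open>
  The universal property. Evaluation of the free algebra in the target is linear and multiplicative, so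
  the polynomials that it sends to zero form a two-sided ideal; this ideal contains the relators, hence the
  ideal they generate, and evaluation factors through the quotient.
\<close>

theorem lift:
  assumes tgt: "algebra_on sT C e m" and x: "x ` G \<subseteq> C"
    and rel: "\<And>p. p \<in> S \<Longrightarrow> algebra_on.algebra_eval sT e m x p = 0"
  shows "\<exists>h. Vector_Spaces.linear s sT h \<and> h 1 = e \<and> (\<forall>a b. h (a * b) = m (h a) (h b)) \<and>
    (\<forall>g\<in>G. h (X g) = x g) \<and> range h \<subseteq> C"
proof -
  interpret T: algebra_on sT C e m by (rule tgt)
  let ?F = "free_algebra_on G :: ('g, 'k) free_algebra set"
  let ?f = "free_eval s X" and ?E = "T.algebra_eval x"
  let ?K = "{p \<in> ?F. ?E p = 0}"
  note E = T.linear_algebra_eval[of x]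
  have f: "Vector_Spaces.linear free_scale s ?f"
    unfolding free_eval_eq by (rule self.linear_algebra_eval)
  have m0: "m 0 a = 0 \<and> m a 0 = 0" if "a \<in> C" for a
    using T.mult_sum_left[of "{}" _ a] T.mult_sum_right[of "{}" _ a] that by simp
  have "two_sided_ideal ?F ?K"
    unfolding two_sided_ideal_def
    by (auto simp: free_algebra_on_basic free_algebra_on_closed linear_addD[OF E] linear_zeroD[OF E]
        T.algebra_eval_mult[OF x] m0 T.algebra_eval_closed[OF x])
  moreover have "S \<subseteq> ?K" using rel relators by auto
  ultimately have ideal: "ideal_generated ?F S \<subseteq> ?K" by (auto simp: ideal_generated_def)
  have wd: "?E p = ?E q" if "p \<in> ?F" "q \<in> ?F" "?f p = ?f q" for p q
  proof -
    have "?f (p - q) = 0" using that by (simp add: linear_diffD[OF f])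
    then have "p - q \<in> ideal_generated ?F S"
      using pres that by (simp add: presented_algebra_def free_algebra_on_closed)
    then have "?E (p - q) = 0" using ideal by blast
    then show ?thesis by (simp add: linear_diffD[OF E])
  qed
  \<comment> \<open>The value at \<open>a\<close> is read off from an arbitrary polynomial representing \<open>a\<close>.\<close>
  define h where "h a = ?E (SOME p. p \<in> ?F \<and> ?f p = a)" for a
  have h: "h (?f p) = ?E p" if "p \<in> ?F" for p
  proof -
    have "\<exists>q. q \<in> ?F \<and> ?f q = ?f p" using that by blast
    then have "(SOME q. q \<in> ?F \<and> ?f q = ?f p) \<in> ?F \<and> ?f (SOME q. q \<in> ?F \<and> ?f q = ?f p) = ?f p"
      by (rule someI_ex)
    then show ?thesis unfolding h_def using that by (intro wd) auto
  qed
  have "Vector_Spaces.linear s sT h"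
  proof (rule linearI)
    fix a b r
    obtain p q where pq: "p \<in> ?F" "?f p = a" "q \<in> ?F" "?f q = b" using ex_preimage by metis
    have "h (?f (p + q)) = h (?f p) + h (?f q)"
      unfolding h[OF pq(1)] h[OF pq(3)] h[OF free_algebra_on_closed(1)[OF pq(1,3)]]
      by (rule linear_addD[OF E])
    then show "h (a + b) = h a + h b" using pq by (simp add: linear_addD[OF f])
    have "h (?f (free_scale r p)) = sT r (h (?f p))"
      unfolding h[OF pq(1)] h[OF free_algebra_on_closed(4)[OF pq(1,1)]]
      by (rule linear_scaleD[OF E])
    then show "h (s r a) = sT r (h a)" using pq by (simp add: linear_scaleD[OF f])
  qed unfold_locales
  moreover have "h 1 = e"
    using h[of 1] by (simp add: free_algebra_on_basic free_eval_eq self.algebra_eval_one T.algebra_eval_one)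
  moreover have "h (a * b) = m (h a) (h b)" for a b
  proof -
    obtain p q where pq: "p \<in> ?F" "?f p = a" "q \<in> ?F" "?f q = b" using ex_preimage by metis
    have "h (?f (p * q)) = m (h (?f p)) (h (?f q))"
      unfolding h[OF pq(1)] h[OF pq(3)] h[OF free_algebra_on_closed(3)[OF pq(1,3)]]
      by (rule T.algebra_eval_mult[OF x pq(1,3)])
    then show ?thesis using pq
      by (simp add: free_eval_eq self.algebra_eval_mult[of _ G])
  qed
  moreover have "h (X g) = x g" if "g \<in> G" for g
    using h[of "free_gen g"] that x
    by (simp add: free_algebra_on_basic free_eval_eq self.algebra_eval_gen T.algebra_eval_gen
        image_subset_iff)
  moreover have "h a \<in> C" for a
    using ex_preimage[of a] h T.algebra_eval_closed[OF x] by metis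
  ultimately show ?thesis by blast
qed

text \<open>
  The presented algebra is spanned by words in the generators, and these arise from \<open>1\<close> by
  multiplications with generators on the left.
\<close>

lemma generator_induct:
  assumes "subspace P" "1 \<in> P" "\<And>g a. g \<in> G \<Longrightarrow> a \<in> P \<Longrightarrow> X g * a \<in> P"
  shows "a \<in> P"
proof -
  obtain p where p: "p \<in> free_algebra_on G" "free_eval s X p = a" using ex_preimage by blast
  have "prod_list (map X gs) \<in> P" if "set gs \<subseteq> G" for gs
    using that assms by (induction gs) auto
  then have "free_eval s X p \<in> P"
    unfolding free_eval_def using p(1) assms(1)
    by (auto intro!: subspace_sum subspace_scale simp: free_algebra_on_def)
  then show ?thesis using p by simp
qed

end

section \<open>The universal property of tensor products\<close>

definition bilinear_map ::
    "('k::field \<Rightarrow> 'a \<Rightarrow> 'a::ab_group_add) \<Rightarrow> ('k \<Rightarrow> 'b \<Rightarrow> 'b::ab_group_add) \<Rightarrow>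
     ('k \<Rightarrow> 'c \<Rightarrow> 'c::ab_group_add) \<Rightarrow> ('a \<Rightarrow> 'b \<Rightarrow> 'c) \<Rightarrow> bool" where
  "bilinear_map sA sB sC \<beta> \<longleftrightarrow> vector_space sC \<and>
     (\<forall>a b b'. \<beta> a (b + b') = \<beta> a b + \<beta> a b') \<and> (\<forall>r a b. \<beta> a (sB r b) = sC r (\<beta> a b)) \<and>
     (\<forall>a a' b. \<beta> (a + a') b = \<beta> a b + \<beta> a' b) \<and> (\<forall>r a b. \<beta> (sA r a) b = sC r (\<beta> a b))"

lemma bilinear_mapI:
  assumes "vector_space sC"
    and "\<And>a b b'. \<beta> a (b + b') = \<beta> a b + \<beta> a b'" "\<And>r a b. \<beta> a (sB r b) = sC r (\<beta> a b)"
    and "\<And>a a' b. \<beta> (a + a') b = \<beta> a b + \<beta> a' b" "\<And>r a b. \<beta> (sA r a) b = sC r (\<beta> a b)"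
  shows "bilinear_map sA sB sC \<beta>"
  using assms by (simp add: bilinear_map_def)

lemma bilinear_mapD:
  assumes "bilinear_map sA sB sC \<beta>"
  shows "vector_space sC"
    and "\<beta> a (b + b') = \<beta> a b + \<beta> a b'" "\<beta> a (sB r b) = sC r (\<beta> a b)"
    and "\<beta> (a + a') b = \<beta> a b + \<beta> a' b" "\<beta> (sA r a) b = sC r (\<beta> a b)"
  using assms by (simp_all add: bilinear_map_def)

context tensor_product
begin

lemma tensor_eval_eq: "tensor_eval sC \<beta> = linear_extension sC (\<lambda>(a, b). \<beta> a b)"
  by (auto simp: tensor_eval_def linear_extension_def fun_eq_iff intro!: sum.cong)

lemma linear_tensor_eval:
  assumes "vector_space sC"
  shows "Vector_Spaces.linear free_scale sC (tensor_eval sC \<beta>)"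
  unfolding tensor_eval_eq by (rule vector_space.linear_linear_extension[OF assms])

lemma tensor_eval_single:
  assumes "vector_space sC"
  shows "tensor_eval sC \<beta> (Poly_Mapping.single (a, b) r) = sC r (\<beta> a b)"
  unfolding tensor_eval_eq by (simp add: vector_space.linear_extension_single[OF assms])

lemma tensor_eval_relator:
  assumes "bilinear_map sA sB sC \<beta>" "p \<in> tensor_relators sA sB"
  shows "tensor_eval sC \<beta> p = 0"
proof -
  interpret C: vector_space sC using bilinear_mapD(1)[OF assms(1)] .
  show ?thesis
    using assms(2) unfolding tensor_relators_def
    by (auto simp: tensor_eval_single[OF C.vector_space_axioms] bilinear_mapD[OF assms(1)]
        linear_diffD[OF linear_tensor_eval[OF C.vector_space_axioms]])
qed

text \<open>
  This is the well-definedness of the linear map that a bilinear \<open>\<beta>\<close> induces on the quotient of the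
  free vector space.
\<close>

lemma tensor_eval_span_relators:
  assumes "bilinear_map sA sB sC \<beta>" "p \<in> module.span free_scale (tensor_relators sA sB)"
  shows "tensor_eval sC \<beta> p = 0"
proof -
  interpret F: vector_space free_scale by (rule vector_space_free_scale)
  note l = linear_tensor_eval[OF bilinear_mapD(1)[OF assms(1)]]
  interpret L: Vector_Spaces.linear free_scale sC "tensor_eval sC \<beta>" by (rule l)
  have "F.span (tensor_relators sA sB) \<subseteq> {p. tensor_eval sC \<beta> p = 0}"
    by (rule F.span_minimal) (auto simp: tensor_eval_relator[OF assms(1)] intro!: L.subspace_kernel)
  then show ?thesis using assms(2) by blast
qed

text \<open>
  The relators lie in the kernel of the evaluation, which spells out bilinearity of \<open>\<otimes>\<close>.
\<close>

lemma bilinear_tens: "bilinear_map sA sB sT t"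
proof -
  interpret F: vector_space free_scale by (rule vector_space_free_scale)
  have z: "tensor_eval sT t p = 0" if "p \<in> tensor_relators sA sB" for p
    using that by (simp add: kernel_eval F.span_base)
  note [simp] = tensor_eval_single[OF T.vector_space_axioms]
    linear_diffD[OF linear_tensor_eval[OF T.vector_space_axioms]]
    linear_addD[OF linear_tensor_eval[OF T.vector_space_axioms]]
  show ?thesis
  proof (rule bilinear_mapI)
    fix a a' b b' r
    show "t a (b + b') = t a b + t a b'"
    proof -
      have "Poly_Mapping.single (a, b + b') 1 - Poly_Mapping.single (a, b) 1 - Poly_Mapping.single (a, b') 1 \<in> tensor_relators sA sB"
        unfolding tensor_relators_def by blast
      from z[OF this] show ?thesis by (simp add: algebra_simps)
    qed
    show "t a (sB r b) = sT r (t a b)"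
    proof -
      have "Poly_Mapping.single (a, sB r b) 1 - Poly_Mapping.single (a, b) r \<in> tensor_relators sA sB"
        unfolding tensor_relators_def by blast
      from z[OF this] show ?thesis by (simp add: algebra_simps)
    qed
    show "t (a + a') b = t a b + t a' b"
    proof -
      have "Poly_Mapping.single (a + a', b) 1 - Poly_Mapping.single (a, b) 1 - Poly_Mapping.single (a', b) 1 \<in> tensor_relators sA sB"
        unfolding tensor_relators_def by blast
      from z[OF this] show ?thesis by (simp add: algebra_simps)
    qed
    show "t (sA r a) b = sT r (t a b)"
    proof -
      have "Poly_Mapping.single (sA r a, b) 1 - Poly_Mapping.single (a, b) r \<in> tensor_relators sA sB"
        unfolding tensor_relators_def by blast
      from z[OF this] show ?thesis by (simp add: algebra_simps)
    qed
  qed unfold_locales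
qed

lemmas tens_simps = bilinear_mapD(2-)[OF bilinear_tens]

lemma tens_sum_left: "t (\<Sum>i\<in>I. f i) b = (\<Sum>i\<in>I. t (f i) b)"
  by (rule linear_sumD[of sA sT "\<lambda>a. t a b"], rule linearI) (simp_all add: tens_simps A.vector_space_axioms T.vector_space_axioms)

lemma tens_sum_right: "t a (\<Sum>i\<in>I. f i) = (\<Sum>i\<in>I. t a (f i))"
  by (rule linear_sumD[of sB sT "t a"], rule linearI) (simp_all add: tens_simps B.vector_space_axioms T.vector_space_axioms)

lemma pure_tensor_induct:
  assumes "T.subspace P" "\<And>a b. t a b \<in> P"
  shows "X \<in> P"
proof -
  obtain p where "X = tensor_eval sT t p" using surj_eval by (metis surjD)
  then show ?thesis using assms unfolding tensor_eval_def
    by (auto intro!: T.subspace_sum T.subspace_scale)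
qed

lemma linear_eqI:
  assumes f: "Vector_Spaces.linear sT sC f" and g: "Vector_Spaces.linear sT sC g"
    and eq: "\<And>a b. f (t a b) = g (t a b)"
  shows "f X = g X"
proof -
  have "X \<in> {X. f X = g X}"
    by (rule pure_tensor_induct)
      (auto simp: eq T.subspace_def linear_addD[OF f] linear_addD[OF g] linear_scaleD[OF f]
        linear_scaleD[OF g] linear_zeroD[OF f] linear_zeroD[OF g])
  then show ?thesis by simp
qed

lemma ex_lift:
  assumes \<beta>: "bilinear_map sA sB sC \<beta>"
  shows "\<exists>h. Vector_Spaces.linear sT sC h \<and> (\<forall>a b. h (t a b) = \<beta> a b)"
proof -
  note C = bilinear_mapD(1)[OF \<beta>]
  let ?e = "tensor_eval sT t" and ?f = "tensor_eval sC \<beta>"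
  note e = linear_tensor_eval[OF T.vector_space_axioms, of t]
  note f = linear_tensor_eval[OF C, of \<beta>]
  have wd: "?f p = ?f q" if "?e p = ?e q" for p q
  proof -
    have "?e (p - q) = 0" using that by (simp add: linear_diffD[OF e])
    then have "?f (p - q) = 0" by (simp add: kernel_eval tensor_eval_span_relators[OF \<beta>])
    then show ?thesis by (simp add: linear_diffD[OF f])
  qed
  define h where "h X = ?f (inv ?e X)" for X
  have h: "h (?e p) = ?f p" for p
    unfolding h_def by (rule wd) (simp add: surj_f_inv_f surj_eval)
  have "Vector_Spaces.linear sT sC h"
  proof (rule linearI)
    fix X Y r
    obtain p q where p: "X = ?e p" and q: "Y = ?e q" using surj_eval by (metis surjD)
    show "h (X + Y) = h X + h Y"
      unfolding p q linear_addD[OF e, symmetric] h by (rule linear_addD[OF f])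
    show "h (sT r X) = sC r (h X)"
      unfolding p linear_scaleD[OF e, symmetric] h by (rule linear_scaleD[OF f])
  qed (rule C T.vector_space_axioms)+
  moreover have "h (t a b) = \<beta> a b" for a b
    using h[of "Poly_Mapping.single (a, b) 1"]
    by (simp add: tensor_eval_single[OF C] tensor_eval_single[OF T.vector_space_axioms]
        vector_space.vector_space_assms(4)[OF C])
  ultimately show ?thesis by blast
qed

lemma lift_unique:
  assumes "bilinear_map sA sB sC \<beta>" "Vector_Spaces.linear sT sC h" "\<And>a b. h (t a b) = \<beta> a b"
  shows "tensor_lift sT sC t \<beta> = h"
  unfolding tensor_lift_def
proof (rule the_equality)
  fix g
  assume g: "Vector_Spaces.linear sT sC g \<and> (\<forall>a b. g (t a b) = \<beta> a b)"
  show "g = h"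
  proof
    fix X show "g X = h X" using g assms by (intro linear_eqI[of sC g h X]) simp_all
  qed
qed (use assms in blast)

lemma
  assumes \<beta>: "bilinear_map sA sB sC \<beta>"
  shows linear_lift: "Vector_Spaces.linear sT sC (tensor_lift sT sC t \<beta>)"
    and lift_tens: "tensor_lift sT sC t \<beta> (t a b) = \<beta> a b"
proof -
  obtain h where "Vector_Spaces.linear sT sC h" "\<And>a b. h (t a b) = \<beta> a b"
    using ex_lift[OF \<beta>] by blast
  with lift_unique[OF \<beta> this]
  show "Vector_Spaces.linear sT sC (tensor_lift sT sC t \<beta>)"
    and "tensor_lift sT sC t \<beta> (t a b) = \<beta> a b" by simp_all
qed

lemma lift_sum_tens:
  assumes \<beta>: "bilinear_map sA sB sC \<beta>"
  shows "tensor_lift sT sC t \<beta> (\<Sum>i\<in>I. t (f i) (g i)) = (\<Sum>i\<in>I. \<beta> (f i) (g i))"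
  by (simp add: linear_sumD[OF linear_lift[OF \<beta>]] lift_tens[OF \<beta>])

lemma lift_add:
  assumes \<beta>: "bilinear_map sA sB sC \<beta>" and \<beta>': "bilinear_map sA sB sC \<beta>'"
  shows "tensor_lift sT sC t (\<lambda>a b. \<beta> a b + \<beta>' a b) X = tensor_lift sT sC t \<beta> X + tensor_lift sT sC t \<beta>' X"
proof -
  interpret C: vector_space sC using bilinear_mapD(1)[OF \<beta>] .
  have s: "bilinear_map sA sB sC (\<lambda>a b. \<beta> a b + \<beta>' a b)"
    by (rule bilinear_mapI)
      (simp_all add: bilinear_mapD[OF \<beta>] bilinear_mapD[OF \<beta>'] algebra_simps C.scale_right_distrib)
  note l = linear_lift[OF \<beta>] and l' = linear_lift[OF \<beta>']
  have "Vector_Spaces.linear sT sC (\<lambda>X. tensor_lift sT sC t \<beta> X + tensor_lift sT sC t \<beta>' X)"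
    by (rule linearI) (simp_all add: linear_addD[OF l] linear_addD[OF l'] linear_scaleD[OF l]
        linear_scaleD[OF l'] C.scale_right_distrib C.vector_space_axioms T.vector_space_axioms)
  from lift_unique[OF s this] show ?thesis by (simp add: lift_tens[OF \<beta>] lift_tens[OF \<beta>'])
qed

lemma linear_lift_lift:
  assumes \<beta>: "bilinear_map sA sB sC \<beta>" and f: "Vector_Spaces.linear sC sD f"
  shows "f (tensor_lift sT sC t \<beta> X) = tensor_lift sT sD t (\<lambda>a b. f (\<beta> a b)) X"
proof -
  have f': "bilinear_map sA sB sD (\<lambda>a b. f (\<beta> a b))"
    by (rule bilinear_mapI)
      (use f in \<open>simp_all add: bilinear_mapD[OF \<beta>] linear_addD[OF f] linear_scaleD[OF f]
        Vector_Spaces.linear_iff\<close>)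
  have "tensor_lift sT sD t (\<lambda>a b. f (\<beta> a b)) = f \<circ> tensor_lift sT sC t \<beta>"
    by (rule lift_unique[OF f'])
      (auto intro!: Vector_Spaces.linear_compose[OF linear_lift[OF \<beta>] f] simp: lift_tens[OF \<beta>])
  then show ?thesis by simp
qed

lemma
  assumes u: "bilinear_map sA' sB' sU u"
    and f: "Vector_Spaces.linear sA sA' f" and g: "Vector_Spaces.linear sB sB' g"
  shows linear_tensor_map: "Vector_Spaces.linear sT sU (tensor_map sT t sU u f g)"
    and tensor_map_tens: "tensor_map sT t sU u f g (t a b) = u (f a) (g b)"
proof -
  have "bilinear_map sA sB sU (\<lambda>a b. u (f a) (g b))"
    by (rule bilinear_mapI)
      (simp_all add: bilinear_mapD[OF u] linear_addD[OF f] linear_scaleD[OF f]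
        linear_addD[OF g] linear_scaleD[OF g])
  from linear_lift[OF this] lift_tens[OF this]
  show "Vector_Spaces.linear sT sU (tensor_map sT t sU u f g)"
    and "tensor_map sT t sU u f g (t a b) = u (f a) (g b)"
    by (simp_all add: tensor_map_def)
qed

end

section \<open>The Yang-Baxter equation in coordinates\<close>

locale based_R_matrix = tensor_cube V
  for V :: "('k::field, 'v::ab_group_add, 'vv::ab_group_add, 'vvv::ab_group_add) tensor_space"
    (structure) +
  fixes N :: nat and v :: "nat \<Rightarrow> 'v" and \<gamma> :: "'vv \<Rightarrow> 'vv" and c :: "nat \<Rightarrow> nat \<Rightarrow> nat \<Rightarrow> nat \<Rightarrow> 'k"
  assumes inj_basis: "inj_on v {1..N}" and indep_basis: "\<not> module.dependent (scl V) (v ` {1..N})"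
    and R_matrix: "R_matrix V \<gamma>"
    and structure_constants: "\<And>i j. i \<in> {1..N} \<Longrightarrow> j \<in> {1..N} \<Longrightarrow>
      \<gamma> (v i \<otimes> v j) = (\<Sum>m=1..N. \<Sum>n=1..N. scl2 V (c i j m n) (v m \<otimes> v n))"
begin

interpretation sq: tensor_product "scl V" "scl V" "scl2 V" "tens V" by (rule square)
interpretation cl: tensor_product "scl2 V" "scl V" "scl3 V" "tensl V" by (rule cube_left)
interpretation cr: tensor_product "scl V" "scl2 V" "scl3 V" "tensr V" by (rule cube_right)

text \<open>
  Coordinate functionals with respect to the basis: linear independence of the \<open>v\<^sub>i\<close> allows prescribing the
  values on them.
\<close>

lemma ex_coordinate:
  "\<exists>\<phi>. Vector_Spaces.linear (scl V) (*) \<phi> \<and> (\<forall>i\<in>{1..N}. \<phi> (v i) = (if i = m then 1 else 0))"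
proof -
  interpret p: vector_space_pair "scl V" "(*) :: 'k \<Rightarrow> 'k \<Rightarrow> 'k"
    by (simp add: vector_space_pair_def vector_space_field sq.A.vector_space_axioms)
  obtain \<phi> where "Vector_Spaces.linear (scl V) (*) \<phi>"
    "\<forall>x\<in>v ` {1..N}. \<phi> x = (if the_inv_into {1..N} v x = m then 1 else 0)"
    using p.linear_independent_extend[OF indep_basis,
        of "\<lambda>x. if the_inv_into {1..N} v x = m then 1 else 0"] by metis
  then show ?thesis
    using the_inv_into_f_f[OF inj_basis] by (intro exI[of _ \<phi>]) (simp del: atLeastAtMost_iff)
qed

definition coord :: "nat \<Rightarrow> 'v \<Rightarrow> 'k" where
  "coord m = (SOME \<phi>. Vector_Spaces.linear (scl V) (*) \<phi> \<and>
     (\<forall>i\<in>{1..N}. \<phi> (v i) = (if i = m then 1 else 0)))"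

lemma linear_coord: "Vector_Spaces.linear (scl V) (*) (coord m)"
  and coord_basis: "i \<in> {1..N} \<Longrightarrow> coord m (v i) = (if i = m then 1 else 0)"
  using someI_ex[OF ex_coordinate[of m]] by (auto simp: coord_def)

abbreviation cube :: "nat \<Rightarrow> nat \<Rightarrow> nat \<Rightarrow> 'vvv" where
  "cube i j k \<equiv> tensr V (v i) (v j \<otimes> v k)"

definition cube_coord :: "nat \<Rightarrow> nat \<Rightarrow> nat \<Rightarrow> 'vvv \<Rightarrow> 'k" where
  "cube_coord m n q = tensor_lift (scl3 V) (*) (tensr V)
     (\<lambda>x Y. coord m x * tensor_lift (scl2 V) (*) (tens V) (\<lambda>y z. coord n y * coord q z) Y)"

lemma
  shows linear_cube_coord: "Vector_Spaces.linear (scl3 V) (*) (cube_coord m n q)"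
    and cube_coord_basis: "i \<in> {1..N} \<Longrightarrow> j \<in> {1..N} \<Longrightarrow> k \<in> {1..N} \<Longrightarrow>
      cube_coord m n q (cube i j k) = (if i = m then 1 else 0) * (if j = n then 1 else 0) * (if k = q then 1 else 0)"
proof -
  have 2: "bilinear_map (scl V) (scl V) (*) (\<lambda>y z. coord n y * coord q z)"
    by (rule bilinear_mapI)
      (simp_all add: linear_addD[OF linear_coord] linear_scaleD[OF linear_coord] algebra_simps
        vector_space_field)
  note l = sq.linear_lift[OF 2]
  have 3: "bilinear_map (scl V) (scl2 V) (*)
     (\<lambda>x Y. coord m x * tensor_lift (scl2 V) (*) (tens V) (\<lambda>y z. coord n y * coord q z) Y)"
    by (rule bilinear_mapI)
      (simp_all add: linear_addD[OF linear_coord] linear_scaleD[OF linear_coord]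
        linear_addD[OF l] linear_scaleD[OF l] algebra_simps vector_space_field)
  show "Vector_Spaces.linear (scl3 V) (*) (cube_coord m n q)"
    unfolding cube_coord_def by (rule cr.linear_lift[OF 3])
  show "i \<in> {1..N} \<Longrightarrow> j \<in> {1..N} \<Longrightarrow> k \<in> {1..N} \<Longrightarrow>
      cube_coord m n q (cube i j k) = (if i = m then 1 else 0) * (if j = n then 1 else 0) * (if k = q then 1 else 0)"
    unfolding cube_coord_def by (simp add: cr.lift_tens[OF 3] sq.lift_tens[OF 2] coord_basis)
qed

text \<open>
  Tensor products of coordinate functionals give the coordinate functionals \<open>f\<close> on the tensor cube; these
  read the \<open>(m, n, q)\<close> coefficient off both sides of the braid relation, applied to
  \<open>v\<^sub>p \<otimes> v\<^sub>i \<otimes> v\<^sub>j\<close>.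
\<close>

lemma yang_baxter:
  assumes pij: "p \<in> {1..N}" "i \<in> {1..N}" "j \<in> {1..N}" and mnq: "m \<in> {1..N}" "n \<in> {1..N}" "q \<in> {1..N}"
  shows "(\<Sum>k=1..N. \<Sum>l=1..N. \<Sum>r=1..N. c i j k l * c p k m r * c r l n q) =
    (\<Sum>k=1..N. \<Sum>l=1..N. \<Sum>r=1..N. c p i k r * c r j l q * c k l m n)"
proof -
  have \<gamma>: "Vector_Spaces.linear (scl2 V) (scl2 V) \<gamma>" using R_matrix by (simp add: R_matrix_def)
  define L where "L = tensor_map (scl3 V) (tensl V) (scl3 V) (tensl V) \<gamma> id"
  define M where "M = tensor_map (scl3 V) (tensr V) (scl3 V) (tensr V) id \<gamma>"
  have braid: "M (L (M X)) = L (M (L X))" for X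
    using R_matrix by (simp add: R_matrix_def L_def M_def Let_def fun_eq_iff)
  have lL: "Vector_Spaces.linear (scl3 V) (scl3 V) L"
    unfolding L_def by (rule cl.linear_tensor_map[OF cl.bilinear_tens \<gamma> sq.A.linear_id])
  have lM: "Vector_Spaces.linear (scl3 V) (scl3 V) M"
    unfolding M_def by (rule cr.linear_tensor_map[OF cr.bilinear_tens sq.A.linear_id \<gamma>])
  have M: "M (cube x y z) = (\<Sum>k=1..N. \<Sum>l=1..N. scl3 V (c y z k l) (cube x k l))"
    if "x \<in> {1..N}" "y \<in> {1..N}" "z \<in> {1..N}" for x y z
    unfolding M_def using that
    by (simp add: cr.tensor_map_tens[OF cr.bilinear_tens sq.A.linear_id \<gamma>] structure_constants
        cr.tens_sum_right cr.tens_simps)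
  have L: "L (cube x y z) = (\<Sum>k=1..N. \<Sum>l=1..N. scl3 V (c x y k l) (cube k l z))"
    if "x \<in> {1..N}" "y \<in> {1..N}" "z \<in> {1..N}" for x y z
    unfolding L_def using that
    by (simp add: cl.tensor_map_tens[OF cl.bilinear_tens \<gamma> sq.A.linear_id] structure_constants
        cl.tens_sum_left cl.tens_simps tens_assoc[symmetric])
  \<comment> \<open>The composites of \<open>f\<close> with \<open>L\<close> and \<open>M\<close> are computed from the outside inwards: \<open>f \<circ> M\<close> and
    \<open>f \<circ> L\<close> on the basis, then \<open>f \<circ> M \<circ> L\<close> and \<open>f \<circ> L \<circ> M\<close>, so that each step expands only one
    application of \<open>\<gamma>\<close>.\<close>
  define f where "f = cube_coord m n q"
  have f: "Vector_Spaces.linear (scl3 V) (*) f" unfolding f_def by (rule linear_cube_coord)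
  have f_cube: "f (cube x y z) = (if x = m \<and> y = n \<and> z = q then 1 else 0)"
    if "x \<in> {1..N}" "y \<in> {1..N}" "z \<in> {1..N}" for x y z
    unfolding f_def using cube_coord_basis[OF that] by simp
  have fM': "g (M (cube x y z)) = (\<Sum>k=1..N. \<Sum>l=1..N. c y z k l * g (cube x k l))"
    and fL': "g (L (cube x y z)) = (\<Sum>k=1..N. \<Sum>l=1..N. c x y k l * g (cube k l z))"
    if "Vector_Spaces.linear (scl3 V) (*) g" "x \<in> {1..N}" "y \<in> {1..N}" "z \<in> {1..N}" for g x y z
    unfolding M[OF that(2-)] L[OF that(2-)] linear_sumD[OF that(1)] linear_scaleD[OF that(1)]
    by (rule refl)+
  have fM: "Vector_Spaces.linear (scl3 V) (*) (\<lambda>X. f (M X))"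
    and fL: "Vector_Spaces.linear (scl3 V) (*) (\<lambda>X. f (L X))"
    using Vector_Spaces.linear_compose[OF lM f] Vector_Spaces.linear_compose[OF lL f]
    by (simp_all add: o_def)
  have fML: "Vector_Spaces.linear (scl3 V) (*) (\<lambda>X. f (M (L X)))"
    and fLM: "Vector_Spaces.linear (scl3 V) (*) (\<lambda>X. f (L (M X)))"
    using Vector_Spaces.linear_compose[OF lL fM] Vector_Spaces.linear_compose[OF lM fL]
    by (simp_all add: o_def)
  have delta: "(\<Sum>k=1..N. \<Sum>l=1..N. h k l * (if P \<and> k = a \<and> l = b then 1 else 0)) = (if P then h a b else 0)"
    if "a \<in> {1..N}" "b \<in> {1..N}" for a b P and h :: "nat \<Rightarrow> nat \<Rightarrow> 'k"
  proof -
    have "(\<Sum>k=1..N. \<Sum>l=1..N. h k l * (if P \<and> k = a \<and> l = b then 1 else 0)) =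
        (\<Sum>k=1..N. if k = a then (\<Sum>l=1..N. if l = b then (if P then h a b else 0) else 0) else 0)"
    proof (intro sum.cong refl)
      fix k
      show "(\<Sum>l=1..N. h k l * (if P \<and> k = a \<and> l = b then 1 else 0)) =
          (if k = a then (\<Sum>l=1..N. if l = b then (if P then h a b else 0) else 0) else 0)"
        by (cases "k = a"; cases P) (simp_all add: if_distrib cong: if_cong)
    qed
    then show ?thesis using that by simp
  qed
  have fM_cube: "f (M (cube x y z)) = (if x = m then c y z n q else 0)"
    if "x \<in> {1..N}" "y \<in> {1..N}" "z \<in> {1..N}" for x y z
  proof -
    have "f (M (cube x y z)) = (\<Sum>k=1..N. \<Sum>l=1..N. c y z k l * (if x = m \<and> k = n \<and> l = q then 1 else 0))"
      unfolding fM'[OF f that] using that by (intro sum.cong refl) (simp only: f_cube)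
    then show ?thesis using delta[OF mnq(2,3), of "c y z" "x = m"] by simp
  qed
  have fL_cube: "f (L (cube x y z)) = (if z = q then c x y m n else 0)"
    if "x \<in> {1..N}" "y \<in> {1..N}" "z \<in> {1..N}" for x y z
  proof -
    have "f (L (cube x y z)) = (\<Sum>k=1..N. \<Sum>l=1..N. c x y k l * (if z = q \<and> k = m \<and> l = n then 1 else 0))"
      unfolding fL'[OF f that] using that by (intro sum.cong refl) (auto simp: f_cube)
    then show ?thesis using delta[OF mnq(1,2), of "c x y" "z = q"] by simp
  qed
  have fML_cube: "f (M (L (cube x y z))) = (\<Sum>r=1..N. c x y m r * c r z n q)"
    if "x \<in> {1..N}" "y \<in> {1..N}" "z \<in> {1..N}" for x y z
  proof -
    have "f (M (L (cube x y z))) = (\<Sum>k=1..N. \<Sum>l=1..N. c x y k l * (if k = m then c l z n q else 0))"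
      unfolding fL'[OF fM that] using that by (intro sum.cong refl) (simp only: fM_cube)
    also have "\<dots> = (\<Sum>k=1..N. if k = m then (\<Sum>l=1..N. c x y m l * c l z n q) else 0)"
      by (intro sum.cong refl) simp
    finally show ?thesis using mnq(1) by simp
  qed
  have fLM_cube: "f (L (M (cube x y z))) = (\<Sum>l=1..N. c y z l q * c x l m n)"
    if "x \<in> {1..N}" "y \<in> {1..N}" "z \<in> {1..N}" for x y z
  proof -
    have "f (L (M (cube x y z))) = (\<Sum>k=1..N. \<Sum>l=1..N. c y z k l * (if l = q then c x k m n else 0))"
      unfolding fM'[OF fL that] using that by (intro sum.cong refl) (simp only: fL_cube)
    also have "\<dots> = (\<Sum>k=1..N. \<Sum>l=1..N. if l = q then c y z k q * c x k m n else 0)"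
      by (intro sum.cong refl) simp
    finally show ?thesis using mnq(3) by simp
  qed
  have 1: "f (M (L (M (cube p i j)))) =
      (\<Sum>k=1..N. \<Sum>l=1..N. c i j k l * (\<Sum>r=1..N. c p k m r * c r l n q))"
    unfolding fM'[OF fML pij] using pij by (intro sum.cong refl) (simp only: fML_cube)
  have 2: "f (L (M (L (cube p i j)))) =
      (\<Sum>k=1..N. \<Sum>r=1..N. c p i k r * (\<Sum>l=1..N. c r j l q * c k l m n))"
    unfolding fL'[OF fLM pij] using pij by (intro sum.cong refl) (simp only: fLM_cube)
  have "(\<Sum>k=1..N. \<Sum>l=1..N. \<Sum>r=1..N. c i j k l * c p k m r * c r l n q) =
      (\<Sum>k=1..N. \<Sum>l=1..N. c i j k l * (\<Sum>r=1..N. c p k m r * c r l n q))"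
    by (simp add: sum_distrib_left mult.assoc)
  also have "\<dots> = (\<Sum>k=1..N. \<Sum>r=1..N. c p i k r * (\<Sum>l=1..N. c r j l q * c k l m n))"
    using 1 2 braid by simp
  also have "\<dots> = (\<Sum>k=1..N. \<Sum>r=1..N. \<Sum>l=1..N. c p i k r * c r j l q * c k l m n)"
    by (simp add: sum_distrib_left mult.assoc)
  also have "\<dots> = (\<Sum>k=1..N. \<Sum>l=1..N. \<Sum>r=1..N. c p i k r * c r j l q * c k l m n)"
    by (intro sum.cong refl sum.swap)
  finally show ?thesis .
qed

end

section \<open>The tensor square of an algebra\<close>

locale algebra_with_cube = tensor_cube A + alg: k_algebra "scl A"
  for A :: "('k::field, 'a::ring_1, 'aa::ab_group_add, 'aaa::ab_group_add) tensor_space"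
    (structure)
begin

sublocale sq: tensor_product "scl A" "scl A" "scl2 A" "tens A" by (rule square)
sublocale cl: tensor_product "scl2 A" "scl A" "scl3 A" "tensl A" by (rule cube_left)
sublocale cr: tensor_product "scl A" "scl2 A" "scl3 A" "tensr A" by (rule cube_right)

lemma bilinear_mult: "bilinear_map (scl A) (scl A) (scl A) (*)"
  by (rule bilinear_mapI)
    (simp_all add: alg.vector_space_axioms alg.scale_mult_left alg.scale_mult_right algebra_simps)

lemma linear_mult_map: "Vector_Spaces.linear (scl2 A) (scl A) (mult_map A)"
  and mult_map_tens: "mult_map A (x \<otimes> y) = x * y"
  unfolding mult_map_def by (rule sq.linear_lift[OF bilinear_mult] sq.lift_tens[OF bilinear_mult])+

text \<open>
  The expression \<open>\<Sum> q x\<^sub>1 x\<^sub>2 y\<^sub>1 y\<^sub>2\<close> for \<open>X = \<Sum> x\<^sub>1 \<otimes> x\<^sub>2\<close> and \<open>Y = \<Sum> y\<^sub>1 \<otimes> y\<^sub>2\<close>. Both the product on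
  the tensor square and the two sides of the commutation rule have this shape.
\<close>

definition double_lift ::
    "('k \<Rightarrow> 'c \<Rightarrow> 'c::ab_group_add) \<Rightarrow> ('a \<Rightarrow> 'a \<Rightarrow> 'a \<Rightarrow> 'a \<Rightarrow> 'c) \<Rightarrow> 'aa \<Rightarrow> 'aa \<Rightarrow> 'c" where
  "double_lift sC q X Y = tensor_lift (scl2 A) sC (tens A)
     (\<lambda>a b. tensor_lift (scl2 A) sC (tens A) (q a b) Y) X"

lemma
  assumes inner: "\<And>a b. bilinear_map (scl A) (scl A) sC (q a b)"
    and outer: "\<And>c d. bilinear_map (scl A) (scl A) sC (\<lambda>a b. q a b c d)"
  shows bilinear_double_lift: "bilinear_map (scl2 A) (scl2 A) sC (double_lift sC q)"
    and double_lift_tens: "double_lift sC q (a \<otimes> b) (c \<otimes> d) = q a b c d"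
proof -
  let ?L = "tensor_lift (scl2 A) sC (tens A)"
  interpret C: vector_space sC using bilinear_mapD(1)[OF inner] .
  note lin = sq.linear_lift[OF inner]
  have o: "bilinear_map (scl A) (scl A) sC (\<lambda>a b. ?L (q a b) Y)" for Y
  proof (rule bilinear_mapI)
    fix a a' b b' r
    have "q a (b + b') = (\<lambda>c d. q a b c d + q a b' c d)" "q (a + a') b = (\<lambda>c d. q a b c d + q a' b c d)"
      "q a (scl A r b) = (\<lambda>c d. sC r (q a b c d))" "q (scl A r a) b = (\<lambda>c d. sC r (q a b c d))"
      using bilinear_mapD(2-)[OF outer] by (simp_all add: fun_eq_iff)
    then show "?L (q a (b + b')) Y = ?L (q a b) Y + ?L (q a b') Y"
      "?L (q (a + a') b) Y = ?L (q a b) Y + ?L (q a' b) Y"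
      "?L (q a (scl A r b)) Y = sC r (?L (q a b) Y)" "?L (q (scl A r a) b) Y = sC r (?L (q a b) Y)"
      by (simp_all add: sq.lift_add[OF inner inner] sq.linear_lift_lift[OF inner C.linear_scale_self])
  qed (rule C.vector_space_axioms)
  note lo = sq.linear_lift[OF o]
  show "bilinear_map (scl2 A) (scl2 A) sC (double_lift sC q)"
    unfolding double_lift_def
    by (rule bilinear_mapI)
      (simp_all add: linear_addD[OF lin] linear_scaleD[OF lin] linear_addD[OF lo] linear_scaleD[OF lo]
        sq.lift_add[OF o o] sq.linear_lift_lift[OF o C.linear_scale_self] C.vector_space_axioms)
  show "double_lift sC q (a \<otimes> b) (c \<otimes> d) = q a b c d"
    unfolding double_lift_def sq.lift_tens[OF o] by (rule sq.lift_tens[OF inner])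
qed

lemma
  assumes \<mu>: "Vector_Spaces.linear (scl2 A) (scl A) \<mu>"
  shows bilinear_tensor_mult: "bilinear_map (scl2 A) (scl2 A) (scl2 A) (tensor_mult A \<mu>)"
    and tensor_mult_tens: "tensor_mult A \<mu> (a \<otimes> b) (c \<otimes> d) = \<mu> (a \<otimes> c) \<otimes> \<mu> (b \<otimes> d)"
proof -
  let ?q = "\<lambda>a b c d. \<mu> (a \<otimes> c) \<otimes> \<mu> (b \<otimes> d)"
  have eq: "tensor_mult A \<mu> = double_lift (scl2 A) ?q"
    by (simp add: fun_eq_iff tensor_mult_def double_lift_def)
  have q: "bilinear_map (scl A) (scl A) (scl2 A) (?q a b)"
    "bilinear_map (scl A) (scl A) (scl2 A) (\<lambda>a b. ?q a b c d)" for a b c d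
    by (rule bilinear_mapI; simp add: sq.tens_simps linear_addD[OF \<mu>] linear_scaleD[OF \<mu>]
        sq.T.vector_space_axioms)+
  show "bilinear_map (scl2 A) (scl2 A) (scl2 A) (tensor_mult A \<mu>)"
    "tensor_mult A \<mu> (a \<otimes> b) (c \<otimes> d) = \<mu> (a \<otimes> c) \<otimes> \<mu> (b \<otimes> d)"
    unfolding eq by (rule bilinear_double_lift[OF q] double_lift_tens[OF q])+
qed

lemma
  assumes h: "bilinear_map (scl2 A) (scl2 A) sC h"
  shows linear_left: "Vector_Spaces.linear (scl2 A) sC (\<lambda>X. h X Y)"
    and linear_right: "Vector_Spaces.linear (scl2 A) sC (h X)"
  by (rule linearI; simp add: bilinear_mapD[OF h] sq.T.vector_space_axioms)+

abbreviation mult2 :: "'aa \<Rightarrow> 'aa \<Rightarrow> 'aa"  (infixl "\<odot>" 70) where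
  "X \<odot> Y \<equiv> tensor_mult A (mult_map A) X Y"

lemma mult2_tens: "(a \<otimes> b) \<odot> (c \<otimes> d) = (a * c) \<otimes> (b * d)"
  by (simp add: tensor_mult_tens[OF linear_mult_map] mult_map_tens)

lemmas linear_mult2 = linear_left[OF bilinear_tensor_mult[OF linear_mult_map]]
  linear_right[OF bilinear_tensor_mult[OF linear_mult_map]]

lemmas mult2_simps = linear_addD[OF linear_mult2(1)] linear_addD[OF linear_mult2(2)]
  linear_scaleD[OF linear_mult2(1)] linear_scaleD[OF linear_mult2(2)]
  linear_sumD[OF linear_mult2(1)] linear_sumD[OF linear_mult2(2)]

text \<open>
  Pure tensors span, so identities between bilinear maps on the tensor square are identities in four
  elements of the algebra.
\<close>

lemma bilinear_eqI:
  assumes f: "bilinear_map (scl2 A) (scl2 A) sC f" and g: "bilinear_map (scl2 A) (scl2 A) sC g"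
    and eq: "\<And>a b c d. f (a \<otimes> b) (c \<otimes> d) = g (a \<otimes> b) (c \<otimes> d)"
  shows "f X Y = g X Y"
proof -
  have "f (a \<otimes> b) Y = g (a \<otimes> b) Y" for a b
    by (rule sq.linear_eqI[OF linear_right[OF f] linear_right[OF g]]) (rule eq)
  then show ?thesis
    by (rule sq.linear_eqI[OF linear_left[OF f] linear_left[OF g]])
qed

lemma mult2_assoc: "(X \<odot> Y) \<odot> Z = X \<odot> (Y \<odot> Z)"
proof -
  have 1: "(a \<otimes> b \<odot> (c \<otimes> d)) \<odot> Z = a \<otimes> b \<odot> (c \<otimes> d \<odot> Z)" for a b c d
  proof (rule sq.linear_eqI[of "scl2 A" _ _ Z])
    show "Vector_Spaces.linear (scl2 A) (scl2 A) (\<lambda>Z. a \<otimes> b \<odot> (c \<otimes> d \<odot> Z))"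
      using Vector_Spaces.linear_compose[OF linear_mult2(2) linear_mult2(2)] by (simp add: o_def)
  qed (simp_all add: linear_mult2 mult2_tens mult.assoc)
  show ?thesis
    by (rule bilinear_eqI[of "scl2 A" "\<lambda>X Y. (X \<odot> Y) \<odot> Z" "\<lambda>X Y. X \<odot> (Y \<odot> Z)", OF _ _ 1];
        rule bilinear_mapI; simp add: mult2_simps sq.T.vector_space_axioms)
qed

lemma mult2_one: "(1 \<otimes> 1) \<odot> X = X" "X \<odot> (1 \<otimes> 1) = X"
  by (rule sq.linear_eqI[of "scl2 A" _ "\<lambda>X. X"];
      simp add: linear_mult2 sq.T.linear_ident mult2_tens)+

lemma algebra_on_square: "algebra_on (scl2 A) UNIV (1 \<otimes> 1) (\<odot>)"
  by unfold_locales (simp_all add: mult2_simps mult2_assoc mult2_one)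

lemma linear_square_map:
  assumes f: "Vector_Spaces.linear (scl A) (scl A) f"
  shows "Vector_Spaces.linear (scl2 A) (scl2 A) (tensor_square_map A f)"
    and "tensor_square_map A f (x \<otimes> y) = f x \<otimes> f y"
  by (rule sq.linear_tensor_map[OF sq.bilinear_tens f f] sq.tensor_map_tens[OF sq.bilinear_tens f f])+

end

section \<open>The bialgebra structure of the FRT quantum group\<close>

text \<open>
  The entries may lie in a noncommutative ring, since the generators \<open>T\<^sub>i\<^sup>j\<close> themselves are treated as a matrix.
\<close>

definition matmul :: "'i set \<Rightarrow> ('i \<Rightarrow> 'i \<Rightarrow> 'r::semiring_0) \<Rightarrow> ('i \<Rightarrow> 'i \<Rightarrow> 'r) \<Rightarrow> 'i \<Rightarrow> 'i \<Rightarrow> 'r" where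
  "matmul I f g i j = (\<Sum>k\<in>I. f i k * g k j)"

lemma matmul_assoc: "matmul I (matmul I f g) h = matmul I f (matmul I g h)"
proof -
  have "(\<Sum>k\<in>I. (\<Sum>l\<in>I. f i l * g l k) * h k j) = (\<Sum>k\<in>I. f i k * (\<Sum>l\<in>I. g k l * h l j))" for i j
    unfolding sum_distrib_left sum_distrib_right by (subst sum.swap) (simp add: mult.assoc)
  then show ?thesis by (simp add: matmul_def fun_eq_iff)
qed

lemma matmul_cong:
  "(\<And>k. k \<in> I \<Longrightarrow> f i k = f' i k) \<Longrightarrow> (\<And>k. k \<in> I \<Longrightarrow> g k j = g' k j) \<Longrightarrow> matmul I f g i j = matmul I f' g' i j"
  by (simp add: matmul_def)

definition relators :: "nat \<Rightarrow> (nat \<Rightarrow> nat \<Rightarrow> nat \<Rightarrow> nat \<Rightarrow> 'k::field) \<Rightarrow> (nat \<times> nat, 'k) free_algebra set" where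
  "relators N c =
     {frt_relator N c i j m n | i j m n. i \<in> {1..N} \<and> j \<in> {1..N} \<and> m \<in> {1..N} \<and> n \<in> {1..N}}"

lemma relators_closed: "relators N c \<subseteq> free_algebra_on ({1..N} \<times> {1..N})"
  unfolding relators_def frt_relator_def
  by (auto intro!: free_algebra_on_closed free_algebra_on_sum free_algebra_on_basic)

lemma (in algebra_on) algebra_eval_relator:
  assumes x: "\<And>i j. i \<in> {1..N} \<Longrightarrow> j \<in> {1..N} \<Longrightarrow> x i j \<in> C"
    and ijmn: "i \<in> {1..N}" "j \<in> {1..N}" "m' \<in> {1..N}" "n \<in> {1..N}"
  shows "algebra_eval (\<lambda>(i, j). x i j) (frt_relator N c i j m' n) =
    (\<Sum>k=1..N. \<Sum>l=1..N. s (c i j k l) (m (x k m') (x l n))) -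
    (\<Sum>k=1..N. \<Sum>l=1..N. s (c k l m' n) (m (x i k) (x j l)))"
proof -
  let ?G = "{1..N} \<times> {1..N}" and ?x = "\<lambda>(i, j). x i j"
  have X: "?x ` ?G \<subseteq> C" using x by auto
  note E = linear_algebra_eval[of ?x]
  have c: "algebra_eval ?x (free_const r) = s r e" for r
    by (simp add: free_const_def algebra_eval_single word_eval_def zero_free_monoid_def)
  have g: "algebra_eval ?x (free_gen (i, j)) = x i j" "free_gen (i, j) \<in> free_algebra_on ?G"
    if "i \<in> {1..N}" "j \<in> {1..N}" for i j
    using that x by (simp_all add: algebra_eval_gen free_algebra_on_basic)
  note eC = unit_closed subspace_scale[OF carrier_subspace] mult_closed
  have 1: "algebra_eval ?x (free_const r * free_gen p * free_gen q) = s r (m (?x p) (?x q))"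
   and 2: "algebra_eval ?x (free_gen p * free_gen q * free_const r) = s r (m (?x p) (?x q))"
    if "p \<in> ?G" "q \<in> ?G" for r p q
  proof -
    from that g obtain p1 p2 q1 q2 where pq: "p = (p1, p2)" "q = (q1, q2)"
      "p1 \<in> {1..N}" "p2 \<in> {1..N}" "q1 \<in> {1..N}" "q2 \<in> {1..N}" by auto
    note in_F = free_algebra_on_basic(3)[of r ?G] g(2)[OF pq(3,4)] g(2)[OF pq(5,6)]
    note xx = x[OF pq(3,4)] x[OF pq(5,6)]
    show "algebra_eval ?x (free_const r * free_gen p * free_gen q) = s r (m (?x p) (?x q))"
      unfolding pq using in_F pq(3-) xx
      by (simp only: algebra_eval_mult[OF X] free_algebra_on_closed c g mult_scale_left eC unit_left split)
    show "algebra_eval ?x (free_gen p * free_gen q * free_const r) = s r (m (?x p) (?x q))"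
      unfolding pq using in_F pq(3-) xx
      by (simp only: algebra_eval_mult[OF X] free_algebra_on_closed c g mult_scale_right eC unit_right split)
  qed
  show ?thesis
    unfolding frt_relator_def linear_diffD[OF E] linear_sumD[OF E]
    by (intro arg_cong2[of _ _ _ _ "(-)"] sum.cong refl; subst 1 2; use ijmn in simp)
qed

locale frt_algebra_cube = tensor_cube A
  for A :: "('k::field, 'a::ring_1, 'aa::ab_group_add, 'aaa::ab_group_add) tensor_space"
    (structure) +
  fixes N :: nat and c :: "nat \<Rightarrow> nat \<Rightarrow> nat \<Rightarrow> nat \<Rightarrow> 'k" and T :: "nat \<Rightarrow> nat \<Rightarrow> 'a"
  assumes frt: "frt_algebra N c (scl A) T"
begin

lemma k_algebra: "k_algebra (scl A)"
  using frt by (simp add: frt_algebra_def presented_algebra_def)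

sublocale algebra_with_cube A
  by (simp add: algebra_with_cube_def k_algebra tensor_cube_axioms)

sublocale presented "scl A" "{1..N} \<times> {1..N}" "relators N c" "\<lambda>(i, j). T i j"
  using frt relators_closed by unfold_locales (simp_all add: frt_algebra_def relators_def)

text \<open>
  The universal property for the FRT relations: a morphism out of \<open>A\<close> is a matrix \<open>x\<close> in the target
  that satisfies the relation required of \<open>T\<close>.
\<close>

lemma frt_lift:
  assumes tgt: "algebra_on sT C e m"
    and x: "\<And>i j. i \<in> {1..N} \<Longrightarrow> j \<in> {1..N} \<Longrightarrow> x i j \<in> C"
    and rel: "\<And>i j p q. i \<in> {1..N} \<Longrightarrow> j \<in> {1..N} \<Longrightarrow> p \<in> {1..N} \<Longrightarrow> q \<in> {1..N} \<Longrightarrow>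
      (\<Sum>k=1..N. \<Sum>l=1..N. sT (c i j k l) (m (x k p) (x l q))) =
      (\<Sum>k=1..N. \<Sum>l=1..N. sT (c k l p q) (m (x i k) (x j l)))"
  shows "\<exists>h. Vector_Spaces.linear (scl A) sT h \<and> h 1 = e \<and> (\<forall>a b. h (a * b) = m (h a) (h b)) \<and>
    (\<forall>i\<in>{1..N}. \<forall>j\<in>{1..N}. h (T i j) = x i j) \<and> range h \<subseteq> C"
proof -
  have "\<exists>h. Vector_Spaces.linear (scl A) sT h \<and> h 1 = e \<and> (\<forall>a b. h (a * b) = m (h a) (h b)) \<and>
    (\<forall>g\<in>{1..N}\<times>{1..N}. h ((\<lambda>(i, j). T i j) g) = (\<lambda>(i, j). x i j) g) \<and> range h \<subseteq> C"
  proof (rule lift[OF tgt])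
    fix p assume "p \<in> relators N c"
    then obtain i j a b where p: "p = frt_relator N c i j a b"
      and I: "i \<in> {1..N}" "j \<in> {1..N}" "a \<in> {1..N}" "b \<in> {1..N}"
      unfolding relators_def by blast
    have "algebra_on.algebra_eval sT e m (\<lambda>(i, j). x i j) p =
      (\<Sum>k=1..N. \<Sum>l=1..N. sT (c i j k l) (m (x k a) (x l b))) -
      (\<Sum>k=1..N. \<Sum>l=1..N. sT (c k l a b) (m (x i k) (x j l)))"
      unfolding p by (rule algebra_on.algebra_eval_relator[OF tgt x I])
    then show "algebra_on.algebra_eval sT e m (\<lambda>(i, j). x i j) p = 0"
      unfolding rel[OF I] by simp
  qed (use x in auto)
  then show ?thesis by auto
qed

lemma frt_relation:
  assumes "i \<in> {1..N}" "j \<in> {1..N}" "m \<in> {1..N}" "n \<in> {1..N}"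
  shows "(\<Sum>k=1..N. \<Sum>l=1..N. scl A (c i j k l) (T k m * T l n)) =
    (\<Sum>k=1..N. \<Sum>l=1..N. scl A (c k l m n) (T i k * T j l))"
proof -
  have "frt_relator N c i j m n \<in> relators N c" using assms by (auto simp: relators_def)
  from relator_zero[OF this]
    algebra_on.algebra_eval_relator[OF alg.algebra_on_UNIV, of N T i j m n c] assms
  show ?thesis by (simp add: alg.free_eval_eq)
qed

lemma frt_induct [consumes 0, case_names subspace one gen]:
  assumes "alg.subspace P" "1 \<in> P"
    "\<And>i j a. i \<in> {1..N} \<Longrightarrow> j \<in> {1..N} \<Longrightarrow> a \<in> P \<Longrightarrow> T i j * a \<in> P"
  shows "a \<in> P"
  by (rule generator_induct) (use assms in auto)

subsection \<open>The comultiplication\<close>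

text \<open>
  With \<open>x\<^sub>i\<^sup>j = \<Sum>\<^sub>k T\<^sub>i\<^sup>k \<otimes> T\<^sub>k\<^sup>j\<close> one has \<open>x\<^sub>k\<^sup>p x\<^sub>l\<^sup>q = \<Sum>\<^sub>a\<^sub>b T\<^sub>k\<^sup>a T\<^sub>l\<^sup>b \<otimes> T\<^sub>a\<^sup>p T\<^sub>b\<^sup>q\<close>. The coefficients \<open>c\<close> move
  from the left of the first tensor factor to its right by the relations of \<open>A\<close>, are shifted to the second factor,
  and move to the right of that factor by the relations again.
\<close>

lemma ex_comult:
  "\<exists>\<Delta>. Vector_Spaces.linear (scl A) (scl2 A) \<Delta> \<and> \<Delta> 1 = 1 \<otimes> 1 \<and>
     (\<forall>x y. \<Delta> (x * y) = \<Delta> x \<odot> \<Delta> y) \<and>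
     (\<forall>i\<in>{1..N}. \<forall>j\<in>{1..N}. \<Delta> (T i j) = (\<Sum>k=1..N. T i k \<otimes> T k j))"
proof -
  let ?x = "\<lambda>i j. \<Sum>k=1..N. T i k \<otimes> T k j"
  have mm: "?x k p \<odot> ?x l q = (\<Sum>a=1..N. \<Sum>b=1..N. (T k a * T l b) \<otimes> (T a p * T b q))" for k p l q
    by (simp add: mult2_simps mult2_tens) (rule sum.swap)
  have "(\<Sum>k=1..N. \<Sum>l=1..N. scl2 A (c i j k l) (?x k p \<odot> ?x l q)) =
      (\<Sum>k=1..N. \<Sum>l=1..N. scl2 A (c k l p q) (?x i k \<odot> ?x j l))"
    if ijpq: "i \<in> {1..N}" "j \<in> {1..N}" "p \<in> {1..N}" "q \<in> {1..N}" for i j p q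
  proof -
    have "(\<Sum>k=1..N. \<Sum>l=1..N. scl2 A (c i j k l) (?x k p \<odot> ?x l q)) =
      (\<Sum>(k,l)\<in>{1..N}\<times>{1..N}. \<Sum>(a,b)\<in>{1..N}\<times>{1..N}. scl A (c i j k l) (T k a * T l b) \<otimes> (T a p * T b q))"
      unfolding mm by (simp add: sum.cartesian_product[symmetric] sq.T.scale_sum_right sq.tens_simps)
    also have "\<dots> = (\<Sum>(a,b)\<in>{1..N}\<times>{1..N}. \<Sum>(k,l)\<in>{1..N}\<times>{1..N}. scl A (c i j k l) (T k a * T l b) \<otimes> (T a p * T b q))"
      unfolding case_prod_unfold by (rule sum.swap)
    also have "\<dots> = (\<Sum>(a,b)\<in>{1..N}\<times>{1..N}. (\<Sum>k=1..N. \<Sum>l=1..N. scl A (c i j k l) (T k a * T l b)) \<otimes> (T a p * T b q))"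
      by (simp add: sum.cartesian_product[symmetric] sq.tens_sum_left)
    also have "\<dots> = (\<Sum>(a,b)\<in>{1..N}\<times>{1..N}. (\<Sum>k=1..N. \<Sum>l=1..N. scl A (c k l a b) (T i k * T j l)) \<otimes> (T a p * T b q))"
      using ijpq by (intro sum.cong refl) (clarsimp simp only: mem_Sigma_iff frt_relation)
    also have "\<dots> = (\<Sum>(a,b)\<in>{1..N}\<times>{1..N}. \<Sum>(k,l)\<in>{1..N}\<times>{1..N}. (T i k * T j l) \<otimes> scl A (c k l a b) (T a p * T b q))"
      by (simp add: sum.cartesian_product[symmetric] sq.tens_sum_left sq.tens_simps)
    also have "\<dots> = (\<Sum>(k,l)\<in>{1..N}\<times>{1..N}. \<Sum>(a,b)\<in>{1..N}\<times>{1..N}. (T i k * T j l) \<otimes> scl A (c k l a b) (T a p * T b q))"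
      unfolding case_prod_unfold by (rule sum.swap)
    also have "\<dots> = (\<Sum>(k,l)\<in>{1..N}\<times>{1..N}. (T i k * T j l) \<otimes> (\<Sum>a=1..N. \<Sum>b=1..N. scl A (c k l a b) (T a p * T b q)))"
      by (simp add: sum.cartesian_product[symmetric] sq.tens_sum_right)
    also have "\<dots> = (\<Sum>(k,l)\<in>{1..N}\<times>{1..N}. (T i k * T j l) \<otimes> (\<Sum>a=1..N. \<Sum>b=1..N. scl A (c a b p q) (T k a * T l b)))"
      using ijpq by (intro sum.cong refl) (clarsimp simp only: mem_Sigma_iff frt_relation)
    also have "\<dots> = (\<Sum>(k,l)\<in>{1..N}\<times>{1..N}. \<Sum>(a,b)\<in>{1..N}\<times>{1..N}. scl2 A (c a b p q) ((T i k * T j l) \<otimes> (T k a * T l b)))"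
      by (simp add: sum.cartesian_product[symmetric] sq.tens_sum_right sq.tens_simps)
    also have "\<dots> = (\<Sum>(a,b)\<in>{1..N}\<times>{1..N}. \<Sum>(k,l)\<in>{1..N}\<times>{1..N}. scl2 A (c a b p q) ((T i k * T j l) \<otimes> (T k a * T l b)))"
      unfolding case_prod_unfold by (rule sum.swap)
    also have "\<dots> = (\<Sum>k=1..N. \<Sum>l=1..N. scl2 A (c k l p q) (?x i k \<odot> ?x j l))"
      unfolding mm by (simp add: sum.cartesian_product[symmetric] sq.T.scale_sum_right)
    finally show ?thesis .
  qed
  then show ?thesis using frt_lift[OF algebra_on_square, of ?x] by blast
qed

lemma multiplicative_unique:
  assumes f: "Vector_Spaces.linear (scl A) sT f" and g: "Vector_Spaces.linear (scl A) sT g"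
    and "f 1 = g 1" "\<And>x y. f (x * y) = m (f x) (f y)" "\<And>x y. g (x * y) = m (g x) (g y)"
    and "\<And>i j. i \<in> {1..N} \<Longrightarrow> j \<in> {1..N} \<Longrightarrow> f (T i j) = g (T i j)"
  shows "f x = g x"
proof -
  have "x \<in> {x. f x = g x}"
    by (rule frt_induct)
      (use assms in \<open>auto simp: alg.subspace_def linear_addD[OF f] linear_addD[OF g]
        linear_scaleD[OF f] linear_scaleD[OF g] linear_zeroD[OF f] linear_zeroD[OF g]\<close>)
  then show ?thesis by simp
qed

abbreviation \<Delta> :: "'a \<Rightarrow> 'aa" where "\<Delta> \<equiv> frt_comult N A T"

lemma comult_properties:
  "Vector_Spaces.linear (scl A) (scl2 A) \<Delta> \<and> \<Delta> 1 = 1 \<otimes> 1 \<and> (\<forall>x y. \<Delta> (x * y) = \<Delta> x \<odot> \<Delta> y) \<and>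
     (\<forall>i\<in>{1..N}. \<forall>j\<in>{1..N}. \<Delta> (T i j) = (\<Sum>k=1..N. T i k \<otimes> T k j))"
proof -
  have "\<exists>!\<Delta>. Vector_Spaces.linear (scl A) (scl2 A) \<Delta> \<and> \<Delta> 1 = 1 \<otimes> 1 \<and>
     (\<forall>x y. \<Delta> (x * y) = \<Delta> x \<odot> \<Delta> y) \<and>
     (\<forall>i\<in>{1..N}. \<forall>j\<in>{1..N}. \<Delta> (T i j) = (\<Sum>k=1..N. T i k \<otimes> T k j))"
  proof (rule ex_ex1I[OF ex_comult], rule ext)
    fix f g x
    assume "Vector_Spaces.linear (scl A) (scl2 A) f \<and> f 1 = 1 \<otimes> 1 \<and>
     (\<forall>x y. f (x * y) = f x \<odot> f y) \<and>
     (\<forall>i\<in>{1..N}. \<forall>j\<in>{1..N}. f (T i j) = (\<Sum>k=1..N. T i k \<otimes> T k j))"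
     "Vector_Spaces.linear (scl A) (scl2 A) g \<and> g 1 = 1 \<otimes> 1 \<and>
     (\<forall>x y. g (x * y) = g x \<odot> g y) \<and>
     (\<forall>i\<in>{1..N}. \<forall>j\<in>{1..N}. g (T i j) = (\<Sum>k=1..N. T i k \<otimes> T k j))"
    then show "f x = g x" by - (rule multiplicative_unique[of "scl2 A" f g "(\<odot>)"], simp_all)
  qed
  from theI'[OF this] show ?thesis unfolding frt_comult_def .
qed

lemma linear_comult: "Vector_Spaces.linear (scl A) (scl2 A) \<Delta>"
  and comult_one: "\<Delta> 1 = 1 \<otimes> 1"
  and comult_mult: "\<Delta> (x * y) = \<Delta> x \<odot> \<Delta> y"
  and comult_gen: "i \<in> {1..N} \<Longrightarrow> j \<in> {1..N} \<Longrightarrow> \<Delta> (T i j) = (\<Sum>k=1..N. T i k \<otimes> T k j)"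
  using comult_properties by simp_all

subsection \<open>Words in the generators\<close>

fun word :: "nat list \<Rightarrow> nat list \<Rightarrow> 'a" where
  "word (i # I) (j # J) = T i j * word I J"
| "word _ _ = 1"

definition idx :: "nat \<Rightarrow> nat list set" where
  "idx n = {I. length I = n \<and> set I \<subseteq> {1..N}}"

lemma finite_idx: "finite (idx n)"
  using finite_lists_length_eq[of "{1..N}" n] by (simp add: idx_def conj_commute)

lemma idx_0: "idx 0 = {[]}"
  by (auto simp: idx_def)

lemma idx_Suc: "I \<in> idx (Suc n) \<longleftrightarrow> (\<exists>i\<in>{1..N}. \<exists>J\<in>idx n. I = i # J)"
  by (cases I) (auto simp: idx_def)

lemma sum_idx_Suc: "(\<Sum>I\<in>idx (Suc n). f I) = (\<Sum>i=1..N. \<Sum>I\<in>idx n. f (i # I))"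
proof -
  have "idx (Suc n) = (\<lambda>(i, I). i # I) ` ({1..N} \<times> idx n)" by (auto simp: idx_Suc)
  then have "(\<Sum>I\<in>idx (Suc n). f I) = (\<Sum>(i, I)\<in>{1..N} \<times> idx n. f (i # I))"
    by (simp add: sum.reindex inj_on_def case_prod_unfold)
  then show ?thesis by (simp add: sum.cartesian_product)
qed

text \<open>
  The words span \<open>A\<close>: their span contains \<open>1\<close>, the empty word, and is stable under left multiplication
  by generators.
\<close>

lemma word_induct:
  assumes P: "alg.subspace P" and w: "\<And>n I J. I \<in> idx n \<Longrightarrow> J \<in> idx n \<Longrightarrow> word I J \<in> P"
  shows "x \<in> P"
proof -
  define W where "W = {word I J | n I J. I \<in> idx n \<and> J \<in> idx n}"
  have "x \<in> alg.span W"
  proof (induction rule: frt_induct)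
    case one
    have "word [] [] \<in> W" unfolding W_def using idx_0 by blast
    then show ?case by (simp add: alg.span_base)
  next
    case (gen i j a)
    have l: "Vector_Spaces.linear (scl A) (scl A) ((*) (T i j))"
      by (rule linearI) (simp_all add: algebra_simps alg.scale_mult_right alg.vector_space_axioms)
    have "T i j * b \<in> W" if "b \<in> W" for b
    proof -
      from that obtain n I J where "b = word I J" "I \<in> idx n" "J \<in> idx n" by (auto simp: W_def)
      then have "T i j * b = word (i # I) (j # J)" "i # I \<in> idx (Suc n)" "j # J \<in> idx (Suc n)"
        using gen by (auto simp: idx_Suc)
      then show ?thesis unfolding W_def by blast
    qed
    then have "W \<subseteq> {b. T i j * b \<in> alg.span W}" by (auto intro: alg.span_base)
    moreover have "alg.subspace {b. T i j * b \<in> alg.span W}"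
      by (auto simp: alg.subspace_def linear_addD[OF l] linear_scaleD[OF l]
          intro: alg.span_add alg.span_scale alg.span_zero)
    ultimately have "alg.span W \<subseteq> {b. T i j * b \<in> alg.span W}" by (rule alg.span_minimal)
    then show ?case using gen by blast
  qed (rule alg.subspace_span)
  moreover have "alg.span W \<subseteq> P" by (rule alg.span_minimal[OF _ P]) (auto simp: W_def w)
  ultimately show ?thesis by blast
qed

lemma linear_word_eqI:
  assumes f: "Vector_Spaces.linear (scl A) sT f" and g: "Vector_Spaces.linear (scl A) sT g"
    and eq: "\<And>n I J. I \<in> idx n \<Longrightarrow> J \<in> idx n \<Longrightarrow> f (word I J) = g (word I J)"
  shows "f x = g x"
proof -
  have "x \<in> {x. f x = g x}"
    by (rule word_induct)
      (auto simp: eq alg.subspace_def linear_addD[OF f] linear_addD[OF g]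
        linear_scaleD[OF f] linear_scaleD[OF g] linear_zeroD[OF f] linear_zeroD[OF g])
  then show ?thesis by simp
qed

text \<open>
  Words of length \<open>n\<close> are the matrix coefficients of the comodule \<open>V\<^bsup>\<otimes>n\<^esup>\<close>. This formula is what reduces
  Sweedler calculus to matrix multiplication.
\<close>

lemma comult_word:
  assumes "I \<in> idx n" "J \<in> idx n"
  shows "\<Delta> (word I J) = (\<Sum>K\<in>idx n. word I K \<otimes> word K J)"
  using assms
proof (induction n arbitrary: I J)
  case 0
  then show ?case by (simp add: idx_0 comult_one)
next
  case (Suc n)
  then obtain i I' j J' where "I = i # I'" "J = j # J'" "i \<in> {1..N}" "j \<in> {1..N}"
    "I' \<in> idx n" "J' \<in> idx n" by (auto simp: idx_Suc)
  then show ?case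
    by (simp add: comult_mult comult_gen Suc.IH sum_idx_Suc mult2_simps mult2_tens
        del: atLeastAtMost_iff) (rule sum.swap)
qed

definition sweedler :: "('k \<Rightarrow> 'c \<Rightarrow> 'c::ab_group_add) \<Rightarrow> ('a \<Rightarrow> 'a \<Rightarrow> 'c) \<Rightarrow> 'a \<Rightarrow> 'c" where
  "sweedler sC \<beta> x = tensor_lift (scl2 A) sC (tens A) \<beta> (\<Delta> x)"

lemma sweedler_word:
  assumes "bilinear_map (scl A) (scl A) sC \<beta>" "I \<in> idx n" "J \<in> idx n"
  shows "sweedler sC \<beta> (word I J) = (\<Sum>K\<in>idx n. \<beta> (word I K) (word K J))"
  unfolding sweedler_def comult_word[OF assms(2,3)] by (rule sq.lift_sum_tens[OF assms(1)])

lemma linear_sweedler: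
  assumes "bilinear_map (scl A) (scl A) sC \<beta>"
  shows "Vector_Spaces.linear (scl A) sC (sweedler sC \<beta>)"
  using Vector_Spaces.linear_compose[OF linear_comult sq.linear_lift[OF assms]]
  by (simp add: sweedler_def[abs_def] o_def)

text \<open>
  On a word, both sides are \<open>\<Sum>\<^sub>K\<^sub>L T\<^sub>I\<^sup>K \<otimes> T\<^sub>K\<^sup>L \<otimes> T\<^sub>L\<^sup>J\<close>.
\<close>

lemma coassociative:
  "tensor_map (scl2 A) (tens A) (scl3 A) (tensr A) id \<Delta> (\<Delta> x) =
   tensor_map (scl2 A) (tens A) (scl3 A) (tensl A) \<Delta> id (\<Delta> x)"
proof (rule linear_word_eqI[of "scl3 A"])
  note r = sq.linear_tensor_map[OF cr.bilinear_tens alg.linear_id linear_comult]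
    sq.tensor_map_tens[OF cr.bilinear_tens alg.linear_id linear_comult]
  note l = sq.linear_tensor_map[OF cl.bilinear_tens linear_comult alg.linear_id]
    sq.tensor_map_tens[OF cl.bilinear_tens linear_comult alg.linear_id]
  show "Vector_Spaces.linear (scl A) (scl3 A) (\<lambda>x. tensor_map (scl2 A) (tens A) (scl3 A) (tensr A) id \<Delta> (\<Delta> x))"
    using Vector_Spaces.linear_compose[OF linear_comult r(1)] by (simp add: o_def)
  show "Vector_Spaces.linear (scl A) (scl3 A) (\<lambda>x. tensor_map (scl2 A) (tens A) (scl3 A) (tensl A) \<Delta> id (\<Delta> x))"
    using Vector_Spaces.linear_compose[OF linear_comult l(1)] by (simp add: o_def)
  fix n I J assume IJ: "I \<in> idx n" "J \<in> idx n"
  have "tensor_map (scl2 A) (tens A) (scl3 A) (tensr A) id \<Delta> (\<Delta> (word I J)) =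
      (\<Sum>K\<in>idx n. \<Sum>L\<in>idx n. tensr A (word I K) (word K L \<otimes> word L J))"
    using IJ by (simp add: comult_word linear_sumD[OF r(1)] r(2) cr.tens_sum_right cong: sum.cong)
  also have "\<dots> = (\<Sum>L\<in>idx n. \<Sum>K\<in>idx n. tensl A (word I K \<otimes> word K L) (word L J))"
    by (subst sum.swap) (simp add: tens_assoc)
  also have "\<dots> = tensor_map (scl2 A) (tens A) (scl3 A) (tensl A) \<Delta> id (\<Delta> (word I J))"
    using IJ by (simp add: comult_word linear_sumD[OF l(1)] l(2) cl.tens_sum_left cong: sum.cong)
  finally show "tensor_map (scl2 A) (tens A) (scl3 A) (tensr A) id \<Delta> (\<Delta> (word I J)) =
    tensor_map (scl2 A) (tens A) (scl3 A) (tensl A) \<Delta> id (\<Delta> (word I J))" .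
qed

end

section \<open>The cobraiding form\<close>

lemma sum_fun_apply: "(\<Sum>i\<in>I. f i) x = (\<Sum>i\<in>I. f i x)"
  by (induction I rule: infinite_finite_induct) auto

lemma sum_kronecker_delta:
  fixes h :: "nat \<Rightarrow> nat \<Rightarrow> 'r::semiring_1"
  assumes "p \<in> {1..N}" "q \<in> {1..N}"
  shows "(\<Sum>k=1..N. \<Sum>l=1..N. h k l * ((if k = p then 1 else 0) * (if l = q then 1 else 0))) = h p q"
    "(\<Sum>k=1..N. \<Sum>l=1..N. h k l * ((if p = k then 1 else 0) * (if q = l then 1 else 0))) = h p q"
proof -
  have "(\<Sum>l=1..N. h k l * ((if k = p then 1 else 0) * (if l = q then 1 else 0))) = (if k = p then h k q else 0)" for k
    using assms by (cases "k = p") (simp_all add: if_distrib cong: if_cong)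
  then show *: "(\<Sum>k=1..N. \<Sum>l=1..N. h k l * ((if k = p then 1 else 0) * (if l = q then 1 else 0))) = h p q"
    using assms by simp
  then show "(\<Sum>k=1..N. \<Sum>l=1..N. h k l * ((if p = k then 1 else 0) * (if q = l then 1 else 0))) = h p q"
    by (simp add: eq_commute[of p] eq_commute[of q])
qed

lemma sum_swap_pairs:
  "(\<Sum>a\<in>A. \<Sum>b\<in>B. \<Sum>c\<in>C. \<Sum>d\<in>D. f a b c d) = (\<Sum>c\<in>C. \<Sum>d\<in>D. \<Sum>a\<in>A. \<Sum>b\<in>B. f a b c d)"
proof -
  have "(\<Sum>a\<in>A. \<Sum>b\<in>B. \<Sum>c\<in>C. \<Sum>d\<in>D. f a b c d) = (\<Sum>x\<in>A\<times>B. \<Sum>y\<in>C\<times>D. f (fst x) (snd x) (fst y) (snd y))"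
    by (simp only: sum.cartesian_product' fst_conv snd_conv)
  also have "\<dots> = (\<Sum>y\<in>C\<times>D. \<Sum>x\<in>A\<times>B. f (fst x) (snd x) (fst y) (snd y))"
    by (rule sum.swap)
  finally show ?thesis by (simp only: sum.cartesian_product' fst_conv snd_conv)
qed

lemma algebra_on_field: "algebra_on ((*) :: 'k::field \<Rightarrow> 'k \<Rightarrow> 'k) UNIV 1 (*)"
proof (rule k_algebra.algebra_on_UNIV)
  show "k_algebra ((*) :: 'k \<Rightarrow> 'k \<Rightarrow> 'k)"
    by (simp add: k_algebra_def k_algebra_axioms_def vector_space_field mult_ac)
qed

lemma vector_space_matrices:
  "vector_space (\<lambda>r (f :: 'i \<Rightarrow> 'j \<Rightarrow> 'k::field) i j. r * f i j)"
  by unfold_locales (simp_all add: fun_eq_iff algebra_simps)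

text \<open>
  Restricting to matrices supported on \<open>I\<close> makes the identity matrix of \<open>I\<close> a unit, although the type of
  indices may be infinite.
\<close>

lemma algebra_on_matrices:
  fixes I :: "'i set"
  assumes "finite I"
  shows "algebra_on (\<lambda>r (f :: 'i \<Rightarrow> 'i \<Rightarrow> 'k::field) i j. r * f i j)
    {f. \<forall>i j. i \<notin> I \<or> j \<notin> I \<longrightarrow> f i j = 0} (\<lambda>i j. if i \<in> I \<and> i = j then 1 else 0) (matmul I)"
proof -
  interpret vector_space "\<lambda>r (f :: 'i \<Rightarrow> 'i \<Rightarrow> 'k) i j. r * f i j" by (rule vector_space_matrices)
  show ?thesis
  proof unfold_locales
    fix f :: "'i \<Rightarrow> 'i \<Rightarrow> 'k"
    assume f: "f \<in> {f. \<forall>i j. i \<notin> I \<or> j \<notin> I \<longrightarrow> f i j = 0}"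
    have "(\<Sum>k\<in>I. (if i \<in> I \<and> i = k then 1 else 0) * f k j) = f i j" for i j
    proof (cases "i \<in> I")
      case True
      then have "(\<Sum>k\<in>I. (if i \<in> I \<and> i = k then 1 else 0) * f k j) = (\<Sum>k\<in>I. if i = k then f k j else 0)"
        by (intro sum.cong) auto
      then show ?thesis using assms True by simp
    qed (use f in simp)
    then show "matmul I (\<lambda>i j. if i \<in> I \<and> i = j then 1 else 0) f = f"
      by (simp add: matmul_def fun_eq_iff)
    have "(\<Sum>k\<in>I. f i k * (if k \<in> I \<and> k = j then 1 else 0)) = f i j" for i j
    proof -
      have "(\<Sum>k\<in>I. f i k * (if k \<in> I \<and> k = j then 1 else 0)) = (\<Sum>k\<in>I. if k = j then f i k else 0)"
        by (intro sum.cong) auto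
      then show ?thesis using assms f by simp
    qed
    then show "matmul I f (\<lambda>i j. if i \<in> I \<and> i = j then 1 else 0) = f"
      by (simp add: matmul_def fun_eq_iff)
    fix f g h :: "'i \<Rightarrow> 'i \<Rightarrow> 'k" and r
    show "matmul I (matmul I f g) h = matmul I f (matmul I g h)" by (rule matmul_assoc)
    show "matmul I (f + g) h = matmul I f h + matmul I g h"
      "matmul I h (f + g) = matmul I h f + matmul I h g"
      by (simp_all add: fun_eq_iff matmul_def distrib_left distrib_right sum.distrib)
    show "matmul I (\<lambda>i j. r * f i j) g = (\<lambda>i j. r * matmul I f g i j)"
      "matmul I f (\<lambda>i j. r * g i j) = (\<lambda>i j. r * matmul I f g i j)"
      by (simp_all add: fun_eq_iff matmul_def sum_distrib_left mult_ac)
  qed (auto simp: subspace_def matmul_def)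
qed

context algebra_with_cube
begin

abbreviation functional :: "('a \<Rightarrow> 'k) \<Rightarrow> bool" where
  "functional f \<equiv> Vector_Spaces.linear (scl A) (*) f"

lemma bilinear_functionals:
  assumes "functional f" "functional g"
  shows "bilinear_map (scl A) (scl A) (*) (\<lambda>a b. f a * g b)"
  by (rule bilinear_mapI)
    (simp_all add: linear_addD[OF assms(1)] linear_addD[OF assms(2)] linear_scaleD[OF assms(1)]
      linear_scaleD[OF assms(2)] algebra_simps vector_space_field)

abbreviation pair_eval :: "('a \<Rightarrow> 'k) \<Rightarrow> ('a \<Rightarrow> 'k) \<Rightarrow> 'aa \<Rightarrow> 'k" where
  "pair_eval f g \<equiv> tensor_lift (scl2 A) (*) (tens A) (\<lambda>a b. f a * g b)"

text \<open>
  If \<open>F\<close> and \<open>G\<close> are matrix representations of \<open>A\<close>, then \<open>F \<otimes> G\<close> is one of the tensor square of \<open>A\<close>.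
  Multiplicativity is required for the two entries in question only, because coefficients indexed by lists
  are multiplicative just for lists of a common length.
\<close>

lemma pair_eval_mult2:
  assumes f: "\<And>i j. functional (F i j)" and g: "\<And>i j. functional (G i j)"
    and ff: "\<And>a b. F i j (a * b) = (\<Sum>k\<in>X. F i k a * F k j b)"
    and gg: "\<And>a b. G p q (a * b) = (\<Sum>k\<in>Y. G p k a * G k q b)"
  shows "pair_eval (F i j) (G p q) (U \<odot> V) =
    (\<Sum>k\<in>X. \<Sum>r\<in>Y. pair_eval (F i k) (G p r) U * pair_eval (F k j) (G r q) V)"
proof (rule bilinear_eqI[of "(*)"])
  note b = bilinear_functionals[OF f g]
  note l = sq.linear_lift[OF b]
  show "bilinear_map (scl2 A) (scl2 A) (*) (\<lambda>U V. pair_eval (F i j) (G p q) (U \<odot> V))"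
    by (rule bilinear_mapI)
      (simp_all add: mult2_simps linear_addD[OF l] linear_scaleD[OF l] vector_space_field)
  show "bilinear_map (scl2 A) (scl2 A) (*) (\<lambda>U V.
     \<Sum>k\<in>X. \<Sum>r\<in>Y. pair_eval (F i k) (G p r) U * pair_eval (F k j) (G r q) V)"
    by (rule bilinear_mapI)
      (simp_all add: linear_addD[OF l] linear_scaleD[OF l] vector_space_field algebra_simps
        sum.distrib sum_distrib_left)
  fix a b c d
  show "pair_eval (F i j) (G p q) (a \<otimes> b \<odot> (c \<otimes> d)) =
     (\<Sum>k\<in>X. \<Sum>r\<in>Y. pair_eval (F i k) (G p r) (a \<otimes> b) * pair_eval (F k j) (G r q) (c \<otimes> d))"
    by (simp add: mult2_tens sq.lift_tens[OF b] ff gg sum_product mult_ac)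
qed

end

subsection \<open>The convolution algebra on the dual\<close>

context frt_algebra_cube
begin

text \<open>
  The counit is \<open>x \<mapsto> R(x \<otimes> 1)\<close> and the unit of the convolution algebra.
\<close>

definition counit :: "'a \<Rightarrow> 'k" where
  "counit = (SOME h. functional h \<and> h 1 = 1 \<and> (\<forall>a b. h (a * b) = h a * h b) \<and>
    (\<forall>i\<in>{1..N}. \<forall>j\<in>{1..N}. h (T i j) = (if i = j then 1 else 0)))"

lemma counit_properties:
  "functional counit \<and> counit 1 = 1 \<and> (\<forall>a b. counit (a * b) = counit a * counit b) \<and>
    (\<forall>i\<in>{1..N}. \<forall>j\<in>{1..N}. counit (T i j) = (if i = j then 1 else 0))"
proof -
  let ?x = "\<lambda>i j. if i = j then 1 else (0 :: 'k)"
  have "\<exists>h. functional h \<and> h 1 = 1 \<and> (\<forall>a b. h (a * b) = h a * h b) \<and>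
    (\<forall>i\<in>{1..N}. \<forall>j\<in>{1..N}. h (T i j) = ?x i j) \<and> range h \<subseteq> UNIV"
    by (rule frt_lift[OF algebra_on_field]) (simp_all only: UNIV_I sum_kronecker_delta)
  then have "\<exists>h. functional h \<and> h 1 = 1 \<and> (\<forall>a b. h (a * b) = h a * h b) \<and>
    (\<forall>i\<in>{1..N}. \<forall>j\<in>{1..N}. h (T i j) = ?x i j)" by blast
  from someI_ex[OF this] show ?thesis unfolding counit_def .
qed

lemma functional_counit: "functional counit"
  and counit_one: "counit 1 = 1"
  and counit_mult: "counit (a * b) = counit a * counit b"
  and counit_gen: "i \<in> {1..N} \<Longrightarrow> j \<in> {1..N} \<Longrightarrow> counit (T i j) = (if i = j then 1 else 0)"
  using counit_properties by simp_all

lemma counit_word: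
  "I \<in> idx n \<Longrightarrow> J \<in> idx n \<Longrightarrow> counit (word I J) = (if I = J then 1 else 0)"
  by (induction n arbitrary: I J)
    (auto simp: idx_0 idx_Suc counit_one counit_mult counit_gen simp del: atLeastAtMost_iff
      split: if_splits)

definition convolution :: "('a \<Rightarrow> 'k) \<Rightarrow> ('a \<Rightarrow> 'k) \<Rightarrow> 'a \<Rightarrow> 'k" where
  "convolution f g = sweedler (*) (\<lambda>a b. f a * g b)"

lemma convolution_word:
  assumes "functional f" "functional g" "I \<in> idx n" "J \<in> idx n"
  shows "convolution f g (word I J) = (\<Sum>K\<in>idx n. f (word I K) * g (word K J))"
  unfolding convolution_def by (rule sweedler_word[OF bilinear_functionals[OF assms(1,2)] assms(3,4)])

lemma functional_convolution:
  assumes "functional f" "functional g"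
  shows "functional (convolution f g)"
  unfolding convolution_def by (rule linear_sweedler[OF bilinear_functionals[OF assms]])

lemma convolution_assoc:
  assumes f: "functional f" and g: "functional g" and h: "functional h"
  shows "convolution (convolution f g) h = convolution f (convolution g h)"
proof
  fix x
  note lin = functional_convolution f g h
  show "convolution (convolution f g) h x = convolution f (convolution g h) x"
  proof (rule linear_word_eqI[of "(*)"])
    fix n I J assume IJ: "I \<in> idx n" "J \<in> idx n"
    let ?m = "\<lambda>f I J. f (word I J)"
    have "convolution (convolution f g) h (word I J) = matmul (idx n) (matmul (idx n) (?m f) (?m g)) (?m h) I J"
      unfolding convolution_word[OF functional_convolution[OF f g] h IJ] matmul_def
      by (intro sum.cong refl) (simp add: convolution_word[OF f g IJ(1)])
    also have "\<dots> = convolution f (convolution g h) (word I J)"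
      unfolding matmul_assoc convolution_word[OF f functional_convolution[OF g h] IJ]
      unfolding matmul_def[of _ "?m f"]
      by (intro sum.cong refl) (simp add: convolution_word[OF g h _ IJ(2)] matmul_def)
    finally show "convolution (convolution f g) h (word I J) = convolution f (convolution g h) (word I J)" .
  qed (intro lin)+
qed

lemma convolution_counit:
  assumes f: "functional f"
  shows "convolution counit f = f" "convolution f counit = f"
proof -
  note lin = functional_convolution f functional_counit
  show "convolution counit f = f"
  proof
    fix x show "convolution counit f x = f x"
    proof (rule linear_word_eqI[of "(*)"])
      fix n I J assume IJ: "I \<in> idx n" "J \<in> idx n"
      then have "convolution counit f (word I J) = (\<Sum>K\<in>idx n. if I = K then f (word K J) else 0)"
        unfolding convolution_word[OF functional_counit f IJ] by (intro sum.cong) (auto simp: counit_word)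
      then show "convolution counit f (word I J) = f (word I J)" using IJ by (simp add: finite_idx)
    qed (intro lin)+
  qed
  show "convolution f counit = f"
  proof
    fix x show "convolution f counit x = f x"
    proof (rule linear_word_eqI[of "(*)"])
      fix n I J assume IJ: "I \<in> idx n" "J \<in> idx n"
      then have "convolution f counit (word I J) = (\<Sum>K\<in>idx n. if K = J then f (word I K) else 0)"
        unfolding convolution_word[OF f functional_counit IJ] by (intro sum.cong) (auto simp: counit_word)
      then show "convolution f counit (word I J) = f (word I J)" using IJ by (simp add: finite_idx)
    qed (intro lin)+
  qed
qed

lemma vector_space_functions: "vector_space (\<lambda>r (f :: 'x \<Rightarrow> 'k) x. r * f x)"
  by unfold_locales (simp_all add: fun_eq_iff algebra_simps)

lemma convolution_bilinear:
  assumes "functional f" "functional g" "functional h"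
  shows "convolution (f + g) h = convolution f h + convolution g h"
    "convolution h (f + g) = convolution h f + convolution h g"
    "convolution (\<lambda>x. r * f x) g = (\<lambda>x. r * convolution f g x)"
    "convolution f (\<lambda>x. r * g x) = (\<lambda>x. r * convolution f g x)"
proof -
  note b = bilinear_functionals
  have s: "Vector_Spaces.linear (*) (*) ((*) r)"
    by (rule linearI) (simp_all add: vector_space_field algebra_simps)
  show "convolution (f + g) h = convolution f h + convolution g h"
    by (rule ext) (simp add: convolution_def sweedler_def distrib_left distrib_right
      sq.lift_add[OF b[OF assms(1,3)] b[OF assms(2,3)], symmetric])
  show "convolution h (f + g) = convolution h f + convolution h g"
    by (rule ext) (simp add: convolution_def sweedler_def distrib_left distrib_right
      sq.lift_add[OF b[OF assms(3,1)] b[OF assms(3,2)], symmetric])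
  show "convolution (\<lambda>x. r * f x) g = (\<lambda>x. r * convolution f g x)"
    "convolution f (\<lambda>x. r * g x) = (\<lambda>x. r * convolution f g x)"
    by (rule ext, simp add: convolution_def sweedler_def mult_ac
      sq.linear_lift_lift[OF b[OF assms(1,2)] s])+
qed

text \<open>
  The product is opposite to convolution, so that a morphism into this algebra is an anti-morphism for
  convolution; the rule \<open>R(x \<otimes> y z) = \<Sum> R(x\<^sub>1 \<otimes> z) R(x\<^sub>2 \<otimes> y)\<close> asks for this order.
\<close>

lemma algebra_on_dual:
  "algebra_on (\<lambda>r f x. r * f x) {f. functional f} counit (\<lambda>f g. convolution g f)"
proof -
  interpret F: vector_space "\<lambda>r (f :: 'a \<Rightarrow> 'k) x. r * f x" by (rule vector_space_functions)
  have "functional (f + g)" "functional (\<lambda>x. r * f x)" if "functional f" "functional g" for f g r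
    using that by (simp_all add: Vector_Spaces.linear_iff algebra_simps)
  moreover have "functional 0"
    by (rule linearI) (simp_all add: vector_space_field alg.vector_space_axioms)
  ultimately have "F.subspace {f. functional f}" by (simp add: F.subspace_def)
  then show ?thesis
    by unfold_locales
      (simp_all add: functional_counit functional_convolution convolution_assoc convolution_counit
        convolution_bilinear)
qed

end

subsection \<open>The vector representation and its dual map\<close>

locale frt_quantum_group = frt_algebra_cube A N c T
  for A :: "('k::field, 'a::ring_1, 'aa::ab_group_add, 'aaa::ab_group_add) tensor_space"
    (structure) and N c T +
  assumes yang_baxter: "\<And>p i j m n q.
    p \<in> {1..N} \<Longrightarrow> i \<in> {1..N} \<Longrightarrow> j \<in> {1..N} \<Longrightarrow> m \<in> {1..N} \<Longrightarrow> n \<in> {1..N} \<Longrightarrow> q \<in> {1..N} \<Longrightarrow>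
    (\<Sum>k=1..N. \<Sum>l=1..N. \<Sum>r=1..N. c i j k l * c p k m r * c r l n q) =
    (\<Sum>k=1..N. \<Sum>l=1..N. \<Sum>r=1..N. c p i k r * c r j l q * c k l m n)"
begin

text \<open>
  The \<open>(u, v)\<close> entry of the FRT relation for the matrices \<open>(c\<^sub>j\<^sub>i\<^sup>m\<^sup>n)\<^sub>j\<^sub>n\<close> is the Yang-Baxter equation.
\<close>

lemma ex_vector_representation:
  "\<exists>\<rho>. Vector_Spaces.linear (scl A) (\<lambda>r f i j. r * f i j) \<rho> \<and>
    \<rho> 1 = (\<lambda>j n. if j \<in> {1..N} \<and> j = n then 1 else 0) \<and>
    (\<forall>a b. \<rho> (a * b) = matmul {1..N} (\<rho> a) (\<rho> b)) \<and>
    (\<forall>i\<in>{1..N}. \<forall>m\<in>{1..N}. \<rho> (T i m) =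
      (\<lambda>j n. if j \<in> {1..N} \<and> n \<in> {1..N} then c j i m n else 0))"
proof -
  let ?s = "\<lambda>r (f :: nat \<Rightarrow> nat \<Rightarrow> 'k) i j. r * f i j"
  let ?C = "{f :: nat \<Rightarrow> nat \<Rightarrow> 'k. \<forall>i j. i \<notin> {1..N} \<or> j \<notin> {1..N} \<longrightarrow> f i j = 0}"
  let ?e = "\<lambda>j n. if j \<in> {1..N} \<and> j = n then 1 else 0 :: 'k"
  let ?x = "\<lambda>i m j n. if j \<in> {1..N} \<and> n \<in> {1..N} then c j i m n else 0"
  have "\<exists>h. Vector_Spaces.linear (scl A) ?s h \<and> h 1 = ?e \<and>
     (\<forall>a b. h (a * b) = matmul {1..N} (h a) (h b)) \<and>
     (\<forall>i\<in>{1..N}. \<forall>j\<in>{1..N}. h (T i j) = ?x i j) \<and> range h \<subseteq> ?C"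
  proof (rule frt_lift[OF algebra_on_matrices])
    fix i j p q assume ijpq: "i \<in> {1..N}" "j \<in> {1..N}" "p \<in> {1..N}" "q \<in> {1..N}"
    have mm: "matmul {1..N} (?x k p) (?x l q) u v =
        (if u \<in> {1..N} \<and> v \<in> {1..N} then \<Sum>r=1..N. c u k p r * c r l q v else 0)" for k l p q u v
      by (auto simp: matmul_def intro!: sum.cong)
    show "(\<Sum>k=1..N. \<Sum>l=1..N. ?s (c i j k l) (matmul {1..N} (?x k p) (?x l q))) =
        (\<Sum>k=1..N. \<Sum>l=1..N. ?s (c k l p q) (matmul {1..N} (?x i k) (?x j l)))"
    proof (intro ext, unfold sum_fun_apply mm)
      fix u v
      show "(\<Sum>k=1..N. \<Sum>l=1..N. c i j k l * (if u \<in> {1..N} \<and> v \<in> {1..N} then \<Sum>r=1..N. c u k p r * c r l q v else 0)) =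
        (\<Sum>k=1..N. \<Sum>l=1..N. c k l p q * (if u \<in> {1..N} \<and> v \<in> {1..N} then \<Sum>r=1..N. c u i k r * c r j l v else 0))"
      proof (cases "u \<in> {1..N} \<and> v \<in> {1..N}")
        case True
        then have "(\<Sum>k=1..N. \<Sum>l=1..N. \<Sum>r=1..N. c i j k l * c u k p r * c r l q v) =
            (\<Sum>k=1..N. \<Sum>l=1..N. \<Sum>r=1..N. c u i k r * c r j l v * c k l p q)"
          using ijpq by (intro yang_baxter) simp_all
        with True show ?thesis by (simp only: if_True simp_thms sum_distrib_left mult_ac)
      next
        case False
        then show ?thesis by (simp only: if_False mult_zero_right sum.neutral_const)
      qed
    qed
  qed auto
  then show ?thesis by blast
qed

definition rep :: "'a \<Rightarrow> nat \<Rightarrow> nat \<Rightarrow> 'k" where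
  "rep = (SOME \<rho>. Vector_Spaces.linear (scl A) (\<lambda>r f i j. r * f i j) \<rho> \<and>
    \<rho> 1 = (\<lambda>j n. if j \<in> {1..N} \<and> j = n then 1 else 0) \<and>
    (\<forall>a b. \<rho> (a * b) = matmul {1..N} (\<rho> a) (\<rho> b)) \<and>
    (\<forall>i\<in>{1..N}. \<forall>m\<in>{1..N}. \<rho> (T i m) =
      (\<lambda>j n. if j \<in> {1..N} \<and> n \<in> {1..N} then c j i m n else 0)))"

lemma rep_properties:
  "Vector_Spaces.linear (scl A) (\<lambda>r f i j. r * f i j) rep \<and>
    rep 1 = (\<lambda>j n. if j \<in> {1..N} \<and> j = n then 1 else 0) \<and>
    (\<forall>a b. rep (a * b) = matmul {1..N} (rep a) (rep b)) \<and>
    (\<forall>i\<in>{1..N}. \<forall>m\<in>{1..N}. rep (T i m) =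
      (\<lambda>j n. if j \<in> {1..N} \<and> n \<in> {1..N} then c j i m n else 0))"
  using someI_ex[OF ex_vector_representation] unfolding rep_def .

lemma rep_linear: "Vector_Spaces.linear (scl A) (\<lambda>r f i j. r * f i j) rep"
  and rep_one: "rep 1 = (\<lambda>j n. if j \<in> {1..N} \<and> j = n then 1 else 0)"
  and rep_mult: "rep (a * b) = matmul {1..N} (rep a) (rep b)"
  and rep_gen: "i \<in> {1..N} \<Longrightarrow> m \<in> {1..N} \<Longrightarrow> j \<in> {1..N} \<Longrightarrow> n \<in> {1..N} \<Longrightarrow> rep (T i m) j n = c j i m n"
  using rep_properties by simp_all

lemma functional_rep: "functional (\<lambda>x. rep x j n)"
  by (rule linearI)
    (simp_all add: linear_addD[OF rep_linear] linear_scaleD[OF rep_linear] alg.vector_space_axioms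
      vector_space_field)

text \<open>
  The representation of \<open>A\<close> on \<open>V \<otimes> V\<close> given by the comultiplication, with the second tensor factor acted on by
  \<open>x\<^sub>1\<close> and the first by \<open>x\<^sub>2\<close>: its coefficients are the products in the dual that the relations
  for \<open>\<phi>\<close> involve.
\<close>

definition rep2 :: "'a \<Rightarrow> nat \<times> nat \<Rightarrow> nat \<times> nat \<Rightarrow> 'k" where
  "rep2 x = (\<lambda>(i, j) (m, n). convolution (\<lambda>x. rep x j n) (\<lambda>x. rep x i m) x)"

abbreviation cmat :: "nat \<times> nat \<Rightarrow> nat \<times> nat \<Rightarrow> 'k" where
  "cmat \<equiv> \<lambda>(i, j) (k, l). c i j k l"

abbreviation pairs :: "(nat \<times> nat) set" where "pairs \<equiv> {1..N} \<times> {1..N}"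

lemma functional_rep2: "functional (\<lambda>x. rep2 x d e)"
  unfolding rep2_def case_prod_unfold
  by (intro functional_convolution functional_rep)

lemma rep2_mult: "rep2 (x * y) = matmul pairs (rep2 x) (rep2 y)"
proof (intro ext)
  fix d e :: "nat \<times> nat"
  obtain i j m n where de: "d = (i, j)" "e = (m, n)" by (cases d, cases e)
  have "rep2 (x * y) d e = (\<Sum>l=1..N. \<Sum>k=1..N. rep2 x (i, j) (k, l) * rep2 y (k, l) (m, n))"
    unfolding de rep2_def convolution_def sweedler_def comult_mult split
    by (rule pair_eval_mult2[where F = "\<lambda>j n x. rep x j n" and G = "\<lambda>j n x. rep x j n"])
      (simp_all add: functional_rep rep_mult matmul_def)
  also have "\<dots> = (\<Sum>k=1..N. \<Sum>l=1..N. rep2 x (i, j) (k, l) * rep2 y (k, l) (m, n))"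
    by (rule sum.swap)
  finally show "rep2 (x * y) d e = matmul pairs (rep2 x) (rep2 y) d e"
    by (simp add: matmul_def de sum.cartesian_product case_prod_unfold)
qed

text \<open>
  The matrix of \<open>\<gamma>\<close> commutes with the action of \<open>A\<close> on \<open>V \<otimes> V\<close>. The elements for which this holds
  are closed under products, and on a generator it is the Yang-Baxter equation.
\<close>

lemma rep2_commute:
  assumes "d \<in> pairs" "e \<in> pairs"
  shows "matmul pairs cmat (rep2 x) d e = matmul pairs (rep2 x) cmat d e"
proof -
  let ?P = "{x. \<forall>d\<in>pairs. \<forall>e\<in>pairs. matmul pairs cmat (rep2 x) d e = matmul pairs (rep2 x) cmat d e}"
  note l = linear_addD[OF functional_rep2] linear_scaleD[OF functional_rep2] linear_zeroD[OF functional_rep2]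
  have "x \<in> ?P"
  proof (induction rule: frt_induct)
    case subspace
    show ?case
      by (auto simp: alg.subspace_def matmul_def l algebra_simps sum.distrib sum_distrib_left[symmetric]
          simp del: atLeastAtMost_iff)
  next
    case one
    have 1: "rep2 1 (i, j) (m, n) = (if i = m then 1 else 0) * (if j = n then 1 else 0)"
      if "i \<in> {1..N}" "j \<in> {1..N}" for i j m n
      using that unfolding rep2_def split convolution_def sweedler_def comult_one
        sq.lift_tens[OF bilinear_functionals[OF functional_rep functional_rep]]
      by (simp add: rep_one)
    show ?case
    proof safe
      fix i j m n assume ijmn: "i \<in> {1..N}" "j \<in> {1..N}" "m \<in> {1..N}" "n \<in> {1..N}"
      have "matmul pairs cmat (rep2 1) (i, j) (m, n) = (\<Sum>k=1..N. \<Sum>l=1..N. c i j k l * ((if k = m then 1 else 0) * (if l = n then 1 else 0)))"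
        unfolding matmul_def sum.cartesian_product by (intro sum.cong refl) (clarsimp simp only: split mem_Sigma_iff 1)
      also have "\<dots> = c i j m n" by (rule sum_kronecker_delta) fact+
      also have "\<dots> = (\<Sum>k=1..N. \<Sum>l=1..N. c k l m n * ((if i = k then 1 else 0) * (if j = l then 1 else 0)))"
        by (rule sum_kronecker_delta[symmetric]) fact+
      also have "\<dots> = matmul pairs (rep2 1) cmat (i, j) (m, n)"
        unfolding matmul_def sum.cartesian_product using ijmn
        by (intro sum.cong refl) (clarsimp simp only: split mem_Sigma_iff 1 mult_ac)
      finally show "matmul pairs cmat (rep2 1) (i, j) (m, n) = matmul pairs (rep2 1) cmat (i, j) (m, n)" .
    qed
  next
    case (gen a b x)
    have T: "rep2 (T a b) (i, j) (m, n) = (\<Sum>s=1..N. c j a s n * c i s b m)"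
      if "i \<in> {1..N}" "j \<in> {1..N}" "m \<in> {1..N}" "n \<in> {1..N}" for i j m n
      unfolding rep2_def split convolution_def sweedler_def comult_gen[OF gen(1,2)]
        sq.lift_sum_tens[OF bilinear_functionals[OF functional_rep functional_rep]]
      using that gen(1,2) by (intro sum.cong refl) (simp only: rep_gen)
    have TT: "matmul pairs cmat (rep2 (T a b)) d e = matmul pairs (rep2 (T a b)) cmat d e"
      if de: "d \<in> pairs" "e \<in> pairs" for d e
    proof -
      from de obtain i j m n where ijmn: "d = (i, j)" "e = (m, n)" "i \<in> {1..N}" "j \<in> {1..N}" "m \<in> {1..N}" "n \<in> {1..N}"
        by auto
      have "matmul pairs cmat (rep2 (T a b)) d e = (\<Sum>k=1..N. \<Sum>l=1..N. c i j k l * (\<Sum>s=1..N. c l a s n * c k s b m))"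
        unfolding matmul_def sum.cartesian_product ijmn(1,2) using ijmn(3-)
        by (intro sum.cong refl) (clarsimp simp only: split mem_Sigma_iff T)
      also have "\<dots> = (\<Sum>k=1..N. \<Sum>l=1..N. \<Sum>s=1..N. c i j k l * c l a s n * c k s b m)"
        by (simp only: sum_distrib_left mult.assoc)
      also have "\<dots> = (\<Sum>k=1..N. \<Sum>s=1..N. \<Sum>l=1..N. c i j k l * c l a s n * c k s b m)"
        by (intro sum.cong refl sum.swap)
      also have "\<dots> = (\<Sum>s=1..N. \<Sum>l=1..N. \<Sum>k=1..N. c j a s l * c i s b k * c k l m n)"
        by (rule yang_baxter[symmetric]) (use ijmn gen in blast)+
      also have "\<dots> = (\<Sum>l=1..N. \<Sum>s=1..N. \<Sum>k=1..N. c j a s l * c i s b k * c k l m n)"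
        by (rule sum.swap)
      also have "\<dots> = (\<Sum>l=1..N. \<Sum>k=1..N. \<Sum>s=1..N. c j a s l * c i s b k * c k l m n)"
        by (intro sum.cong refl sum.swap)
      also have "\<dots> = (\<Sum>k=1..N. \<Sum>l=1..N. \<Sum>s=1..N. c j a s l * c i s b k * c k l m n)"
        by (rule sum.swap)
      also have "\<dots> = (\<Sum>k=1..N. \<Sum>l=1..N. (\<Sum>s=1..N. c j a s l * c i s b k) * c k l m n)"
        by (simp only: sum_distrib_right)
      also have "\<dots> = matmul pairs (rep2 (T a b)) cmat d e"
        unfolding matmul_def sum.cartesian_product ijmn(1,2) using ijmn(3-)
        by (intro sum.cong refl) (clarsimp simp only: split mem_Sigma_iff T)
      finally show ?thesis .
    qed
    have x: "matmul pairs cmat (rep2 x) d e = matmul pairs (rep2 x) cmat d e"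
      if "d \<in> pairs" "e \<in> pairs" for d e using gen(3) that by blast
    show ?case
    proof (rule CollectI, intro ballI)
      fix d e assume de: "d \<in> pairs" "e \<in> pairs"
      have "matmul pairs cmat (rep2 (T a b * x)) d e = matmul pairs (matmul pairs cmat (rep2 (T a b))) (rep2 x) d e"
        by (simp only: rep2_mult matmul_assoc)
      also have "\<dots> = matmul pairs (matmul pairs (rep2 (T a b)) cmat) (rep2 x) d e"
        by (rule matmul_cong) (use TT de in simp_all)
      also have "\<dots> = matmul pairs (rep2 (T a b)) (matmul pairs cmat (rep2 x)) d e"
        by (simp only: matmul_assoc)
      also have "\<dots> = matmul pairs (rep2 (T a b)) (matmul pairs (rep2 x) cmat) d e"
        by (rule matmul_cong) (use x de in simp_all)
      also have "\<dots> = matmul pairs (rep2 (T a b * x)) cmat d e"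
        by (simp only: rep2_mult matmul_assoc)
      finally show "matmul pairs cmat (rep2 (T a b * x)) d e = matmul pairs (rep2 (T a b * x)) cmat d e" .
    qed
  qed
  then show ?thesis using assms by blast
qed

lemma ex_dual_map:
  "\<exists>\<phi>. Vector_Spaces.linear (scl A) (\<lambda>r f x. r * f x) \<phi> \<and> \<phi> 1 = counit \<and>
    (\<forall>a b. \<phi> (a * b) = convolution (\<phi> b) (\<phi> a)) \<and>
    (\<forall>j\<in>{1..N}. \<forall>n\<in>{1..N}. \<phi> (T j n) = (\<lambda>x. rep x j n)) \<and> range \<phi> \<subseteq> {f. functional f}"
proof (rule frt_lift[OF algebra_on_dual])
  fix i j p q assume ijpq: "i \<in> {1..N}" "j \<in> {1..N}" "p \<in> {1..N}" "q \<in> {1..N}"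
  show "(\<Sum>k=1..N. \<Sum>l=1..N. (\<lambda>x. c i j k l * convolution (\<lambda>x. rep x l q) (\<lambda>x. rep x k p) x)) =
    (\<Sum>k=1..N. \<Sum>l=1..N. (\<lambda>x. c k l p q * convolution (\<lambda>x. rep x j l) (\<lambda>x. rep x i k) x))"
  proof (rule ext, unfold sum_fun_apply)
    fix x
    have "matmul pairs cmat (rep2 x) (i, j) (p, q) = matmul pairs (rep2 x) cmat (i, j) (p, q)"
      by (rule rep2_commute) (use ijpq in auto)
    then show "(\<Sum>k=1..N. \<Sum>l=1..N. c i j k l * convolution (\<lambda>x. rep x l q) (\<lambda>x. rep x k p) x) =
       (\<Sum>k=1..N. \<Sum>l=1..N. c k l p q * convolution (\<lambda>x. rep x j l) (\<lambda>x. rep x i k) x)"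
      by (simp add: matmul_def rep2_def sum.cartesian_product case_prod_unfold mult.commute)
  qed
qed (simp add: functional_rep)

text \<open>
  The anti-morphism \<open>\<phi>\<close> into the dual, that is, \<open>dual_map y x = R(x \<otimes> y)\<close>.
\<close>

definition dual_map :: "'a \<Rightarrow> 'a \<Rightarrow> 'k" where
  "dual_map = (SOME \<phi>. Vector_Spaces.linear (scl A) (\<lambda>r f x. r * f x) \<phi> \<and> \<phi> 1 = counit \<and>
    (\<forall>a b. \<phi> (a * b) = convolution (\<phi> b) (\<phi> a)) \<and>
    (\<forall>j\<in>{1..N}. \<forall>n\<in>{1..N}. \<phi> (T j n) = (\<lambda>x. rep x j n)) \<and> range \<phi> \<subseteq> {f. functional f})"

lemma dual_map_properties:
  "Vector_Spaces.linear (scl A) (\<lambda>r f x. r * f x) dual_map \<and> dual_map 1 = counit \<and>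
    (\<forall>a b. dual_map (a * b) = convolution (dual_map b) (dual_map a)) \<and>
    (\<forall>j\<in>{1..N}. \<forall>n\<in>{1..N}. dual_map (T j n) = (\<lambda>x. rep x j n)) \<and>
    range dual_map \<subseteq> {f. functional f}"
  using someI_ex[OF ex_dual_map] unfolding dual_map_def .

lemma dual_map_linear: "Vector_Spaces.linear (scl A) (\<lambda>r f x. r * f x) dual_map"
  and dual_map_one: "dual_map 1 = counit"
  and dual_map_mult: "dual_map (a * b) = convolution (dual_map b) (dual_map a)"
  and dual_map_gen: "j \<in> {1..N} \<Longrightarrow> n \<in> {1..N} \<Longrightarrow> dual_map (T j n) = (\<lambda>x. rep x j n)"
  and functional_dual_map: "functional (dual_map a)"
  using dual_map_properties by (simp_all add: image_subset_iff)

end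

subsection \<open>Uniqueness and existence of the form\<close>

text \<open>
  The conditions that \<open>frt_form\<close> selects by a definite description.
\<close>

definition is_frt_form ::
    "nat \<Rightarrow> (nat \<Rightarrow> nat \<Rightarrow> nat \<Rightarrow> nat \<Rightarrow> 'k::field) \<Rightarrow>
     ('k, 'a::ring_1, 'aa::ab_group_add, 'aaa) tensor_space \<Rightarrow> (nat \<Rightarrow> nat \<Rightarrow> 'a) \<Rightarrow> ('aa \<Rightarrow> 'k) \<Rightarrow> bool" where
  "is_frt_form N c A T R \<longleftrightarrow>
     Vector_Spaces.linear (scl2 A) (*) R \<and>
     R (1 \<otimes>\<^bsub>A\<^esub> 1) = 1 \<and>
     (\<forall>i\<in>{1..N}. \<forall>j\<in>{1..N}.
        R (1 \<otimes>\<^bsub>A\<^esub> T i j) = (if i = j then 1 else 0) \<and>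
        R (T i j \<otimes>\<^bsub>A\<^esub> 1) = (if i = j then 1 else 0)) \<and>
     (\<forall>i\<in>{1..N}. \<forall>j\<in>{1..N}. \<forall>m\<in>{1..N}. \<forall>n\<in>{1..N}.
        R (T i m \<otimes>\<^bsub>A\<^esub> T j n) = c j i m n) \<and>
     (\<forall>x y z. R ((x * y) \<otimes>\<^bsub>A\<^esub> z) =
        tensor_lift (scl2 A) (*) (tens A)
          (\<lambda>z\<^sub>1 z\<^sub>2. R (x \<otimes>\<^bsub>A\<^esub> z\<^sub>1) * R (y \<otimes>\<^bsub>A\<^esub> z\<^sub>2)) (frt_comult N A T z)) \<and>
     (\<forall>x y z. R (x \<otimes>\<^bsub>A\<^esub> (y * z)) =
        tensor_lift (scl2 A) (*) (tens A)
          (\<lambda>x\<^sub>1 x\<^sub>2. R (x\<^sub>1 \<otimes>\<^bsub>A\<^esub> z) * R (x\<^sub>2 \<otimes>\<^bsub>A\<^esub> y)) (frt_comult N A T x))"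

lemma frt_form_eq: "frt_form N c A T = (THE R. is_frt_form N c A T R)"
  by (simp add: frt_form_def is_frt_form_def)

context frt_algebra_cube
begin

lemma functional_form:
  assumes "Vector_Spaces.linear (scl2 A) (*) R"
  shows "functional (\<lambda>x. R (x \<otimes> y))" "functional (\<lambda>y. R (x \<otimes> y))"
  by (rule linearI; simp add: sq.tens_simps linear_addD[OF assms] linear_scaleD[OF assms]
      vector_space_field alg.vector_space_axioms)+

lemma is_frt_formD:
  assumes "is_frt_form N c A T R"
  shows "Vector_Spaces.linear (scl2 A) (*) R" "R (1 \<otimes> 1) = 1"
    "i \<in> {1..N} \<Longrightarrow> j \<in> {1..N} \<Longrightarrow> R (1 \<otimes> T i j) = (if i = j then 1 else 0)"
    "i \<in> {1..N} \<Longrightarrow> j \<in> {1..N} \<Longrightarrow> R (T i j \<otimes> 1) = (if i = j then 1 else 0)"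
    "i \<in> {1..N} \<Longrightarrow> j \<in> {1..N} \<Longrightarrow> m \<in> {1..N} \<Longrightarrow> n \<in> {1..N} \<Longrightarrow> R (T i m \<otimes> T j n) = c j i m n"
    "R ((x * y) \<otimes> z) = convolution (\<lambda>a. R (x \<otimes> a)) (\<lambda>a. R (y \<otimes> a)) z"
    "R (x \<otimes> (y * z)) = convolution (\<lambda>a. R (a \<otimes> z)) (\<lambda>a. R (a \<otimes> y)) x"
  using assms by (simp_all add: is_frt_form_def convolution_def sweedler_def)

text \<open>
  The rule for \<open>R(x y \<otimes> z)\<close> determines \<open>R(x \<otimes> 1)\<close> and all \<open>R(x \<otimes> T\<^sub>i\<^sup>j)\<close> by induction on \<open>x\<close>, as
  \<open>\<Delta>(1)\<close> and \<open>\<Delta>(T\<^sub>i\<^sup>j)\<close> again involve only \<open>1\<close> and generators. The rule for \<open>R(x \<otimes> y z)\<close> then determines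
  \<open>R(x \<otimes> y)\<close> by induction on \<open>y\<close>.
\<close>

lemma is_frt_form_unique:
  assumes R: "is_frt_form N c A T R" and R': "is_frt_form N c A T R'"
  shows "R = R'"
proof
  fix X
  note lin = is_frt_formD(1)[OF R] is_frt_formD(1)[OF R']
  note f = functional_form[OF lin(1)] functional_form[OF lin(2)]
  note lift = sq.lift_tens[OF bilinear_functionals] sq.lift_sum_tens[OF bilinear_functionals]
  have sub: "alg.subspace {x. h x = h' x}" if "functional h" "functional h'" for h h'
    by (auto simp: alg.subspace_def linear_addD[OF that(1)] linear_addD[OF that(2)]
        linear_scaleD[OF that(1)] linear_scaleD[OF that(2)] linear_zeroD[OF that(1)] linear_zeroD[OF that(2)])
  have one_right: "R (x \<otimes> 1) = R' (x \<otimes> 1)" for x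
  proof -
    have "x \<in> {x. R (x \<otimes> 1) = R' (x \<otimes> 1)}"
    proof (induction rule: frt_induct)
      case (gen i j a)
      have "S ((T i j * a) \<otimes> 1) = S (T i j \<otimes> 1) * S (a \<otimes> 1)" if "is_frt_form N c A T S" for S
        unfolding is_frt_formD(6)[OF that] convolution_def sweedler_def comult_one
        by (rule lift(1)) (rule functional_form[OF is_frt_formD(1)[OF that]])+
      from this[OF R] this[OF R'] gen show ?case
        by (simp add: is_frt_formD(4)[OF R] is_frt_formD(4)[OF R'])
    qed (simp_all add: sub f is_frt_formD(2)[OF R] is_frt_formD(2)[OF R'])
    then show ?thesis by simp
  qed
  have gen_right: "\<forall>i\<in>{1..N}. \<forall>j\<in>{1..N}. R (x \<otimes> T i j) = R' (x \<otimes> T i j)" for x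
  proof -
    let ?P = "\<Inter>i\<in>{1..N}. \<Inter>j\<in>{1..N}. {x. R (x \<otimes> T i j) = R' (x \<otimes> T i j)}"
    have "x \<in> ?P"
    proof (induction rule: frt_induct)
      case subspace
      show ?case by (intro alg.subspace_Inter ballI) (auto intro!: alg.subspace_Inter sub f)
    next
      case one
      show ?case by (simp add: is_frt_formD(3)[OF R] is_frt_formD(3)[OF R'])
    next
      case (gen k m a)
      have S: "S ((T k m * a) \<otimes> T i j) = (\<Sum>l=1..N. c i k m l * S (a \<otimes> T l j))"
        if S: "is_frt_form N c A T S" and ij: "i \<in> {1..N}" "j \<in> {1..N}" for S i j
      proof -
        have "S ((T k m * a) \<otimes> T i j) = (\<Sum>l=1..N. S (T k m \<otimes> T i l) * S (a \<otimes> T l j))"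
          unfolding is_frt_formD(6)[OF S] convolution_def sweedler_def comult_gen[OF ij]
          by (rule lift(2)) (rule functional_form[OF is_frt_formD(1)[OF S]])+
        also have "\<dots> = (\<Sum>l=1..N. c i k m l * S (a \<otimes> T l j))"
          using gen ij by (intro sum.cong refl) (simp only: is_frt_formD(5)[OF S])
        finally show ?thesis .
      qed
      show ?case
      proof safe
        fix i j assume ij: "i \<in> {1..N}" "j \<in> {1..N}"
        show "R ((T k m * a) \<otimes> T i j) = R' ((T k m * a) \<otimes> T i j)"
          unfolding S[OF R ij] S[OF R' ij] using gen ij by (intro sum.cong refl) simp
      qed
    qed
    then show ?thesis by blast
  qed
  have "R (x \<otimes> y) = R' (x \<otimes> y)" for x y
  proof -
    have "y \<in> (\<Inter>x. {y. R (x \<otimes> y) = R' (x \<otimes> y)})"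
    proof (induction rule: frt_induct)
      case subspace
      show ?case by (intro alg.subspace_Inter ballI) (auto intro!: sub f)
    next
      case one
      show ?case by (simp add: one_right)
    next
      case (gen i j a)
      have "(\<lambda>b. R (b \<otimes> a)) = (\<lambda>b. R' (b \<otimes> a))" using gen by blast
      moreover have "(\<lambda>b. R (b \<otimes> T i j)) = (\<lambda>b. R' (b \<otimes> T i j))" using gen_right gen by blast
      ultimately show ?case by (simp add: is_frt_formD(7)[OF R] is_frt_formD(7)[OF R'])
    qed
    then show ?thesis by blast
  qed
  then show "R X = R' X" by (rule sq.linear_eqI[OF lin])
qed

end

context frt_quantum_group
begin

text \<open>
  This is the rule for \<open>R(x y \<otimes> z)\<close> with \<open>z\<close> a word. For a generator it says that \<open>\<rho>\<close> is a
  representation; a longer word pairs with \<open>\<Delta>(x y) = \<Delta>(x) \<Delta>(y)\<close> through the tensor product of two such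
  representations.
\<close>

lemma dual_map_word_mult:
  assumes "J \<in> idx n" "L \<in> idx n"
  shows "dual_map (word J L) (x * y) = (\<Sum>K\<in>idx n. dual_map (word J K) x * dual_map (word K L) y)"
  using assms
proof (induction n arbitrary: J L x y)
  case 0
  then show ?case by (simp add: idx_0 dual_map_one counit_mult)
next
  case (Suc n)
  then obtain j J' l L' where JL: "J = j # J'" "L = l # L'" "j \<in> {1..N}" "l \<in> {1..N}"
    and JL': "J' \<in> idx n" "L' \<in> idx n" by (auto simp: idx_Suc)
  let ?g = "\<lambda>j l x. rep x j l"
  have step: "dual_map (word (j # J) (l # L)) = convolution (dual_map (word J L)) (?g j l)"
    if "j \<in> {1..N}" "l \<in> {1..N}" for j l J L
    by (simp only: word.simps dual_map_mult dual_map_gen[OF that])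
  have "dual_map (word J L) (x * y) = pair_eval (dual_map (word J' L')) (?g j l) (\<Delta> x \<odot> \<Delta> y)"
    unfolding JL(1,2) step[OF JL(3,4)] by (simp only: convolution_def sweedler_def comult_mult)
  also have "\<dots> = (\<Sum>K\<in>idx n. \<Sum>k=1..N.
      pair_eval (dual_map (word J' K)) (?g j k) (\<Delta> x) * pair_eval (dual_map (word K L')) (?g k l) (\<Delta> y))"
    by (rule pair_eval_mult2[where F = "\<lambda>J L. dual_map (word J L)"])
      (simp_all add: functional_dual_map functional_rep rep_mult matmul_def Suc.IH[OF JL'])
  also have "\<dots> = (\<Sum>K\<in>idx n. \<Sum>k=1..N.
      dual_map (word (j # J') (k # K)) x * dual_map (word (k # K) (l # L')) y)"
    using JL by (intro sum.cong refl) (simp only: step convolution_def sweedler_def)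
  also have "\<dots> = (\<Sum>k=1..N. \<Sum>K\<in>idx n.
      dual_map (word (j # J') (k # K)) x * dual_map (word (k # K) (l # L')) y)"
    by (rule sum.swap)
  finally show ?case by (simp only: sum_idx_Suc JL(1,2))
qed

definition form :: "'aa \<Rightarrow> 'k" where
  "form = tensor_lift (scl2 A) (*) (tens A) (\<lambda>x y. dual_map y x)"

lemma linear_form: "Vector_Spaces.linear (scl2 A) (*) form"
  and form_tens: "form (x \<otimes> y) = dual_map y x"
proof -
  have b: "bilinear_map (scl A) (scl A) (*) (\<lambda>x y. dual_map y x)"
    by (rule bilinear_mapI)
      (simp_all add: linear_addD[OF dual_map_linear] linear_scaleD[OF dual_map_linear]
        linear_addD[OF functional_dual_map] linear_scaleD[OF functional_dual_map] vector_space_field)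
  show "Vector_Spaces.linear (scl2 A) (*) form" "form (x \<otimes> y) = dual_map y x"
    unfolding form_def by (rule sq.linear_lift[OF b] sq.lift_tens[OF b])+
qed

lemma form_mult_left: "form ((x * y) \<otimes> z) = convolution (\<lambda>a. form (x \<otimes> a)) (\<lambda>a. form (y \<otimes> a)) z"
proof (rule linear_word_eqI[of "(*)"])
  note f = functional_form[OF linear_form]
  show "functional (\<lambda>z. form ((x * y) \<otimes> z))" by (rule f)
  show "functional (convolution (\<lambda>a. form (x \<otimes> a)) (\<lambda>a. form (y \<otimes> a)))"
    by (rule functional_convolution[OF f(2) f(2)])
  fix n I J assume IJ: "I \<in> idx n" "J \<in> idx n"
  then show "form ((x * y) \<otimes> word I J) = convolution (\<lambda>a. form (x \<otimes> a)) (\<lambda>a. form (y \<otimes> a)) (word I J)"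
    by (simp add: convolution_word[OF f(2) f(2)]) (simp add: form_tens dual_map_word_mult)
qed

lemma is_frt_form_form: "is_frt_form N c A T form"
proof -
  have "form (x \<otimes> (y * z)) = convolution (\<lambda>a. form (a \<otimes> z)) (\<lambda>a. form (a \<otimes> y)) x" for x y z
    by (simp add: form_tens dual_map_mult)
  then show ?thesis
    unfolding is_frt_form_def using form_mult_left
    by (simp add: linear_form convolution_def sweedler_def del: atLeastAtMost_iff)
      (simp add: form_tens dual_map_one dual_map_gen counit_one counit_gen rep_one rep_gen)
qed

lemma is_frt_form_iff: "is_frt_form N c A T R \<longleftrightarrow> R = frt_form N c A T"
proof -
  have "frt_form N c A T = form"
    unfolding frt_form_eq
    by (rule the_equality[where P = "is_frt_form N c A T"])
      (rule is_frt_form_form is_frt_form_unique[OF _ is_frt_form_form] | assumption)+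
  then show ?thesis using is_frt_form_form is_frt_form_unique by metis
qed

subsection \<open>The commutation relation\<close>

text \<open>
  For \<open>X = \<Delta>(x)\<close> these are the matrices \<open>\<Sum> R(x\<^sub>2 \<otimes> T\<^sub>j\<^sup>l) x\<^sub>1\<close> and \<open>\<Sum> R(x\<^sub>1 \<otimes> T\<^sub>j\<^sup>l) x\<^sub>2\<close> over \<open>A\<close>. Both are
  multiplicative in \<open>X\<close>.
\<close>

definition rep_right :: "'aa \<Rightarrow> nat \<Rightarrow> nat \<Rightarrow> 'a" where
  "rep_right X j l = tensor_lift (scl2 A) (scl A) (tens A) (\<lambda>a b. scl A (rep b j l) a) X"

definition rep_left :: "'aa \<Rightarrow> nat \<Rightarrow> nat \<Rightarrow> 'a" where
  "rep_left X j l = tensor_lift (scl2 A) (scl A) (tens A) (\<lambda>a b. scl A (rep a j l) b) X"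

lemma bilinear_rep:
  "bilinear_map (scl A) (scl A) (scl A) (\<lambda>a b. scl A (rep b j l) a)"
  "bilinear_map (scl A) (scl A) (scl A) (\<lambda>a b. scl A (rep a j l) b)"
  by (rule bilinear_mapI; simp add: linear_addD[OF functional_rep] linear_scaleD[OF functional_rep]
      alg.vector_space_axioms alg.scale_right_distrib alg.scale_left_distrib mult_ac)+

lemma linear_rep_right: "Vector_Spaces.linear (scl2 A) (scl A) (\<lambda>X. rep_right X j l)"
  and linear_rep_left: "Vector_Spaces.linear (scl2 A) (scl A) (\<lambda>X. rep_left X j l)"
  unfolding rep_right_def rep_left_def
  by (rule sq.linear_lift[OF bilinear_rep(1)] sq.linear_lift[OF bilinear_rep(2)])+

lemma rep_right_tens: "rep_right (a \<otimes> b) j l = scl A (rep b j l) a"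
  and rep_left_tens: "rep_left (a \<otimes> b) j l = scl A (rep a j l) b"
  unfolding rep_right_def rep_left_def
  by (rule sq.lift_tens[OF bilinear_rep(1)] sq.lift_tens[OF bilinear_rep(2)])+

lemma rep_right_mult: "rep_right (X \<odot> Y) j l = matmul {1..N} (rep_right X) (rep_right Y) j l"
proof -
  note l = linear_addD[OF linear_rep_right] linear_scaleD[OF linear_rep_right]
  show ?thesis unfolding matmul_def
    by (rule bilinear_eqI[of "scl A" _ "\<lambda>X Y. (\<Sum>k=1..N. rep_right X j k * rep_right Y k l)"];
        (rule bilinear_mapI)?;
        simp add: l mult2_simps alg.vector_space_axioms alg.scale_sum_right sum.distrib distrib_left distrib_right
          alg.scale_mult_left alg.scale_mult_right mult2_tens rep_right_tens rep_mult matmul_def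
          alg.scale_sum_left mult_ac)
qed

lemma rep_left_mult: "rep_left (X \<odot> Y) j l = matmul {1..N} (rep_left X) (rep_left Y) j l"
proof -
  note l = linear_addD[OF linear_rep_left] linear_scaleD[OF linear_rep_left]
  show ?thesis unfolding matmul_def
    by (rule bilinear_eqI[of "scl A" _ "\<lambda>X Y. (\<Sum>k=1..N. rep_left X j k * rep_left Y k l)"];
        (rule bilinear_mapI)?;
        simp add: l mult2_simps alg.vector_space_axioms alg.scale_sum_right sum.distrib distrib_left distrib_right
          alg.scale_mult_left alg.scale_mult_right mult2_tens rep_left_tens rep_mult matmul_def
          alg.scale_sum_left mult_ac)
qed

text \<open>
  The commutation rule with \<open>y\<close> a generator, written as a matrix identity \<open>T \<cdot> r(x) = l(x) \<cdot> T\<close> over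
  \<open>A\<close>. As \<open>r\<close> and \<open>l\<close> are multiplicative, it passes to products of elements \<open>x\<close>; for \<open>x\<close> a
  generator it is the defining relation of \<open>A\<close>.
\<close>

lemma commute_generator:
  assumes "j \<in> {1..N}" "n \<in> {1..N}"
  shows "matmul {1..N} T (rep_right (\<Delta> x)) j n = matmul {1..N} (rep_left (\<Delta> x)) T j n"
proof -
  let ?I = "{1..N}" and ?r = "\<lambda>x. rep_right (\<Delta> x)" and ?l = "\<lambda>x. rep_left (\<Delta> x)"
  let ?P = "{x. \<forall>j\<in>?I. \<forall>n\<in>?I. matmul ?I T (?r x) j n = matmul ?I (?l x) T j n}"
  have "x \<in> ?P"
  proof (induction rule: frt_induct)
    case subspace
    note l = linear_addD[OF linear_comult] linear_scaleD[OF linear_comult] linear_zeroD[OF linear_comult]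
      linear_addD[OF linear_rep_right] linear_scaleD[OF linear_rep_right] linear_zeroD[OF linear_rep_right]
      linear_addD[OF linear_rep_left] linear_scaleD[OF linear_rep_left] linear_zeroD[OF linear_rep_left]
    show ?case
      by (simp add: alg.subspace_def matmul_def l distrib_left distrib_right sum.distrib
          alg.scale_mult_left alg.scale_mult_right alg.scale_sum_right[symmetric] del: atLeastAtMost_iff)
  next
    case one
    show ?case
    proof safe
      fix j n assume jn: "j \<in> ?I" "n \<in> ?I"
      have "matmul ?I T (?r 1) j n = (\<Sum>k\<in>?I. if k = n then T j k else 0)"
        unfolding matmul_def by (intro sum.cong refl) (auto simp: comult_one rep_right_tens rep_one)
      also have "\<dots> = (\<Sum>k\<in>?I. if j = k then T k n else 0)" using jn by simp
      also have "\<dots> = matmul ?I (?l 1) T j n"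
        unfolding matmul_def using jn by (intro sum.cong refl) (auto simp: comult_one rep_left_tens rep_one)
      finally show "matmul ?I T (?r 1) j n = matmul ?I (?l 1) T j n" .
    qed
  next
    case (gen i m x)
    have gen_gen: "matmul ?I T (?r (T i m)) j n = matmul ?I (?l (T i m)) T j n"
      if jn: "j \<in> ?I" "n \<in> ?I" for j n
    proof -
      have "matmul ?I T (?r (T i m)) j n = (\<Sum>l=1..N. \<Sum>k=1..N. scl A (c l k m n) (T j l * T i k))"
        unfolding matmul_def using gen jn
        by (intro sum.cong refl)
          (simp add: comult_gen linear_sumD[OF linear_rep_right] rep_right_tens rep_gen sum_distrib_left
            alg.scale_mult_right del: atLeastAtMost_iff cong: sum.cong)
      also have "\<dots> = (\<Sum>k=1..N. \<Sum>l=1..N. scl A (c j i k l) (T k m * T l n))"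
        by (rule frt_relation[symmetric]) (use gen jn in blast)+
      also have "\<dots> = (\<Sum>l=1..N. \<Sum>k=1..N. scl A (c j i k l) (T k m * T l n))" by (rule sum.swap)
      also have "\<dots> = matmul ?I (?l (T i m)) T j n"
        unfolding matmul_def using gen jn
        by (intro sum.cong refl)
          (simp add: comult_gen linear_sumD[OF linear_rep_left] rep_left_tens rep_gen sum_distrib_right
            alg.scale_mult_left del: atLeastAtMost_iff cong: sum.cong)
      finally show ?thesis .
    qed
    have r_mult: "?r (T i m * x) = matmul ?I (?r (T i m)) (?r x)"
      and l_mult: "?l (T i m * x) = matmul ?I (?l (T i m)) (?l x)"
      by (intro ext, simp only: comult_mult rep_right_mult rep_left_mult)+
    show ?case
    proof (rule CollectI, intro ballI)
      fix j n assume jn: "j \<in> ?I" "n \<in> ?I"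
      have "matmul ?I T (?r (T i m * x)) j n = matmul ?I (matmul ?I T (?r (T i m))) (?r x) j n"
        by (simp only: r_mult matmul_assoc)
      also have "\<dots> = matmul ?I (matmul ?I (?l (T i m)) T) (?r x) j n"
        by (rule matmul_cong[OF _ refl]) (rule gen_gen[OF jn(1)])
      also have "\<dots> = matmul ?I (?l (T i m)) (matmul ?I T (?r x)) j n" by (simp only: matmul_assoc)
      also have "\<dots> = matmul ?I (?l (T i m)) (matmul ?I (?l x) T) j n"
        by (rule matmul_cong[OF refl]) (use gen jn in blast)
      also have "\<dots> = matmul ?I (?l (T i m * x)) T j n" by (simp only: l_mult matmul_assoc)
      finally show "matmul ?I T (?r (T i m * x)) j n = matmul ?I (?l (T i m * x)) T j n" .
    qed
  qed
  then show ?thesis using assms by blast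
qed

lemma commute_generator_word:
  assumes IM: "I \<in> idx p" "M \<in> idx p" and jn: "j \<in> {1..N}" "n \<in> {1..N}"
  shows "(\<Sum>l=1..N. \<Sum>K\<in>idx p. scl A (rep (word K M) l n) (T j l * word I K)) =
    (\<Sum>l=1..N. \<Sum>K\<in>idx p. scl A (rep (word I K) j l) (word K M * T l n))"
  using commute_generator[OF jn, of "word I M"] IM
  by (simp add: matmul_def comult_word linear_sumD[OF linear_rep_right] linear_sumD[OF linear_rep_left]
      rep_right_tens rep_left_tens sum_distrib_left sum_distrib_right alg.scale_mult_left alg.scale_mult_right)

text \<open>
  Induction on the length of the second word: \<open>R(x \<otimes> y y') = \<Sum> R(x\<^sub>1 \<otimes> y') R(x\<^sub>2 \<otimes> y)\<close> splits off its first
  letter, after which the word \<open>x\<close> is moved past \<open>y'\<close> by the induction hypothesis and past the letter by the previous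
  lemma.
\<close>

lemma commute_words:
  assumes "I \<in> idx p" "M \<in> idx p" "J \<in> idx q" "L' \<in> idx q"
  shows "(\<Sum>L\<in>idx q. \<Sum>K\<in>idx p. scl A (dual_map (word L L') (word K M)) (word J L * word I K)) =
    (\<Sum>L\<in>idx q. \<Sum>K\<in>idx p. scl A (dual_map (word J L) (word I K)) (word K M * word L L'))"
  using assms
proof (induction q arbitrary: I M J L')
  case 0
  have "(\<Sum>K\<in>idx p. scl A (counit (word K M)) (word I K)) = (\<Sum>K\<in>idx p. if K = M then word I K else 0)"
    using 0 by (intro sum.cong refl) (simp add: counit_word)
  also have "\<dots> = (\<Sum>K\<in>idx p. if I = K then word K M else 0)"
    using 0 by (simp add: finite_idx)
  also have "\<dots> = (\<Sum>K\<in>idx p. scl A (counit (word I K)) (word K M))"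
    using 0 by (intro sum.cong refl) (simp add: counit_word)
  finally show ?case using 0 by (simp add: idx_0 dual_map_one)
next
  case (Suc q)
  then obtain j J' n N' where J: "J = j # J'" "L' = n # N'"
    and jn: "j \<in> {1..N}" "n \<in> {1..N}" and JN: "J' \<in> idx q" "N' \<in> idx q"
    by (auto simp: idx_Suc simp del: atLeastAtMost_iff)
  let ?r = "\<lambda>K M L L'. dual_map (word L L') (word K M)" and ?g = "\<lambda>K M l n. rep (word K M) l n"
  note IM = Suc.prems(1,2)
  have r: "dual_map (T l n * word L L') (word K M) = (\<Sum>S\<in>idx p. ?r K S L L' * ?g S M l n)"
    if "l \<in> {1..N}" "n \<in> {1..N}" "K \<in> idx p" "M \<in> idx p" for l n L L' K M
    unfolding dual_map_mult dual_map_gen[OF that(1,2)]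
    by (rule convolution_word[OF functional_dual_map functional_rep that(3,4)])
  note expand = alg.scale_sum_right alg.scale_sum_left sum_distrib_left sum_distrib_right
    alg.scale_mult_left alg.scale_mult_right alg.scale_scale
  have "(\<Sum>l=1..N. \<Sum>L\<in>idx q. \<Sum>K\<in>idx p.
        scl A (dual_map (T l n * word L N') (word K M)) (T j l * word J' L * word I K)) =
      (\<Sum>l=1..N. \<Sum>L\<in>idx q. \<Sum>K\<in>idx p. \<Sum>S\<in>idx p.
        scl A (?g S M l n * ?r K S L N') (T j l * (word J' L * word I K)))"
    using IM jn by (intro sum.cong refl) (simp only: r alg.scale_sum_left mult_ac(1) mult.commute[of "dual_map _ _"] mult.assoc)
  also have "\<dots> = (\<Sum>l=1..N. \<Sum>L\<in>idx q. \<Sum>S\<in>idx p. \<Sum>K\<in>idx p.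
        scl A (?g S M l n * ?r K S L N') (T j l * (word J' L * word I K)))"
    by (rule sum.cong[OF refl], rule sum.cong[OF refl], rule sum.swap)
  also have "\<dots> = (\<Sum>l=1..N. \<Sum>S\<in>idx p. \<Sum>L\<in>idx q. \<Sum>K\<in>idx p.
        scl A (?g S M l n * ?r K S L N') (T j l * (word J' L * word I K)))"
    by (rule sum.cong[OF refl], rule sum.swap)
  also have "\<dots> = (\<Sum>l=1..N. \<Sum>S\<in>idx p. scl A (?g S M l n)
        (T j l * (\<Sum>L\<in>idx q. \<Sum>K\<in>idx p. scl A (?r K S L N') (word J' L * word I K))))"
    by (simp only: expand)
  also have "\<dots> = (\<Sum>l=1..N. \<Sum>S\<in>idx p. scl A (?g S M l n)
        (T j l * (\<Sum>L\<in>idx q. \<Sum>K\<in>idx p. scl A (?r I K J' L) (word K S * word L N'))))"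
    using IM JN by (intro sum.cong refl) (simp only: Suc.IH)
  also have "\<dots> = (\<Sum>l=1..N. \<Sum>S\<in>idx p. \<Sum>L\<in>idx q. \<Sum>K\<in>idx p.
        scl A (?g S M l n * ?r I K J' L) (T j l * word K S * word L N'))"
    by (simp only: expand mult.assoc)
  also have "\<dots> = (\<Sum>L\<in>idx q. \<Sum>K\<in>idx p. \<Sum>l=1..N. \<Sum>S\<in>idx p.
        scl A (?r I K J' L * ?g S M l n) (T j l * word K S * word L N'))"
    by (subst sum_swap_pairs) (simp only: mult.commute)
  also have "\<dots> = (\<Sum>L\<in>idx q. \<Sum>K\<in>idx p. scl A (?r I K J' L)
        ((\<Sum>l=1..N. \<Sum>S\<in>idx p. scl A (?g S M l n) (T j l * word K S)) * word L N'))"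
    by (simp only: expand)
  also have "\<dots> = (\<Sum>L\<in>idx q. \<Sum>K\<in>idx p. scl A (?r I K J' L)
        ((\<Sum>l=1..N. \<Sum>S\<in>idx p. scl A (?g K S j l) (word S M * T l n)) * word L N'))"
    using IM jn by (intro sum.cong refl) (simp only: commute_generator_word)
  also have "\<dots> = (\<Sum>L\<in>idx q. \<Sum>K\<in>idx p. \<Sum>l=1..N. \<Sum>S\<in>idx p.
        scl A (?r I K J' L * ?g K S j l) (word S M * (T l n * word L N')))"
    by (simp only: expand mult.assoc)
  also have "\<dots> = (\<Sum>l=1..N. \<Sum>S\<in>idx p. \<Sum>L\<in>idx q. \<Sum>K\<in>idx p.
        scl A (?r I K J' L * ?g K S j l) (word S M * (T l n * word L N')))"
    by (rule sum_swap_pairs)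
  also have "\<dots> = (\<Sum>l=1..N. \<Sum>L\<in>idx q. \<Sum>S\<in>idx p. \<Sum>K\<in>idx p.
        scl A (?r I K J' L * ?g K S j l) (word S M * (T l n * word L N')))"
    by (intro sum.cong refl sum.swap)
  also have "\<dots> = (\<Sum>l=1..N. \<Sum>L\<in>idx q. \<Sum>S\<in>idx p.
        scl A (dual_map (T j l * word J' L) (word I S)) (word S M * (T l n * word L N')))"
    using IM jn by (intro sum.cong refl) (simp only: r alg.scale_sum_left)
  finally show ?case unfolding J sum_idx_Suc word.simps .
qed

text \<open>
  The linear map \<open>f\<close> is the identity for the untwisted commutation rule and \<open>\<alpha>\<close> for the twisted one.
\<close>

lemma bilinear_commute:
  assumes f: "Vector_Spaces.linear (scl A) (scl A) f"
  shows "bilinear_map (scl A) (scl A) (scl A) (\<lambda>y\<^sub>1 y\<^sub>2. scl A (form (x\<^sub>2 \<otimes> y\<^sub>2)) (f (y\<^sub>1 * x\<^sub>1)))"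
    "bilinear_map (scl A) (scl A) (scl A) (\<lambda>x\<^sub>1 x\<^sub>2. scl A (form (x\<^sub>2 \<otimes> y\<^sub>2)) (f (y\<^sub>1 * x\<^sub>1)))"
    "bilinear_map (scl A) (scl A) (scl A) (\<lambda>y\<^sub>1 y\<^sub>2. scl A (form (x\<^sub>1 \<otimes> y\<^sub>1)) (f (x\<^sub>2 * y\<^sub>2)))"
    "bilinear_map (scl A) (scl A) (scl A) (\<lambda>x\<^sub>1 x\<^sub>2. scl A (form (x\<^sub>1 \<otimes> y\<^sub>1)) (f (x\<^sub>2 * y\<^sub>2)))"
  by (rule bilinear_mapI; simp add: sq.tens_simps linear_addD[OF linear_form] linear_scaleD[OF linear_form]
      distrib_left distrib_right linear_addD[OF f] linear_scaleD[OF f] alg.vector_space_axioms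
      alg.scale_right_distrib alg.scale_left_distrib alg.scale_mult_left alg.scale_mult_right mult_ac(2))+

text \<open>
  Both sides are bilinear in \<open>x\<close> and \<open>y\<close>, and on words the coproducts are explicit.
\<close>

theorem form_commutation:
  "double_lift (scl A) (\<lambda>x\<^sub>1 x\<^sub>2 y\<^sub>1 y\<^sub>2. scl A (form (x\<^sub>2 \<otimes> y\<^sub>2)) (y\<^sub>1 * x\<^sub>1)) (\<Delta> x) (\<Delta> y) =
   double_lift (scl A) (\<lambda>x\<^sub>1 x\<^sub>2 y\<^sub>1 y\<^sub>2. scl A (form (x\<^sub>1 \<otimes> y\<^sub>1)) (x\<^sub>2 * y\<^sub>2)) (\<Delta> x) (\<Delta> y)"
  (is "?L (\<Delta> x) (\<Delta> y) = ?R (\<Delta> x) (\<Delta> y)")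
proof -
  note b = bilinear_commute[OF alg.linear_ident]
  have L: "bilinear_map (scl2 A) (scl2 A) (scl A) ?L" by (rule bilinear_double_lift[OF b(1,2)])
  have R: "bilinear_map (scl2 A) (scl2 A) (scl A) ?R" by (rule bilinear_double_lift[OF b(3,4)])
  have lin: "Vector_Spaces.linear (scl A) (scl A) (\<lambda>x. h (\<Delta> x) Y)"
    "Vector_Spaces.linear (scl A) (scl A) (\<lambda>y. h X (\<Delta> y))"
    if "bilinear_map (scl2 A) (scl2 A) (scl A) h" for h X Y
    using Vector_Spaces.linear_compose[OF linear_comult linear_left[OF that]]
      Vector_Spaces.linear_compose[OF linear_comult linear_right[OF that]] by (simp_all add: o_def)
  have "?L (\<Delta> (word I M)) (\<Delta> y) = ?R (\<Delta> (word I M)) (\<Delta> y)" if IM: "I \<in> idx p" "M \<in> idx p" for p I M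
  proof (rule linear_word_eqI[OF lin(2)[OF L] lin(2)[OF R]])
    fix q J L' assume JL: "J \<in> idx q" "L' \<in> idx q"
    have expand: "h (\<Delta> (word I M)) (\<Delta> (word J L')) =
      (\<Sum>L\<in>idx q. \<Sum>K\<in>idx p. h (word I K \<otimes> word K M) (word J L \<otimes> word L L'))"
      if "bilinear_map (scl2 A) (scl2 A) (scl A) h" for h
      unfolding comult_word[OF IM] comult_word[OF JL] linear_sumD[OF linear_left[OF that]]
        linear_sumD[OF linear_right[OF that]] by (rule refl)
    show "?L (\<Delta> (word I M)) (\<Delta> (word J L')) = ?R (\<Delta> (word I M)) (\<Delta> (word J L'))"
      using commute_words[OF IM JL, folded form_tens]
      unfolding expand[OF L] expand[OF R] double_lift_tens[OF b(1,2)] double_lift_tens[OF b(3,4)] .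
  qed
  then show ?thesis by (rule linear_word_eqI[OF lin(1)[OF L] lin(1)[OF R]])
qed

end

section \<open>Twisting by a bialgebra morphism\<close>

context algebra_with_cube
begin

lemma square_map_mult2:
  assumes f: "Vector_Spaces.linear (scl A) (scl A) f" and mult: "\<And>x y. f (x * y) = f x * f y"
  shows "tensor_square_map A f (X \<odot> Y) = tensor_square_map A f X \<odot> tensor_square_map A f Y"
proof -
  note s = linear_square_map[OF f]
  show ?thesis
    by (rule bilinear_eqI[of "scl2 A" _ "\<lambda>X Y. tensor_square_map A f X \<odot> tensor_square_map A f Y"];
        (rule bilinear_mapI)?;
        simp add: mult2_simps linear_addD[OF s(1)] linear_scaleD[OF s(1)] s(2) mult2_tens mult
          sq.T.vector_space_axioms)
qed

lemma lift_square_map: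
  assumes f: "Vector_Spaces.linear (scl A) (scl A) f" and \<beta>: "bilinear_map (scl A) (scl A) sC \<beta>"
  shows "tensor_lift (scl2 A) sC (tens A) \<beta> (tensor_square_map A f X) =
    tensor_lift (scl2 A) sC (tens A) (\<lambda>a b. \<beta> (f a) (f b)) X"
proof -
  note s = linear_square_map[OF f]
  have b: "bilinear_map (scl A) (scl A) sC (\<lambda>a b. \<beta> (f a) (f b))"
    by (rule bilinear_mapI) (simp_all add: bilinear_mapD[OF \<beta>] linear_addD[OF f] linear_scaleD[OF f])
  have "Vector_Spaces.linear (scl2 A) sC (\<lambda>X. tensor_lift (scl2 A) sC (tens A) \<beta> (tensor_square_map A f X))"
    using Vector_Spaces.linear_compose[OF s(1) sq.linear_lift[OF \<beta>]] by (simp add: o_def)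
  then show ?thesis
    by (rule sq.linear_eqI[OF _ sq.linear_lift[OF b]]) (simp add: s(2) sq.lift_tens[OF \<beta>] sq.lift_tens[OF b])
qed

end

locale frt_twist = frt_quantum_group A N c T
  for A :: "('k::field, 'a::ring_1, 'aa::ab_group_add, 'aaa::ab_group_add) tensor_space"
    (structure) and N c T +
  fixes \<alpha> :: "'a \<Rightarrow> 'a"
  assumes bialgebra_endomorphism: "bialgebra_endomorphism A \<Delta> \<alpha>"
begin

lemma linear_twist: "Vector_Spaces.linear (scl A) (scl A) \<alpha>"
  and twist_one: "\<alpha> 1 = 1"
  and twist_mult: "\<alpha> (x * y) = \<alpha> x * \<alpha> y"
  and twist_comult: "tensor_square_map A \<alpha> (\<Delta> x) = \<Delta> (\<alpha> x)"
  using bialgebra_endomorphism by (simp_all add: bialgebra_endomorphism_def fun_eq_iff)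

text \<open>
  As \<open>\<alpha>\<close> commutes with \<open>\<mu>\<close> and \<open>\<Delta>\<close>, all its copies can be moved onto the arguments; what remains are
  ordinary associativity, coassociativity and multiplicativity of \<open>\<Delta>\<close> at \<open>\<alpha> (\<alpha> x)\<close>.
\<close>

lemma hom_bialgebra: "hom_bialgebra A (\<alpha> \<circ> mult_map A) (\<Delta> \<circ> \<alpha>) \<alpha>"
proof (intro hom_bialgebra.intro hom_bialgebra_axioms.intro)
  let ?S = "tensor_square_map A \<alpha>"
  note S = linear_square_map[OF linear_twist]
  note comp = Vector_Spaces.linear_compose
  note lm = comp[OF linear_mult_map linear_twist] and ld = comp[OF linear_twist linear_comult]
  show "tensor_cube A" by (rule tensor_cube_axioms)
  show "Vector_Spaces.linear (scl2 A) (scl A) (\<alpha> \<circ> mult_map A)" by (rule lm)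
  show "Vector_Spaces.linear (scl A) (scl2 A) (\<Delta> \<circ> \<alpha>)" by (rule ld)
  show "Vector_Spaces.linear (scl A) (scl A) \<alpha>" by (rule linear_twist)
  show "\<alpha> \<circ> (\<alpha> \<circ> mult_map A) = \<alpha> \<circ> mult_map A \<circ> ?S"
    by (rule ext, rule sq.linear_eqI[OF comp[OF lm linear_twist] comp[OF S(1) lm]])
      (simp add: S(2) mult_map_tens twist_mult)
  show "?S \<circ> (\<Delta> \<circ> \<alpha>) = \<Delta> \<circ> \<alpha> \<circ> \<alpha>" by (simp add: fun_eq_iff twist_comult)
  show "\<alpha> \<circ> mult_map A \<circ> tensor_map (scl3 A) (tensr A) (scl2 A) (tens A) \<alpha> (\<alpha> \<circ> mult_map A) =
    \<alpha> \<circ> mult_map A \<circ> tensor_map (scl3 A) (tensl A) (scl2 A) (tens A) (\<alpha> \<circ> mult_map A) \<alpha>"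
    (is "?m \<circ> ?r = ?m \<circ> ?l")
  proof
    fix W
    have r: "Vector_Spaces.linear (scl3 A) (scl2 A) ?r" "?r (tensr A x Y) = \<alpha> x \<otimes> ?m Y" for x Y
      by (rule cr.linear_tensor_map[OF sq.bilinear_tens linear_twist lm]
          cr.tensor_map_tens[OF sq.bilinear_tens linear_twist lm])+
    have l: "Vector_Spaces.linear (scl3 A) (scl2 A) ?l" "?l (tensl A X y) = ?m X \<otimes> \<alpha> y" for X y
      by (rule cl.linear_tensor_map[OF sq.bilinear_tens lm linear_twist]
          cl.tensor_map_tens[OF sq.bilinear_tens lm linear_twist])+
    note mr = comp[OF r(1) lm] and ml = comp[OF l(1) lm]
    have tr: "Vector_Spaces.linear (scl2 A) (scl3 A) (tensr A x)" for x
      by (rule linearI) (simp_all add: cr.tens_simps sq.T.vector_space_axioms cl.T.vector_space_axioms)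
    have "(?m \<circ> ?r) (tensr A x Y) = (?m \<circ> ?l) (tensr A x Y)" for x Y
    proof -
      have "(?m \<circ> ?r \<circ> tensr A x) Y = (?m \<circ> ?l \<circ> tensr A x) Y"
      proof (rule sq.linear_eqI[OF comp[OF tr mr] comp[OF tr ml]])
        fix y z
        have "(?m \<circ> ?r) (tensr A x (y \<otimes> z)) = \<alpha> (\<alpha> x * \<alpha> (y * z))"
          unfolding o_apply r(2) mult_map_tens by (simp add: mult_map_tens)
        also have "\<dots> = \<alpha> (\<alpha> (x * y) * \<alpha> z)" by (simp only: twist_mult mult.assoc)
        also have "\<dots> = (?m \<circ> ?l) (tensr A x (y \<otimes> z))"
          unfolding tens_assoc[symmetric] o_apply l(2) mult_map_tens by (simp add: mult_map_tens)
        finally show "(?m \<circ> ?r \<circ> tensr A x) (y \<otimes> z) = (?m \<circ> ?l \<circ> tensr A x) (y \<otimes> z)" by simp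
      qed
      then show ?thesis by simp
    qed
    then show "(?m \<circ> ?r) W = (?m \<circ> ?l) W" by (rule cr.linear_eqI[OF mr ml])
  qed
  show "tensor_map (scl2 A) (tens A) (scl3 A) (tensr A) \<alpha> (\<Delta> \<circ> \<alpha>) \<circ> (\<Delta> \<circ> \<alpha>) =
    tensor_map (scl2 A) (tens A) (scl3 A) (tensl A) (\<Delta> \<circ> \<alpha>) \<alpha> \<circ> (\<Delta> \<circ> \<alpha>)"
  proof
    fix x
    let ?r = "tensor_map (scl2 A) (tens A) (scl3 A) (tensr A)"
      and ?l = "tensor_map (scl2 A) (tens A) (scl3 A) (tensl A)"
    note r = sq.linear_tensor_map[OF cr.bilinear_tens] sq.tensor_map_tens[OF cr.bilinear_tens]
    note l = sq.linear_tensor_map[OF cl.bilinear_tens] sq.tensor_map_tens[OF cl.bilinear_tens]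
    have "?r \<alpha> (\<Delta> \<circ> \<alpha>) X = (?r id \<Delta> \<circ> ?S) X" for X
      by (rule sq.linear_eqI[OF r(1)[OF linear_twist ld] comp[OF S(1) r(1)[OF alg.linear_id linear_comult]]])
        (simp add: r(2)[OF linear_twist ld] r(2)[OF alg.linear_id linear_comult] S(2))
    moreover have "?l (\<Delta> \<circ> \<alpha>) \<alpha> X = (?l \<Delta> id \<circ> ?S) X" for X
      by (rule sq.linear_eqI[OF l(1)[OF ld linear_twist] comp[OF S(1) l(1)[OF linear_comult alg.linear_id]]])
        (simp add: l(2)[OF ld linear_twist] l(2)[OF linear_comult alg.linear_id] S(2))
    ultimately show "(?r \<alpha> (\<Delta> \<circ> \<alpha>) \<circ> (\<Delta> \<circ> \<alpha>)) x = (?l (\<Delta> \<circ> \<alpha>) \<alpha> \<circ> (\<Delta> \<circ> \<alpha>)) x"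
      by (simp add: twist_comult coassociative)
  qed
  fix a b
  \<comment> \<open>The tensor square of the twisted product is the product of the tensor square, twisted by \<open>\<alpha> \<otimes> \<alpha>\<close>.\<close>
  have tm: "tensor_mult A (\<alpha> \<circ> mult_map A) X Y = ?S (X \<odot> Y)" for X Y
  proof (rule bilinear_eqI[OF bilinear_tensor_mult[OF lm]])
    show "bilinear_map (scl2 A) (scl2 A) (scl2 A) (\<lambda>X Y. ?S (X \<odot> Y))"
      by (rule bilinear_mapI)
        (simp_all add: mult2_simps linear_addD[OF S(1)] linear_scaleD[OF S(1)] sq.T.vector_space_axioms)
  qed (simp add: tensor_mult_tens[OF lm] mult2_tens S(2) mult_map_tens)
  show "(\<Delta> \<circ> \<alpha>) ((\<alpha> \<circ> mult_map A) (a \<otimes> b)) =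
      tensor_mult A (\<alpha> \<circ> mult_map A) ((\<Delta> \<circ> \<alpha>) a) ((\<Delta> \<circ> \<alpha>) b)"
    by (simp add: tm mult_map_tens comult_mult[symmetric] twist_comult twist_mult)
qed

text \<open>
  The two multiplicativity rules are the untwisted ones at \<open>\<alpha> x\<close>, \<open>\<alpha> y\<close>, \<open>\<alpha> z\<close>. The commutation rule is the
  image under \<open>\<alpha>\<close> of the untwisted one at \<open>\<alpha> x\<close>, \<open>\<alpha> y\<close>.
\<close>

theorem cobraided: "cobraided_hom_bialgebra A (\<alpha> \<circ> mult_map A) (\<Delta> \<circ> \<alpha>) \<alpha> (frt_form N c A T)"
proof (intro cobraided_hom_bialgebra.intro cobraided_hom_bialgebra_axioms.intro)
  let ?R = "frt_form N c A T"
  have R: "is_frt_form N c A T ?R" by (simp add: is_frt_form_iff)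
  have form: "?R = form" using is_frt_form_form by (simp add: is_frt_form_iff)
  show "hom_bialgebra A (\<alpha> \<circ> mult_map A) (\<Delta> \<circ> \<alpha>) \<alpha>" by (rule hom_bialgebra)
  show "Vector_Spaces.linear (scl2 A) (*) ?R" by (rule is_frt_formD(1)[OF R])
  fix x y z
  show "?R ((\<alpha> \<circ> mult_map A) (x \<otimes> y) \<otimes> \<alpha> z) =
      tensor_lift (scl2 A) (*) (tens A) (\<lambda>z\<^sub>1 z\<^sub>2. ?R (\<alpha> x \<otimes> z\<^sub>1) * ?R (\<alpha> y \<otimes> z\<^sub>2)) ((\<Delta> \<circ> \<alpha>) z)"
    using is_frt_formD(6)[OF R, of "\<alpha> x" "\<alpha> y" "\<alpha> z"]
    by (simp add: mult_map_tens twist_mult convolution_def sweedler_def)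
  show "?R (\<alpha> x \<otimes> (\<alpha> \<circ> mult_map A) (y \<otimes> z)) =
      tensor_lift (scl2 A) (*) (tens A) (\<lambda>x\<^sub>1 x\<^sub>2. ?R (x\<^sub>1 \<otimes> \<alpha> z) * ?R (x\<^sub>2 \<otimes> \<alpha> y)) ((\<Delta> \<circ> \<alpha>) x)"
    using is_frt_formD(7)[OF R, of "\<alpha> x" "\<alpha> y" "\<alpha> z"]
    by (simp add: mult_map_tens twist_mult convolution_def sweedler_def)
  let ?L = "\<lambda>f. double_lift (scl A) (\<lambda>x\<^sub>1 x\<^sub>2 y\<^sub>1 y\<^sub>2. scl A (form (x\<^sub>2 \<otimes> y\<^sub>2)) (f (y\<^sub>1 * x\<^sub>1)))"
    and ?M = "\<lambda>f. double_lift (scl A) (\<lambda>x\<^sub>1 x\<^sub>2 y\<^sub>1 y\<^sub>2. scl A (form (x\<^sub>1 \<otimes> y\<^sub>1)) (f (x\<^sub>2 * y\<^sub>2)))"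
  note b = bilinear_commute[OF linear_twist] and b1 = bilinear_commute[OF alg.linear_ident]
  have comp: "bilinear_map (scl2 A) (scl2 A) (scl A) (\<lambda>X Y. \<alpha> (h X Y))"
    if "bilinear_map (scl2 A) (scl2 A) (scl A) h" for h
    by (rule bilinear_mapI)
      (simp_all add: bilinear_mapD[OF that] linear_addD[OF linear_twist] linear_scaleD[OF linear_twist])
  have "?L \<alpha> X Y = \<alpha> (?L (\<lambda>a. a) X Y)" for X Y
    by (rule bilinear_eqI[OF bilinear_double_lift[OF b(1,2)] comp[OF bilinear_double_lift[OF b1(1,2)]]])
      (simp add: double_lift_tens[OF b(1,2)] double_lift_tens[OF b1(1,2)] linear_scaleD[OF linear_twist])
  moreover have "?M \<alpha> X Y = \<alpha> (?M (\<lambda>a. a) X Y)" for X Y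
    by (rule bilinear_eqI[OF bilinear_double_lift[OF b(3,4)] comp[OF bilinear_double_lift[OF b1(3,4)]]])
      (simp add: double_lift_tens[OF b(3,4)] double_lift_tens[OF b1(3,4)] linear_scaleD[OF linear_twist])
  ultimately have "?L \<alpha> (\<Delta> (\<alpha> x)) (\<Delta> (\<alpha> y)) = ?M \<alpha> (\<Delta> (\<alpha> x)) (\<Delta> (\<alpha> y))"
    by (simp only: form_commutation)
  then show "tensor_lift (scl2 A) (scl A) (tens A) (\<lambda>x\<^sub>1 x\<^sub>2.
         tensor_lift (scl2 A) (scl A) (tens A)
           (\<lambda>y\<^sub>1 y\<^sub>2. scl A (?R (x\<^sub>2 \<otimes> y\<^sub>2)) ((\<alpha> \<circ> mult_map A) (y\<^sub>1 \<otimes> x\<^sub>1))) ((\<Delta> \<circ> \<alpha>) y)) ((\<Delta> \<circ> \<alpha>) x) =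
       tensor_lift (scl2 A) (scl A) (tens A) (\<lambda>x\<^sub>1 x\<^sub>2.
         tensor_lift (scl2 A) (scl A) (tens A)
           (\<lambda>y\<^sub>1 y\<^sub>2. scl A (?R (x\<^sub>1 \<otimes> y\<^sub>1)) ((\<alpha> \<circ> mult_map A) (x\<^sub>2 \<otimes> y\<^sub>2))) ((\<Delta> \<circ> \<alpha>) y)) ((\<Delta> \<circ> \<alpha>) x)"
    unfolding double_lift_def form by (simp only: o_apply mult_map_tens)
qed

end

context frt_quantum_group
begin

lemma twist_unique:
  assumes "is_frt_twist N A T lam \<alpha>" "is_frt_twist N A T lam \<beta>"
  shows "\<alpha> = \<beta>"
proof
  fix x
  show "\<alpha> x = \<beta> x"
    by (rule multiplicative_unique[where sT = "scl A" and m = "(*)"])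
      (use assms in \<open>simp_all add: is_frt_twist_def bialgebra_endomorphism_def\<close>)
qed

context
  fixes lam :: "nat \<Rightarrow> 'k"
  assumes lam_nonzero: "\<And>i. i \<in> {1..N} \<Longrightarrow> lam i \<noteq> 0"
    and lam_compatible: "\<And>i j m n. i \<in> {1..N} \<Longrightarrow> j \<in> {1..N} \<Longrightarrow> m \<in> {1..N} \<Longrightarrow> n \<in> {1..N} \<Longrightarrow>
      lam i * lam j * c i j m n = lam m * lam n * c i j m n"
begin

text \<open>
  Rescaling \<open>T\<^sub>i\<^sup>j\<close> by \<open>\<lambda>\<^sub>i \<lambda>\<^sub>j\<inverse>\<close> multiplies every term of the relation for \<open>i, j, p, q\<close> whose coefficient
  does not vanish by the same scalar \<open>z = \<lambda>\<^sub>i \<lambda>\<^sub>j / (\<lambda>\<^sub>p \<lambda>\<^sub>q)\<close>; this is where compatibility of the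
  \<open>\<lambda>\<^sub>i\<close> with \<open>c\<close> enters.
\<close>

lemma ex_twist: "\<exists>\<alpha>. is_frt_twist N A T lam \<alpha>"
proof -
  let ?w = "\<lambda>i j. lam i * inverse (lam j)"
  let ?x = "\<lambda>i j. scl A (?w i j) (T i j)"
  have "\<exists>h. Vector_Spaces.linear (scl A) (scl A) h \<and> h 1 = 1 \<and> (\<forall>a b. h (a * b) = h a * h b) \<and>
    (\<forall>i\<in>{1..N}. \<forall>j\<in>{1..N}. h (T i j) = ?x i j) \<and> range h \<subseteq> UNIV"
  proof (rule frt_lift[OF alg.algebra_on_UNIV])
    fix i j p q assume ijpq: "i \<in> {1..N}" "j \<in> {1..N}" "p \<in> {1..N}" "q \<in> {1..N}"
    define z where "z = lam i * lam j * inverse (lam p * lam q)"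
    have 1: "c i j k l * (?w l q * ?w k p) = z * c i j k l" if "k \<in> {1..N}" "l \<in> {1..N}" for k l
      using lam_compatible[OF ijpq(1,2) that] by (auto simp: z_def mult_ac)
    have 2: "c k l p q * (?w j l * ?w i k) = z * c k l p q" if "k \<in> {1..N}" "l \<in> {1..N}" for k l
      using lam_compatible[OF that ijpq(3,4)] lam_nonzero[OF that(1)] lam_nonzero[OF that(2)]
        lam_nonzero[OF ijpq(3)] lam_nonzero[OF ijpq(4)]
      by (simp add: z_def field_simps)
    have "(\<Sum>k=1..N. \<Sum>l=1..N. scl A (c i j k l) (?x k p * ?x l q)) =
        (\<Sum>k=1..N. \<Sum>l=1..N. scl A z (scl A (c i j k l) (T k p * T l q)))"
      by (intro sum.cong refl)
        (simp only: alg.scale_mult_left alg.scale_mult_right alg.scale_scale 1)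
    also have "\<dots> = scl A z (\<Sum>k=1..N. \<Sum>l=1..N. scl A (c i j k l) (T k p * T l q))"
      by (simp only: alg.scale_sum_right)
    also have "\<dots> = scl A z (\<Sum>k=1..N. \<Sum>l=1..N. scl A (c k l p q) (T i k * T j l))"
      by (simp only: frt_relation[OF ijpq])
    also have "\<dots> = (\<Sum>k=1..N. \<Sum>l=1..N. scl A z (scl A (c k l p q) (T i k * T j l)))"
      by (simp only: alg.scale_sum_right)
    also have "\<dots> = (\<Sum>k=1..N. \<Sum>l=1..N. scl A (c k l p q) (?x i k * ?x j l))"
      by (intro sum.cong refl)
        (simp only: alg.scale_mult_left alg.scale_mult_right alg.scale_scale 2)
    finally show "(\<Sum>k=1..N. \<Sum>l=1..N. scl A (c i j k l) (?x k p * ?x l q)) =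
      (\<Sum>k=1..N. \<Sum>l=1..N. scl A (c k l p q) (?x i k * ?x j l))" .
  qed simp
  then obtain h where h: "Vector_Spaces.linear (scl A) (scl A) h" and h1: "h 1 = 1"
    and hm: "\<And>a b. h (a * b) = h a * h b"
    and hg: "\<And>i j. i \<in> {1..N} \<Longrightarrow> j \<in> {1..N} \<Longrightarrow> h (T i j) = ?x i j" by blast
  note S = linear_square_map[OF h]
  have "(tensor_square_map A h \<circ> \<Delta>) x = (\<Delta> \<circ> h) x" for x
  proof (rule multiplicative_unique[where m = "(\<odot>)"])
    show "Vector_Spaces.linear (scl A) (scl2 A) (tensor_square_map A h \<circ> \<Delta>)"
      "Vector_Spaces.linear (scl A) (scl2 A) (\<Delta> \<circ> h)"
      by (rule Vector_Spaces.linear_compose[OF linear_comult S(1)] Vector_Spaces.linear_compose[OF h linear_comult])+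
    fix i j assume ij: "i \<in> {1..N}" "j \<in> {1..N}"
    have "(tensor_square_map A h \<circ> \<Delta>) (T i j) = (\<Sum>k=1..N. scl2 A (?w i j) (T i k \<otimes> T k j))"
      unfolding o_apply comult_gen[OF ij] linear_sumD[OF S(1)] S(2)
      using ij lam_nonzero
      by (intro sum.cong refl) (simp add: hg sq.tens_simps mult_ac del: atLeastAtMost_iff)
    also have "\<dots> = (\<Delta> \<circ> h) (T i j)"
      using ij by (simp add: hg linear_scaleD[OF linear_comult] comult_gen sq.T.scale_sum_right del: atLeastAtMost_iff)
    finally show "(tensor_square_map A h \<circ> \<Delta>) (T i j) = (\<Delta> \<circ> h) (T i j)" .
  qed (simp_all add: comult_one h1 hm S(2) comult_mult square_map_mult2[OF h hm])
  then have "is_frt_twist N A T lam h"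
    unfolding is_frt_twist_def bialgebra_endomorphism_def using h h1 hm hg by blast
  then show ?thesis by blast
qed

text \<open>
  \<open>R \<circ> (\<alpha> \<otimes> \<alpha>)\<close> satisfies the conditions that characterise \<open>R\<close>: the multiplicativity rules because \<open>\<alpha>\<close> is a
  bialgebra morphism, the values on generators because
  \<open>\<lambda>\<^sub>i \<lambda>\<^sub>m\<inverse> \<lambda>\<^sub>j \<lambda>\<^sub>n\<inverse> c\<^sub>j\<^sub>i\<^sup>m\<^sup>n = c\<^sub>j\<^sub>i\<^sup>m\<^sup>n\<close>.
\<close>

lemma form_invariant:
  assumes tw: "is_frt_twist N A T lam \<alpha>"
  shows "frt_form N c A T = frt_form N c A T \<circ> tensor_square_map A \<alpha>"
proof -
  interpret frt_twist A N c T \<alpha>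
    using tw by unfold_locales (simp add: is_frt_twist_def)
  have tg: "\<alpha> (T i j) = scl A (lam i * inverse (lam j)) (T i j)" if "i \<in> {1..N}" "j \<in> {1..N}" for i j
    using tw that by (simp add: is_frt_twist_def)
  let ?R = "frt_form N c A T"
  let ?R' = "?R \<circ> tensor_square_map A \<alpha>"
  have R: "is_frt_form N c A T ?R" by (simp add: is_frt_form_iff)
  note lR = is_frt_formD(1)[OF R]
  note S = linear_square_map[OF linear_twist]
  have R': "?R' (x \<otimes> y) = ?R (\<alpha> x \<otimes> \<alpha> y)" for x y by (simp add: S(2))
  note f = functional_form[OF lR]
  have "is_frt_form N c A T ?R'"
    unfolding is_frt_form_def
  proof (intro conjI ballI allI)
    show "Vector_Spaces.linear (scl2 A) (*) ?R'"
      by (rule Vector_Spaces.linear_compose[OF S(1) lR])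
    show "?R' (1 \<otimes> 1) = 1" by (simp only: R' twist_one is_frt_formD(2)[OF R])
    fix i j assume ij: "i \<in> {1..N}" "j \<in> {1..N}"
    show "?R' (1 \<otimes> T i j) = (if i = j then 1 else 0)" "?R' (T i j \<otimes> 1) = (if i = j then 1 else 0)"
      unfolding R' twist_one tg[OF ij] sq.tens_simps linear_scaleD[OF lR] is_frt_formD(3,4)[OF R ij]
      using lam_nonzero[OF ij(1)] by auto
    fix m n assume mn: "m \<in> {1..N}" "n \<in> {1..N}"
    show "?R' (T i m \<otimes> T j n) = c j i m n"
      unfolding R' tg[OF ij(1) mn(1)] tg[OF ij(2) mn(2)] sq.tens_simps linear_scaleD[OF lR]
        is_frt_formD(5)[OF R ij mn]
      using lam_compatible[OF ij(2,1) mn] lam_nonzero[OF mn(1)] lam_nonzero[OF mn(2)]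
      by (simp add: field_simps)
  next
    fix x y z
    have "?R' ((x * y) \<otimes> z) = pair_eval (\<lambda>a. ?R (\<alpha> x \<otimes> a)) (\<lambda>a. ?R (\<alpha> y \<otimes> a)) (tensor_square_map A \<alpha> (\<Delta> z))"
      unfolding R' twist_mult is_frt_formD(6)[OF R] convolution_def sweedler_def twist_comult ..
    also have "\<dots> = pair_eval (\<lambda>a. ?R' (x \<otimes> a)) (\<lambda>a. ?R' (y \<otimes> a)) (\<Delta> z)"
      unfolding lift_square_map[OF linear_twist bilinear_functionals[OF f(2) f(2)]] R' ..
    finally show "?R' ((x * y) \<otimes> z) = pair_eval (\<lambda>a. ?R' (x \<otimes> a)) (\<lambda>a. ?R' (y \<otimes> a)) (\<Delta> z)" .
    have "?R' (x \<otimes> (y * z)) = pair_eval (\<lambda>a. ?R (a \<otimes> \<alpha> z)) (\<lambda>a. ?R (a \<otimes> \<alpha> y)) (tensor_square_map A \<alpha> (\<Delta> x))"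
      unfolding R' twist_mult is_frt_formD(7)[OF R] convolution_def sweedler_def twist_comult ..
    also have "\<dots> = pair_eval (\<lambda>a. ?R' (a \<otimes> z)) (\<lambda>a. ?R' (a \<otimes> y)) (\<Delta> x)"
      unfolding lift_square_map[OF linear_twist bilinear_functionals[OF f(1) f(1)]] R' ..
    finally show "?R' (x \<otimes> (y * z)) = pair_eval (\<lambda>a. ?R' (a \<otimes> z)) (\<lambda>a. ?R' (a \<otimes> y)) (\<Delta> x)" .
  qed
  then show ?thesis by (simp only: is_frt_form_iff)
qed

end

end

theorem corollary4p4:
  fixes V :: "('k::field_char_0, 'v::ab_group_add, 'vv::ab_group_add, 'vvv::ab_group_add) tensor_space"
    and A :: "('k, 'a::ring_1, 'aa::ab_group_add, 'aaa::ab_group_add) tensor_space"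
    and N :: nat
    and v :: "nat \<Rightarrow> 'v"
    and \<gamma> :: "'vv \<Rightarrow> 'vv"
    and c :: "nat \<Rightarrow> nat \<Rightarrow> nat \<Rightarrow> nat \<Rightarrow> 'k"
    and T :: "nat \<Rightarrow> nat \<Rightarrow> 'a"
    and lam :: "nat \<Rightarrow> 'k"
  assumes V: "tensor_cube V"
    and basis: "inj_on v {1..N}" "\<not> module.dependent (scl V) (v ` {1..N})"
      "module.span (scl V) (v ` {1..N}) = UNIV"
    and gamma: "R_matrix V \<gamma>"
    and structure_constants: "\<And>i j. i \<in> {1..N} \<Longrightarrow> j \<in> {1..N} \<Longrightarrow>
      \<gamma> (v i \<otimes>\<^bsub>V\<^esub> v j) = (\<Sum>m=1..N. \<Sum>n=1..N. scl2 V (c i j m n) (v m \<otimes>\<^bsub>V\<^esub> v n))"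
    and A: "tensor_cube A"
    and frt: "frt_algebra N c (scl A) T"
    and lam_invertible: "\<And>i. i \<in> {1..N} \<Longrightarrow> lam i \<noteq> 0"
    and lam_compatible: "\<And>i j m n. i \<in> {1..N} \<Longrightarrow> j \<in> {1..N} \<Longrightarrow> m \<in> {1..N} \<Longrightarrow> n \<in> {1..N} \<Longrightarrow>
      lam i * lam j * c i j m n = lam m * lam n * c i j m n"
  shows "(\<exists>!\<alpha>. is_frt_twist N A T lam \<alpha>) \<and>
    (\<forall>\<alpha>. is_frt_twist N A T lam \<alpha> \<longrightarrow>
      (let \<mu> = mult_map A; \<Delta> = frt_comult N A T; R = frt_form N c A T;
           \<mu>\<^sub>\<alpha> = \<alpha> \<circ> \<mu>; \<Delta>\<^sub>\<alpha> = \<Delta> \<circ> \<alpha>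
       in cobraided_hom_bialgebra A \<mu>\<^sub>\<alpha> \<Delta>\<^sub>\<alpha> \<alpha> R \<and>
          R = R \<circ> tensor_square_map A \<alpha> \<and>
          (\<forall>i\<in>{1..N}. \<forall>j\<in>{1..N}.
             \<Delta>\<^sub>\<alpha> (T i j) = scl2 A (lam i * inverse (lam j)) (\<Delta> (T i j)) \<and>
             scl2 A (lam i * inverse (lam j)) (\<Delta> (T i j)) =
               scl2 A (lam i * inverse (lam j)) (\<Sum>k=1..N. T i k \<otimes>\<^bsub>A\<^esub> T k j))))"
proof -
  interpret V: based_R_matrix V N v \<gamma> c
    using V basis(1,2) gamma structure_constants
    by (simp add: based_R_matrix_def based_R_matrix_axioms_def del: atLeastAtMost_iff)
  interpret frt_quantum_group A N c T
    using A frt V.yang_baxter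
    by (simp add: frt_quantum_group_def frt_quantum_group_axioms_def frt_algebra_cube_def
        frt_algebra_cube_axioms_def del: atLeastAtMost_iff)
  have "\<exists>!\<alpha>. is_frt_twist N A T lam \<alpha>"
  proof (rule ex_ex1I)
    show "\<exists>\<alpha>. is_frt_twist N A T lam \<alpha>" by (rule ex_twist[OF lam_invertible lam_compatible])
  qed (rule twist_unique)
  moreover have "cobraided_hom_bialgebra A (\<alpha> \<circ> mult_map A) (\<Delta> \<circ> \<alpha>) \<alpha> (frt_form N c A T)"
    "frt_form N c A T = frt_form N c A T \<circ> tensor_square_map A \<alpha>"
    "\<forall>i\<in>{1..N}. \<forall>j\<in>{1..N}.
       (\<Delta> \<circ> \<alpha>) (T i j) = scl2 A (lam i * inverse (lam j)) (\<Delta> (T i j)) \<and>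
       scl2 A (lam i * inverse (lam j)) (\<Delta> (T i j)) =
         scl2 A (lam i * inverse (lam j)) (\<Sum>k=1..N. T i k \<otimes>\<^bsub>A\<^esub> T k j)"
    if tw: "is_frt_twist N A T lam \<alpha>" for \<alpha>
  proof -
    interpret frt_twist A N c T \<alpha>
      using tw by unfold_locales (simp add: is_frt_twist_def)
    show "cobraided_hom_bialgebra A (\<alpha> \<circ> mult_map A) (\<Delta> \<circ> \<alpha>) \<alpha> (frt_form N c A T)"
      by (rule cobraided)
    show "frt_form N c A T = frt_form N c A T \<circ> tensor_square_map A \<alpha>"
      by (rule form_invariant[OF lam_invertible lam_compatible tw])
    show "\<forall>i\<in>{1..N}. \<forall>j\<in>{1..N}.
       (\<Delta> \<circ> \<alpha>) (T i j) = scl2 A (lam i * inverse (lam j)) (\<Delta> (T i j)) \<and>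
       scl2 A (lam i * inverse (lam j)) (\<Delta> (T i j)) =
         scl2 A (lam i * inverse (lam j)) (\<Sum>k=1..N. T i k \<otimes>\<^bsub>A\<^esub> T k j)"
      using tw by (simp add: is_frt_twist_def linear_scaleD[OF linear_comult] comult_gen
          del: atLeastAtMost_iff)
  qed
  ultimately show ?thesis unfolding Let_def by blast
qed

end
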